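(* Let $d\ge1$ and let $0<\chi_1<\dots<\chi_d$ be real numbers. There exists a function $f:[1,\infty)\to[1,\infty)$, depending only on $d$ and $\chi_1,\dots,\chi_d$, such that for every $0<\epsilon<1$ there exists $\delta>0$ for which the following holds. Let $m_1,\dots,m_d,k_1,\dots,k_d,n\in\mathbb{Z}_{>0}$ be such that $m_d\ge f(\epsilon^{-1})$, $n\ge f(k_1)$, $k_j\ge f(m_j)$ for $1\le j\le d$, and $m_j\ge f(k_{j+1})$ for $1\le j<d$. Let $\theta$ be a compactly supported Borel probability measure on $\mathbb{R}^d$ with $\mathrm{diam}(\mathrm{supp}(\theta))\le\epsilon^{-1}$ and $\frac1nH(\theta,\mathcal{E}_n)>\epsilon$. For $1\le j\le d$ let $Q_j$ be the set of all integers $1\le q\le n$ such that $$\frac1{m_j}H\left(\theta^{*k_j},\mathcal{E}_{q+m_j}\mid\mathcal{E}_q\vee\pi_{[d]\setminus\{j\}}^{-1}\mathcal{E}_{q+m_j}\right)>\chi_j-\epsilon.$$ Then there exists $1\le j\le d$ such that $\frac1n|Q_j|>\delta$.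
   Context: Logarithms are base $2$; $[d]:=\{1,\dots,d\}$. For $t\in\mathbb{R}$, $\mathcal{D}^1_t$ is the partition of $\mathbb{R}$ into intervals $[k2^{-\lfloor t\rfloor},(k+1)2^{-\lfloor t\rfloor})$, $k\in\mathbb{Z}$. For $n\in\mathbb{Z}$, $\mathcal{E}_n:=\{D_1\times\dots\times D_d: D_j\in\mathcal{D}^1_{\chi_jn}\text{ for }1\le j\le d\}$, a partition of $\mathbb{R}^d$. For $J\subset[d]$, $\pi_J$ is the orthogonal projection of $\mathbb{R}^d$ onto $\mathrm{span}\{e_j:j\in J\}$, and $\pi_J^{-1}\mathcal{E}_n:=\{\pi_J^{-1}(E):E\in\mathcal{E}_n\}$ (discarding empty sets). $\mathcal{D}\vee\mathcal{E}$ is the common refinement of partitions. $\theta^{*k}$ is the $k$-fold convolution of $\theta$ with itself. $H(\theta,\mathcal{D}):=-\sum_{D\in\mathcal{D}}\theta(D)\log\theta(D)$ and $H(\theta,\mathcal{D}\mid\mathcal{E}):=\sum_{E\in\mathcal{E},\,\theta(E)>0}\theta(E)H(\theta_E,\mathcal{D})$ with $\theta_E:=\theta(E)^{-1}\theta|_E$. *)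

theory Defs
  imports "HOL-Probability.Probability"
begin

text \<open>
  Points of d-dimensional space are vectors of type \<open>real ^ 'n\<close>; where the order of the
  coordinates matters, \<open>'n\<close> is a finite linear order, so that it plays the role of
  \<open>{1 < \<dots> < d}\<close> with \<open>d = CARD('n) \<ge> 1\<close>, and
  \<open>i < j \<and> {i<..<j} = {}\<close> says that \<open>j\<close> is the index following \<open>i\<close>.
\<close>

definition dyadic :: "real \<Rightarrow> real set set" where
  "dyadic t = range (\<lambda>k::int.
     {of_int k * 2 powi (- \<lfloor>t\<rfloor>) ..< (of_int k + 1) * 2 powi (- \<lfloor>t\<rfloor>)})"

definition box_partition :: "('n \<Rightarrow> real) \<Rightarrow> int \<Rightarrow> (real ^ 'n) set set" where
  "box_partition chi n =
     {{x. \<forall>j. x $ j \<in> D j} | D. \<forall>j. D j \<in> dyadic (chi j * of_int n)}"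

definition coord_proj :: "'n set \<Rightarrow> real ^ 'n \<Rightarrow> real ^ 'n" where
  "coord_proj J x = (\<chi> i. if i \<in> J then x $ i else 0)"

lemma coord_proj_orthogonal_projection:
  fixes J :: "'n::finite set" and x :: "real ^ 'n"
  shows "coord_proj J x \<in> span ((\<lambda>j. axis j 1) ` J)"
    and "y \<in> span ((\<lambda>j. axis j 1) ` J) \<Longrightarrow> orthogonal (x - coord_proj J x) y"
proof -
  have "coord_proj J x = (\<Sum>j\<in>J. x $ j *\<^sub>R axis j 1)"
    by (simp add: vec_eq_iff coord_proj_def axis_def if_distrib [of "\<lambda>z. _ * z"] cong: if_cong)
  then show "coord_proj J x \<in> span ((\<lambda>j. axis j 1) ` J)"
    by (simp add: span_sum span_scale span_base)
  show "orthogonal (x - coord_proj J x) y" if "y \<in> span ((\<lambda>j. axis j 1) ` J)"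
    by (rule orthogonal_to_span [OF that])
      (auto simp: orthogonal_def inner_axis coord_proj_def)
qed

definition pullback_partition :: "('a \<Rightarrow> 'b) \<Rightarrow> 'b set set \<Rightarrow> 'a set set" where
  "pullback_partition g P = {g -` E | E. E \<in> P} - {{}}"

definition common_refinement :: "'a set set \<Rightarrow> 'a set set \<Rightarrow> 'a set set" where
  "common_refinement P R = {D \<inter> E | D E. D \<in> P \<and> E \<in> R} - {{}}"

text \<open>
  The sums below range over countable partitions.  For a compactly supported measure and the
  partitions used here only finitely many terms are nonzero, so that \<open>infsum\<close>
  never takes its default value for non-summable families.  The conditional measure
  \<open>\<theta>\<^sub>E\<close> is \<open>uniform_measure \<theta> E\<close>.
\<close>

definition partition_entropy :: "'a measure \<Rightarrow> 'a set set \<Rightarrow> real" where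
  "partition_entropy \<theta> P = - (\<Sum>\<^sub>\<infinity>D\<in>P. measure \<theta> D * log 2 (measure \<theta> D))"

definition cond_partition_entropy :: "'a measure \<Rightarrow> 'a set set \<Rightarrow> 'a set set \<Rightarrow> real" where
  "cond_partition_entropy \<theta> P R =
     (\<Sum>\<^sub>\<infinity>E\<in>{E\<in>R. measure \<theta> E > 0}.
        measure \<theta> E * partition_entropy (uniform_measure \<theta> E) P)"

primrec convolution_power :: "'a::ordered_euclidean_space measure \<Rightarrow> nat \<Rightarrow> 'a measure" where
  "convolution_power \<theta> 0 = return borel 0"
| "convolution_power \<theta> (Suc k) = convolution \<theta> (convolution_power \<theta> k)"

definition measure_support :: "'a::topological_space measure \<Rightarrow> 'a set" where
  "measure_support \<theta> = {x. \<forall>U. open U \<and> x \<in> U \<longrightarrow> emeasure \<theta> U > 0}"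

definition high_entropy_scales ::
  "('n::finite \<Rightarrow> real) \<Rightarrow> (real ^ 'n) measure \<Rightarrow> real \<Rightarrow> ('n \<Rightarrow> nat) \<Rightarrow> ('n \<Rightarrow> nat) \<Rightarrow> nat \<Rightarrow> 'n \<Rightarrow> int set"
where
  "high_entropy_scales chi \<theta> \<epsilon> m k n j =
     {q. 1 \<le> q \<and> q \<le> int n \<and>
        1 / real (m j) *
          cond_partition_entropy (convolution_power \<theta> (k j))
            (box_partition chi (q + int (m j)))
            (common_refinement (box_partition chi q)
              (pullback_partition (coord_proj (UNIV - {j}))
                (box_partition chi (q + int (m j)))))
        > chi j - \<epsilon>}"

end

theory Submission
  imports Defs
begin

text \<open>
  Let \<open>S\<close> be the sum of \<open>K\<close> independent vectors with law \<open>\<theta>\<close>, rounded to its cells. If, given its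
  cell at some scale, the \<open>j\<close>-th coordinate of \<open>S\<close> still carries a bounded amount of entropy at finer
  scales, then a small ball estimate shows that the sum of many independent copies of \<open>S\<close> has almost
  full entropy in the direction \<open>j\<close> at slightly coarser scales; this remains true when some further
  coordinates \<open>J\<close> are fixed at finer scales. Let \<open>G J\<close> be the entropy of the coordinates \<open>J\<close> over a
  block of scales, given all coordinates at the start of the block. Averaged over the position of the
  block, \<open>G J\<close> essentially increases with the length of the block and with \<open>K\<close>, so by the pigeonhole
  principle some bounded \<open>K\<close> and block length are almost stationary. There the estimate above forces
  every increment \<open>G (J \<union> {i}) - G J\<close> to be negligible or almost maximal, at most positions. As \<open>G\<close> is
  submodular and the exponents are distinct, \<open>G\<close> is then almost additive, so that a coordinate \<open>j\<close>
  which carries entropy at all also carries entropy given the other coordinates. Applying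
  the estimate once more, with \<open>J\<close> the set of all other coordinates, shows that the direction \<open>j\<close> is
  almost saturated.
\<close>

section \<open>Entropy of functions on a finite probability space\<close>

text \<open>Distinct exponents are essential: for equal ones, a measure on the diagonal has entropy
  in each coordinate but none given the other. Submodularity and the dichotomy rule this out because
  the total weight must come out the same in whatever order the coordinates are added.

  The obstacle is the conditioning. The small ball estimate allows the other coordinates to be fixed
  only at coarser scales than those of the summands, since the rounding errors of
  \<open>4 ^ (a + b)\<close> summands use up \<open>2 * (a + b)\<close> binary digits. So the
  coordinates in \<open>J\<close> have to start a gap of \<open>R\<close> scales finer, and the
  remaining ones end a gap coarser. Every such change of conditioning costs a \<open>defect\<close>,
  a failure of additivity in the block length; the defects are small on average when the block
  length is almost stationary. Stationarity in \<open>K\<close> serves to transport what is proved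
  for more copies back to the original number. All other losses are bounded per block, so that long
  blocks make them negligible.\<close>

lemma expectation_finite:
  fixes f :: "'a \<Rightarrow> real"
  assumes "finite (set_pmf P)"
  shows "measure_pmf.expectation P f = (\<Sum>x\<in>set_pmf P. pmf P x * f x)"
  using integral_measure_pmf[OF assms, of P f] by simp

lemma sum_pmf_set: "finite (set_pmf P) \<Longrightarrow> (\<Sum>x\<in>set_pmf P. pmf P x) = 1"
  by (rule sum_pmf_eq_1) auto

lemma prob_finite:
  assumes "finite (set_pmf P)"
  shows "measure_pmf.prob P A = (\<Sum>x\<in>set_pmf P. if x \<in> A then pmf P x else 0)"
proof -
  have "measure_pmf.prob P A = measure_pmf.prob P (A \<inter> set_pmf P)"
    by (rule measure_Int_set_pmf[symmetric])
  also have "\<dots> = sum (pmf P) (A \<inter> set_pmf P)"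
    using assms by (simp add: measure_measure_pmf_finite)
  also have "\<dots> = (\<Sum>x\<in>set_pmf P. if x \<in> A then pmf P x else 0)"
    by (subst Int_commute, rule sum.inter_restrict[OF assms])
  finally show ?thesis .
qed

lemma sum_prob_fibers:
  assumes fin: "finite (set_pmf P)"
  shows "(\<Sum>x\<in>f ` set_pmf P. measure_pmf.prob P {w. f w = x \<and> R w}) = measure_pmf.prob P {w. R w}"
proof -
  have "(\<Sum>x\<in>f ` set_pmf P. measure_pmf.prob P {w. f w = x \<and> R w}) =
      (\<Sum>x\<in>f ` set_pmf P. \<Sum>w\<in>{w\<in>set_pmf P. f w = x}. if R w then pmf P w else 0)"
    unfolding prob_finite[OF fin] sum.inter_filter[OF fin]
    by (intro sum.cong refl) auto
  also have "\<dots> = (\<Sum>w\<in>set_pmf P. if R w then pmf P w else 0)"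
    by (rule sum.image_gen[OF fin, symmetric])
  finally show ?thesis by (simp add: prob_finite[OF fin])
qed

definition fiber_prob :: "'a pmf \<Rightarrow> ('a \<Rightarrow> 'b) \<Rightarrow> 'a \<Rightarrow> real" where
  "fiber_prob P f w = measure_pmf.prob P {w'. f w' = f w}"

text \<open>Shannon entropy as the mean information content of a sample point. Averaging over sample
  points instead of summing over values leaves the value type arbitrary: only the fibres of
  \<open>f\<close> matter.\<close>

definition ent :: "'a pmf \<Rightarrow> ('a \<Rightarrow> 'b) \<Rightarrow> real" where
  "ent P f = measure_pmf.expectation P (\<lambda>w. - log 2 (fiber_prob P f w))"

definition cond_ent :: "'a pmf \<Rightarrow> ('a \<Rightarrow> 'b) \<Rightarrow> ('a \<Rightarrow> 'c) \<Rightarrow> real" where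
  "cond_ent P f g = ent P (\<lambda>w. (f w, g w)) - ent P g"

lemma fiber_prob_pos: "w \<in> set_pmf P \<Longrightarrow> 0 < fiber_prob P f w"
  unfolding fiber_prob_def by (rule measure_pmf_posI[of w]) auto

lemma fiber_prob_finite:
  "finite (set_pmf P) \<Longrightarrow>
    fiber_prob P f w = (\<Sum>w'\<in>set_pmf P. if f w' = f w then pmf P w' else 0)"
  by (simp add: fiber_prob_def prob_finite)

lemma fiber_prob_mono:
  assumes "\<And>w'. w' \<in> set_pmf P \<Longrightarrow> f w' = f w \<Longrightarrow> g w' = g w"
  shows "fiber_prob P f w \<le> fiber_prob P g w"
  unfolding fiber_prob_def
  by (subst (1 2) measure_Int_set_pmf[symmetric], rule measure_pmf.finite_measure_mono) (use assms in auto)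

lemma ent_finite:
  "finite (set_pmf P) \<Longrightarrow> ent P f = (\<Sum>w\<in>set_pmf P. pmf P w * - log 2 (fiber_prob P f w))"
  by (simp add: ent_def expectation_finite sum_negf)

lemma ent_map_pmf: "ent (map_pmf g P) f = ent P (\<lambda>w. f (g w))"
  by (simp add: ent_def fiber_prob_def vimage_def)

lemma ent_mono:
  assumes fin: "finite (set_pmf P)"
    and "\<And>w w'. w \<in> set_pmf P \<Longrightarrow> w' \<in> set_pmf P \<Longrightarrow> f w = f w' \<Longrightarrow> g w = g w'"
  shows "ent P g \<le> ent P f"
proof -
  have "log 2 (fiber_prob P f w) \<le> log 2 (fiber_prob P g w)" if "w \<in> set_pmf P" for w
    using that assms(2) fiber_prob_pos[OF that, of f]
    by (subst log_le_cancel_iff) (auto intro!: fiber_prob_mono fiber_prob_pos)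
  then show ?thesis
    unfolding ent_finite[OF fin] by (intro sum_mono mult_left_mono) auto
qed

lemma ent_cong:
  assumes "finite (set_pmf P)"
    and "\<And>w w'. w \<in> set_pmf P \<Longrightarrow> w' \<in> set_pmf P \<Longrightarrow> f w = f w' \<longleftrightarrow> g w = g w'"
  shows "ent P g = ent P f"
  by (rule antisym; rule ent_mono) (use assms in blast)+

text \<open>The division removes the multiplicity of a value, so that an expectation of density
  quotients becomes a sum of weights over the attained values. Combined with Jensen's inequality
  this yields the Gibbs type bounds below.\<close>

lemma expectation_div_fiber_prob:
  fixes F :: "'b \<Rightarrow> real"
  assumes fin: "finite (set_pmf P)"
  shows "measure_pmf.expectation P (\<lambda>w. F (f w) / fiber_prob P f w) = (\<Sum>x\<in>f ` set_pmf P. F x)"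
proof -
  have "(\<Sum>w\<in>set_pmf P. pmf P w * (F (f w) / fiber_prob P f w)) =
      (\<Sum>x\<in>f ` set_pmf P. \<Sum>w\<in>{w\<in>set_pmf P. f w = x}. pmf P w * (F (f w) / fiber_prob P f w))"
    by (rule sum.image_gen[OF fin])
  also have "\<dots> = (\<Sum>x\<in>f ` set_pmf P. F x)"
  proof (rule sum.cong[OF refl])
    fix x assume "x \<in> f ` set_pmf P"
    then obtain w0 where w: "w0 \<in> set_pmf P" "x = f w0" by auto
    have *: "fiber_prob P f w = fiber_prob P f w0" if "f w = x" for w
      using that w by (simp add: fiber_prob_def)
    have sub: "(\<Sum>w\<in>{w\<in>set_pmf P. f w = x}. pmf P w) = fiber_prob P f w0"
      using fin w by (simp add: fiber_prob_finite sum.inter_filter)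
    have "(\<Sum>w\<in>{w\<in>set_pmf P. f w = x}. pmf P w * (F (f w) / fiber_prob P f w)) =
        (\<Sum>w\<in>{w\<in>set_pmf P. f w = x}. pmf P w * (F x / fiber_prob P f w0))"
      by (rule sum.cong) (auto simp: *)
    also have "\<dots> = fiber_prob P f w0 * (F x / fiber_prob P f w0)"
      by (simp only: sum_distrib_right[symmetric] sub)
    also have "\<dots> = F x" using fiber_prob_pos[OF w(1), of f] by simp
    finally show "(\<Sum>w\<in>{w\<in>set_pmf P. f w = x}. pmf P w * (F (f w) / fiber_prob P f w)) = F x" .
  qed
  finally show ?thesis by (simp add: expectation_finite[OF fin])
qed

lemma log2_le_linear:
  fixes a N :: real
  assumes "0 < a" "0 < N"
  shows "log 2 a \<le> log 2 N + (a / N - 1) / ln 2"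
proof -
  have "ln (a / N) \<le> a / N - 1" using assms by (intro ln_le_minus_one) auto
  then have "ln a \<le> ln N + (a / N - 1)" using assms by (simp add: ln_div)
  then show ?thesis by (simp add: log_def field_simps)
qed

text \<open>Jensen's inequality, from the tangent of the logarithm at \<open>N\<close>.\<close>

lemma expectation_log_le:
  assumes fin: "finite (set_pmf P)" and "0 < N"
    and pos: "\<And>w. w \<in> set_pmf P \<Longrightarrow> 0 < a w"
    and le: "measure_pmf.expectation P a \<le> N"
  shows "measure_pmf.expectation P (\<lambda>w. log 2 (a w)) \<le> log 2 N"
proof -
  have "(\<Sum>w\<in>set_pmf P. pmf P w * log 2 (a w)) \<le>
      (\<Sum>w\<in>set_pmf P. pmf P w * (log 2 N + (a w / N - 1) / ln 2))"
    by (intro sum_mono mult_left_mono log2_le_linear pos \<open>0 < N\<close>) auto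
  also have "\<dots> = (\<Sum>w\<in>set_pmf P. pmf P w * (log 2 N - 1 / ln 2) + pmf P w * a w * (1 / (N * ln 2)))"
    using \<open>0 < N\<close> by (intro sum.cong refl) (simp add: field_simps)
  also have "\<dots> = (log 2 N - 1 / ln 2) + (\<Sum>w\<in>set_pmf P. pmf P w * a w) * (1 / (N * ln 2))"
    unfolding sum.distrib sum_distrib_right[symmetric] by (simp add: sum_pmf_set[OF fin])
  also have "\<dots> \<le> (log 2 N - 1 / ln 2) + N * (1 / (N * ln 2))"
    using le \<open>0 < N\<close> by (intro add_left_mono mult_right_mono) (auto simp: expectation_finite[OF fin])
  also have "\<dots> = log 2 N" using \<open>0 < N\<close> by simp
  finally show ?thesis by (simp add: expectation_finite[OF fin])
qed

lemma cond_ent_alt: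
  assumes fin: "finite (set_pmf P)"
  shows "cond_ent P f g =
    measure_pmf.expectation P (\<lambda>w. log 2 (fiber_prob P g w / fiber_prob P (\<lambda>w. (f w, g w)) w))"
proof -
  have "log 2 (fiber_prob P g w / fiber_prob P (\<lambda>w. (f w, g w)) w) =
      - log 2 (fiber_prob P (\<lambda>w. (f w, g w)) w) - - log 2 (fiber_prob P g w)"
    if "w \<in> set_pmf P" for w
    using fiber_prob_pos[OF that, of g] fiber_prob_pos[OF that, of "\<lambda>w. (f w, g w)"]
    by (simp add: log_divide)
  then show ?thesis
    unfolding cond_ent_def ent_finite[OF fin] expectation_finite[OF fin]
      sum_subtractf[symmetric] right_diff_distrib[symmetric]
    by (intro sum.cong) auto
qed

text \<open>Gibbs' inequality against the law \<open>F\<close> under which \<open>f\<close> and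
  \<open>h\<close> are conditionally independent given \<open>g\<close>; its mass on the attained
  triples is at most 1.\<close>

lemma cond_ent_antimono:
  assumes fin: "finite (set_pmf P)"
  shows "cond_ent P f (\<lambda>w. (g w, h w)) \<le> cond_ent P f g"
proof -
  let ?S = "set_pmf P"
  let ?fg = "\<lambda>w. (f w, g w)" and ?gh = "\<lambda>w. (g w, h w)" and ?fgh = "\<lambda>w. (f w, g w, h w)"
  define pfg where "pfg x y = measure_pmf.prob P {w. f w = x \<and> g w = y}" for x y
  define pgh where "pgh y z = measure_pmf.prob P {w. g w = y \<and> h w = z}" for y z
  define pg where "pg y = measure_pmf.prob P {w. g w = y}" for y
  have nn: "0 \<le> pfg x y" "0 \<le> pgh y z" "0 \<le> pg y" for x y z
    by (auto simp: pfg_def pgh_def pg_def)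
  define F where "F = (\<lambda>(x, y, z). pfg x y * pgh y z / pg y)"
  have sum_pfg: "(\<Sum>x\<in>f ` ?S. pfg x y) = pg y" for y
    unfolding pfg_def pg_def by (rule sum_prob_fibers[OF fin])
  have sum_pgh: "(\<Sum>z\<in>h ` ?S. pgh y z) = pg y" for y
    unfolding pgh_def pg_def by (subst conj_commute, rule sum_prob_fibers[OF fin])
  have sum_pg: "(\<Sum>y\<in>g ` ?S. pg y) = 1"
    using sum_prob_fibers[OF fin, of g "\<lambda>_. True"] by (simp add: pg_def)
  have "measure_pmf.expectation P (\<lambda>w. F (?fgh w) / fiber_prob P ?fgh w) = (\<Sum>t\<in>?fgh ` ?S. F t)"
    by (rule expectation_div_fiber_prob[OF fin])
  also have "\<dots> \<le> (\<Sum>t\<in>(f ` ?S) \<times> ((g ` ?S) \<times> (h ` ?S)). F t)"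
    using fin nn by (intro sum_mono2) (auto simp: F_def)
  also have "\<dots> = (\<Sum>x\<in>f ` ?S. \<Sum>y\<in>g ` ?S. \<Sum>z\<in>h ` ?S. pfg x y * pgh y z / pg y)"
    by (simp add: sum.cartesian_product F_def split_def)
  also have "\<dots> = (\<Sum>y\<in>g ` ?S. \<Sum>x\<in>f ` ?S. \<Sum>z\<in>h ` ?S. pfg x y * pgh y z / pg y)"
    by (rule sum.swap)
  also have "\<dots> = (\<Sum>y\<in>g ` ?S. \<Sum>x\<in>f ` ?S. pfg x y * (\<Sum>z\<in>h ` ?S. pgh y z) / pg y)"
    by (simp add: sum_distrib_left sum_divide_distrib)
  also have "\<dots> = (\<Sum>y\<in>g ` ?S. (\<Sum>x\<in>f ` ?S. pfg x y) * pg y / pg y)"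
    by (simp add: sum_pgh sum_distrib_right sum_divide_distrib)
  also have "\<dots> = 1" by (simp add: sum_pfg sum_pg)
  finally have le1: "measure_pmf.expectation P (\<lambda>w. F (?fgh w) / fiber_prob P ?fgh w) \<le> 1" .
  have F_eq: "F (?fgh w) = fiber_prob P ?fg w * fiber_prob P ?gh w / fiber_prob P g w" for w
    by (simp add: F_def pfg_def pgh_def pg_def fiber_prob_def)
  have "measure_pmf.expectation P (\<lambda>w. log 2 (F (?fgh w) / fiber_prob P ?fgh w)) \<le> log 2 1"
    by (rule expectation_log_le[OF fin]) (use le1 in \<open>auto simp: F_eq intro!: divide_pos_pos mult_pos_pos fiber_prob_pos\<close>)
  moreover have "measure_pmf.expectation P (\<lambda>w. log 2 (F (?fgh w) / fiber_prob P ?fgh w)) =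
      ent P ?fgh + ent P g - ent P ?fg - ent P ?gh"
  proof -
    have *: "log 2 (F (?fgh w) / fiber_prob P ?fgh w) = log 2 (fiber_prob P ?fg w) + log 2 (fiber_prob P ?gh w)
       - log 2 (fiber_prob P g w) - log 2 (fiber_prob P ?fgh w)" if "w \<in> ?S" for w
      using fiber_prob_pos[OF that, of ?fg] fiber_prob_pos[OF that, of ?gh]
        fiber_prob_pos[OF that, of g] fiber_prob_pos[OF that, of ?fgh]
      by (simp add: F_eq log_divide log_mult)
    show ?thesis
      unfolding ent_finite[OF fin] expectation_finite[OF fin]
        sum_subtractf[symmetric] sum.distrib[symmetric]
      by (intro sum.cong refl) (simp only: *, simp add: algebra_simps)
  qed
  ultimately show ?thesis unfolding cond_ent_def by simp
qed

lemma cond_ent_antimono':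
  assumes fin: "finite (set_pmf P)"
    and det: "\<And>w w'. w \<in> set_pmf P \<Longrightarrow> w' \<in> set_pmf P \<Longrightarrow> k w = k w' \<Longrightarrow> g w = g w'"
  shows "cond_ent P f k \<le> cond_ent P f g"
proof -
  have "cond_ent P f k = cond_ent P f (\<lambda>w. (g w, k w))"
    unfolding cond_ent_def
    by (rule arg_cong2[of _ _ _ _ "(-)"]; rule ent_cong[OF fin]) (use det in blast)+
  then show ?thesis using cond_ent_antimono[OF fin, of f g k] by simp
qed

lemma cond_ent_mono:
  assumes fin: "finite (set_pmf P)"
    and det: "\<And>w w'. w \<in> set_pmf P \<Longrightarrow> w' \<in> set_pmf P \<Longrightarrow> f w = f w' \<Longrightarrow> g w = g w' \<Longrightarrow> k w = k w'"
  shows "cond_ent P k g \<le> cond_ent P f g"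
  unfolding cond_ent_def by (rule diff_right_mono, rule ent_mono[OF fin]) (use det in blast)

lemma cond_ent_chain:
  assumes fin: "finite (set_pmf P)"
  shows "cond_ent P (\<lambda>w. (f w, g w)) h = cond_ent P g h + cond_ent P f (\<lambda>w. (g w, h w))"
  unfolding cond_ent_def using ent_cong[OF fin, of "\<lambda>w. ((f w, g w), h w)" "\<lambda>w. (f w, (g w, h w))"]
  by auto

text \<open>Lattice form of \<open>cond_ent_antimono\<close>: \<open>m\<close> is a common
  coarsening of \<open>f\<close> and \<open>g\<close>, and \<open>j\<close> is determined by the
  pair. For cells these will be the levels \<open>inf\<close> and \<open>sup\<close>.\<close>

lemma ent_submodular:
  assumes fin: "finite (set_pmf P)"
    and det_f: "\<And>w w'. w \<in> set_pmf P \<Longrightarrow> w' \<in> set_pmf P \<Longrightarrow> f w = f w' \<Longrightarrow> m w = m w'"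
    and det_g: "\<And>w w'. w \<in> set_pmf P \<Longrightarrow> w' \<in> set_pmf P \<Longrightarrow> g w = g w' \<Longrightarrow> m w = m w'"
    and det_j: "\<And>w w'. w \<in> set_pmf P \<Longrightarrow> w' \<in> set_pmf P \<Longrightarrow> f w = f w' \<Longrightarrow> g w = g w' \<Longrightarrow> j w = j w'"
  shows "ent P j + ent P m \<le> ent P f + ent P g"
proof -
  have "ent P j \<le> ent P (\<lambda>w. (f w, g w))" by (rule ent_mono[OF fin]) (use det_j in blast)
  moreover have "cond_ent P f g \<le> cond_ent P f m" by (rule cond_ent_antimono'[OF fin]) (use det_g in blast)
  moreover have "ent P (\<lambda>w. (f w, m w)) = ent P f" by (rule ent_cong[OF fin]) (use det_f in blast)
  ultimately show ?thesis unfolding cond_ent_def by simp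
qed

text \<open>Gibbs' inequality with the probability of the value of \<open>g\<close> as weight of
  each attained pair: \<open>card\<close> bounds the total weight by \<open>N\<close>.\<close>

lemma cond_ent_le_log_card:
  fixes N :: nat
  assumes fin: "finite (set_pmf P)" and "0 < N"
    and card: "\<And>y. card (f ` {w \<in> set_pmf P. g w = y}) \<le> N"
  shows "cond_ent P f g \<le> log 2 (real N)"
proof -
  let ?S = "set_pmf P" let ?fg = "\<lambda>w. (f w, g w)"
  define pg where "pg y = measure_pmf.prob P {w. g w = y}" for y
  have im: "?fg ` ?S = (\<lambda>(y, x). (x, y)) ` (SIGMA y:g ` ?S. f ` {w \<in> ?S. g w = y})" by force
  have "measure_pmf.expectation P (\<lambda>w. (\<lambda>(x, y). pg y) (?fg w) / fiber_prob P ?fg w) =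
     (\<Sum>t\<in>?fg ` ?S. (\<lambda>(x, y). pg y) t)"
    by (rule expectation_div_fiber_prob[OF fin])
  also have "\<dots> = (\<Sum>(y, x)\<in>(SIGMA y:g ` ?S. f ` {w \<in> ?S. g w = y}). pg y)"
    unfolding im by (subst sum.reindex) (auto simp: inj_on_def split_def)
  also have "\<dots> = (\<Sum>y\<in>g ` ?S. \<Sum>x\<in>f ` {w \<in> ?S. g w = y}. pg y)"
    using fin by (subst sum.Sigma) auto
  also have "\<dots> = (\<Sum>y\<in>g ` ?S. real (card (f ` {w \<in> ?S. g w = y})) * pg y)" by simp
  also have "\<dots> \<le> (\<Sum>y\<in>g ` ?S. real N * pg y)"
    using card by (intro sum_mono mult_right_mono) (auto simp: pg_def)
  also have "\<dots> = real N"
    using sum_prob_fibers[OF fin, of g "\<lambda>_. True"] by (simp add: pg_def sum_distrib_left[symmetric])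
  finally have *: "measure_pmf.expectation P (\<lambda>w. fiber_prob P g w / fiber_prob P ?fg w) \<le> real N"
    by (simp add: pg_def fiber_prob_def)
  show ?thesis unfolding cond_ent_alt[OF fin]
    by (rule expectation_log_le[OF fin _ _ *]) (use \<open>0 < N\<close> in \<open>auto intro!: divide_pos_pos fiber_prob_pos\<close>)
qed

lemma ent_le_log_card:
  fixes N :: nat
  assumes fin: "finite (set_pmf P)" and card: "card (f ` set_pmf P) \<le> N"
  shows "ent P f \<le> log 2 (real N)"
proof -
  have "0 < card (f ` set_pmf P)" using fin set_pmf_not_empty[of P] by (auto simp: card_gt_0_iff)
  then have N: "0 < N" using card by simp
  have "cond_ent P f (\<lambda>_. ()) \<le> log 2 (real N)"
    by (rule cond_ent_le_log_card[OF fin N]) (use card in auto)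
  moreover have "ent P (\<lambda>w. (f w, ())) = ent P f" by (rule ent_cong[OF fin]) auto
  moreover have "ent P (\<lambda>_. ()) = 0" by (simp add: ent_def fiber_prob_def)
  ultimately show ?thesis by (simp add: cond_ent_def)
qed

section \<open>Conditionally independent copies\<close>

text \<open>\<open>copy_exp P c F\<close> is the expectation of \<open>F w w'\<close>, where \<open>w\<close> has law \<open>P\<close>
  and \<open>w'\<close> is drawn from \<open>P\<close> conditioned on \<open>c w' = c w\<close>.\<close>

definition copy_exp :: "'a pmf \<Rightarrow> ('a \<Rightarrow> 'c) \<Rightarrow> ('a \<Rightarrow> 'a \<Rightarrow> real) \<Rightarrow> real" where
  "copy_exp P c F = measure_pmf.expectation P (\<lambda>w.
     measure_pmf.expectation P (\<lambda>w'. if c w' = c w then F w w' else 0) / fiber_prob P c w)"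

lemma copy_exp_finite:
  assumes "finite (set_pmf P)"
  shows "copy_exp P c F = (\<Sum>w\<in>set_pmf P. \<Sum>w'\<in>set_pmf P.
    pmf P w * pmf P w' / fiber_prob P c w * (if c w' = c w then F w w' else 0))"
  by (simp add: copy_exp_def expectation_finite[OF assms] sum_distrib_left sum_divide_distrib mult.assoc)

lemma copy_exp_mono:
  assumes fin: "finite (set_pmf P)"
    and "\<And>w w'. w \<in> set_pmf P \<Longrightarrow> w' \<in> set_pmf P \<Longrightarrow> c w' = c w \<Longrightarrow> F w w' \<le> G w w'"
  shows "copy_exp P c F \<le> copy_exp P c G"
  unfolding copy_exp_finite[OF fin]
  by (intro sum_mono mult_left_mono) (auto intro!: assms divide_nonneg_nonneg simp: fiber_prob_def)

lemma copy_exp_cong: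
  assumes fin: "finite (set_pmf P)"
    and "\<And>w w'. w \<in> set_pmf P \<Longrightarrow> w' \<in> set_pmf P \<Longrightarrow> c w' = c w \<Longrightarrow> F w w' = G w w'"
  shows "copy_exp P c F = copy_exp P c G"
  by (rule antisym; rule copy_exp_mono[OF fin]) (use assms(2) in auto)

lemma copy_exp_add:
  assumes fin: "finite (set_pmf P)"
  shows "copy_exp P c (\<lambda>w w'. F w w' + G w w') = copy_exp P c F + copy_exp P c G"
  unfolding copy_exp_finite[OF fin] sum.distrib[symmetric]
  by (intro sum.cong refl) (auto simp: distrib_left add_divide_distrib)

lemma copy_exp_cmult:
  assumes fin: "finite (set_pmf P)"
  shows "copy_exp P c (\<lambda>w w'. a * F w w') = a * copy_exp P c F"
  unfolding copy_exp_finite[OF fin] sum_distrib_left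
  by (intro sum.cong refl) auto

lemma copy_exp_sum:
  assumes fin: "finite (set_pmf P)" and "finite I"
  shows "copy_exp P c (\<lambda>w w'. \<Sum>i\<in>I. F i w w') = (\<Sum>i\<in>I. copy_exp P c (F i))"
  using \<open>finite I\<close>
proof (induction I)
  case empty
  then show ?case by (simp add: copy_exp_def)
next
  case (insert i I)
  then show ?case by (simp add: copy_exp_add[OF fin])
qed

lemma copy_exp_fst:
  assumes fin: "finite (set_pmf P)"
  shows "copy_exp P c (\<lambda>w w'. g w) = measure_pmf.expectation P g"
proof -
  have "(\<Sum>w'\<in>set_pmf P. pmf P w * pmf P w' / fiber_prob P c w * (if c w' = c w then g w else 0)) = pmf P w * g w"
    if "w \<in> set_pmf P" for w
  proof -
    have "(\<Sum>w'\<in>set_pmf P. pmf P w * pmf P w' / fiber_prob P c w * (if c w' = c w then g w else 0)) =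
      (\<Sum>w'\<in>set_pmf P. pmf P w * g w / fiber_prob P c w * (if c w' = c w then pmf P w' else 0))"
      by (intro sum.cong refl) auto
    also have "\<dots> = pmf P w * g w / fiber_prob P c w * fiber_prob P c w"
      by (simp only: sum_distrib_left[symmetric] fiber_prob_finite[OF fin, symmetric])
    finally show ?thesis using fiber_prob_pos[OF that, of c] by simp
  qed
  then show ?thesis by (simp add: copy_exp_finite[OF fin] expectation_finite[OF fin])
qed

lemma copy_exp_const: "finite (set_pmf P) \<Longrightarrow> copy_exp P c (\<lambda>_ _. a) = a"
  using copy_exp_fst[of P c "\<lambda>_. a"] by simp

lemma copy_exp_swap:
  assumes fin: "finite (set_pmf P)"
  shows "copy_exp P c (\<lambda>w w'. F w' w) = copy_exp P c F"
proof -
  have *: "pmf P w * pmf P w' / fiber_prob P c w * (if c w' = c w then F w' w else 0) =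
      pmf P w' * pmf P w / fiber_prob P c w' * (if c w = c w' then F w' w else 0)" for w w'
  proof (cases "c w' = c w")
    case True
    have "fiber_prob P c w = fiber_prob P c w'" by (simp add: fiber_prob_def True)
    then show ?thesis by (simp only: True mult.commute[of "pmf P w"] refl if_True)
  next
    case False
    then have "c w \<noteq> c w'" by metis
    with False show ?thesis by (simp only: if_False)
  qed
  show ?thesis unfolding copy_exp_finite[OF fin]
    by (subst sum.swap) (intro sum.cong refl *)
qed

text \<open>Exchanging the two copies preserves their joint law. Below, this removes sines and cross
  terms without any centring of the variables.\<close>

lemma copy_exp_odd:
  assumes fin: "finite (set_pmf P)" and odd: "\<And>w w'. F w' w = - F w w'"
  shows "copy_exp P c F = 0"
proof -
  have "copy_exp P c (\<lambda>w w'. F w' w) = copy_exp P c (\<lambda>w w'. (-1) * F w w')"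
    by (rule arg_cong[of _ _ "copy_exp P c"], intro ext, rule trans[OF odd]) simp
  also have "\<dots> = - copy_exp P c F" by (subst copy_exp_cmult[OF fin]) simp
  finally show ?thesis using copy_exp_swap[OF fin, of c F] by linarith
qed

lemma copy_exp_map_pmf:
  "copy_exp (map_pmf g P) c F = copy_exp P (\<lambda>w. c (g w)) (\<lambda>w w'. F (g w) (g w'))"
  by (simp add: copy_exp_def fiber_prob_def vimage_def)

lemma fiber_prob_pair_pmf:
  assumes A: "finite (set_pmf A)" and B: "finite (set_pmf B)"
  shows "fiber_prob (pair_pmf A B) (\<lambda>(a, b). (f a, g b)) (a, b) = fiber_prob A f a * fiber_prob B g b"
proof -
  have fin: "finite (set_pmf (pair_pmf A B))" using A B by simp
  show ?thesis
    unfolding fiber_prob_finite[OF fin] fiber_prob_finite[OF A] fiber_prob_finite[OF B]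
      set_pair_pmf sum.cartesian_product' sum_product
    by (intro sum.cong refl) (simp add: pmf_pair)
qed

lemma copy_exp_pair_pmf:
  assumes A: "finite (set_pmf A)" and B: "finite (set_pmf B)"
  shows "copy_exp (pair_pmf A B) (\<lambda>(a, b). (c a, e b)) (\<lambda>(a, b) (a', b'). F a a' * G b b') =
    copy_exp A c F * copy_exp B e G"
proof -
  have fin: "finite (set_pmf (pair_pmf A B))" using A B by simp
  let ?u = "\<lambda>a a'. pmf A a * pmf A a' / fiber_prob A c a * (if c a' = c a then F a a' else 0)"
  let ?w = "\<lambda>b b'. pmf B b * pmf B b' / fiber_prob B e b * (if e b' = e b then G b b' else 0)"
  have "copy_exp (pair_pmf A B) (\<lambda>(a, b). (c a, e b)) (\<lambda>(a, b) (a', b'). F a a' * G b b') =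
    (\<Sum>a\<in>set_pmf A. \<Sum>b\<in>set_pmf B. \<Sum>a'\<in>set_pmf A. \<Sum>b'\<in>set_pmf B. ?u a a' * ?w b b')"
    unfolding copy_exp_finite[OF fin] set_pair_pmf sum.cartesian_product'
    by (intro sum.cong refl) (simp add: fiber_prob_pair_pmf[OF A B] pmf_pair)
  also have "\<dots> = (\<Sum>a\<in>set_pmf A. \<Sum>b\<in>set_pmf B. (\<Sum>a'\<in>set_pmf A. ?u a a') * (\<Sum>b'\<in>set_pmf B. ?w b b'))"
    by (simp only: sum_product)
  also have "\<dots> = copy_exp A c F * copy_exp B e G"
    by (simp only: sum_product[symmetric] copy_exp_finite[OF A] copy_exp_finite[OF B])
  finally show ?thesis .
qed

lemma copy_exp_log_le:
  assumes fin: "finite (set_pmf P)" and "0 < N"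
    and pos: "\<And>w w'. w \<in> set_pmf P \<Longrightarrow> w' \<in> set_pmf P \<Longrightarrow> c w' = c w \<Longrightarrow> 0 < a w w'"
    and le: "copy_exp P c a \<le> N"
  shows "copy_exp P c (\<lambda>w w'. log 2 (a w w')) \<le> log 2 N"
proof -
  have "copy_exp P c (\<lambda>w w'. log 2 (a w w')) \<le>
      copy_exp P c (\<lambda>w w'. (log 2 N - 1 / ln 2) + 1 / (N * ln 2) * a w w')"
  proof (rule copy_exp_mono[OF fin])
    fix w w' assume "w \<in> set_pmf P" "w' \<in> set_pmf P" "c w' = c w"
    from log2_le_linear[OF pos[OF this] \<open>0 < N\<close>]
    show "log 2 (a w w') \<le> (log 2 N - 1 / ln 2) + 1 / (N * ln 2) * a w w'"
      by (simp add: diff_divide_distrib)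
  qed
  also have "\<dots> = (log 2 N - 1 / ln 2) + 1 / (N * ln 2) * copy_exp P c a"
    by (simp only: copy_exp_add[OF fin] copy_exp_cmult[OF fin] copy_exp_const[OF fin])
  also have "\<dots> \<le> (log 2 N - 1 / ln 2) + 1 / (N * ln 2) * N"
    using le \<open>0 < N\<close> by (intro add_left_mono mult_left_mono) auto
  also have "\<dots> = log 2 N" using \<open>0 < N\<close> by simp
  finally show ?thesis .
qed

text \<open>Shannon entropy dominates collision entropy: the mean conditional probability of the
  value taken is the probability that a conditionally independent copy agrees, and Jensen's
  inequality moves the logarithm outside.\<close>

lemma cond_ent_ge_collision:
  assumes fin: "finite (set_pmf P)" and "0 < N"
    and le: "copy_exp P c (\<lambda>w w'. if f w = f w' then 1 else 0) \<le> N"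
  shows "- log 2 N \<le> cond_ent P f c"
proof -
  let ?fc = "\<lambda>w. (f w, c w)"
  have eq: "measure_pmf.expectation P (\<lambda>w. fiber_prob P ?fc w / fiber_prob P c w) =
    copy_exp P c (\<lambda>w w'. if f w = f w' then 1 else 0)"
    unfolding copy_exp_def fiber_prob_finite[OF fin, of ?fc] expectation_finite[OF fin]
    by (intro sum.cong refl arg_cong2[of _ _ _ _ "(*)"] arg_cong2[of _ _ _ _ "(/)"]) auto
  have "measure_pmf.expectation P (\<lambda>w. log 2 (fiber_prob P ?fc w / fiber_prob P c w)) \<le> log 2 N"
    by (rule expectation_log_le[OF fin \<open>0 < N\<close>]) (use le in \<open>auto simp: eq intro!: divide_pos_pos fiber_prob_pos\<close>)
  moreover have "cond_ent P f c =
      - measure_pmf.expectation P (\<lambda>w. log 2 (fiber_prob P ?fc w / fiber_prob P c w))"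
  proof -
    have "log 2 (fiber_prob P c w / fiber_prob P ?fc w) = - log 2 (fiber_prob P ?fc w / fiber_prob P c w)"
      if "w \<in> set_pmf P" for w
      using fiber_prob_pos[OF that, of c] fiber_prob_pos[OF that, of ?fc] by (simp add: log_divide)
    then show ?thesis unfolding cond_ent_alt[OF fin] expectation_finite[OF fin] sum_negf[symmetric]
      by (intro sum.cong refl) simp
  qed
  ultimately show ?thesis by simp
qed

text \<open>Gibbs' inequality with reference weights centred at the value of the copy. As the centre
  is itself random, no conditional mean has to be chosen, and weights of total mass \<open>B\<close>
  cost only \<open>log 2 B\<close>.\<close>

lemma cond_ent_le_weights:
  assumes fin: "finite (set_pmf P)" and "0 < B"
    and pos: "\<And>x y. 0 < W x y"
    and le: "\<And>w'. w' \<in> set_pmf P \<Longrightarrow> (\<Sum>x\<in>f ` set_pmf P. W x (f w')) \<le> B"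
  shows "cond_ent P f c \<le> log 2 B + copy_exp P c (\<lambda>w w'. - log 2 (W (f w) (f w')))"
proof -
  let ?S = "set_pmf P"
  let ?fc = "\<lambda>w. (f w, c w)"
  let ?a = "\<lambda>w w'. W (f w) (f w') * (fiber_prob P c w / fiber_prob P ?fc w)"
  have inner: "(\<Sum>w\<in>?S. pmf P w * ((if c w' = c w then W (f w) (f w') else 0) / fiber_prob P ?fc w)) \<le> B"
    if w': "w' \<in> ?S" for w'
  proof -
    let ?F = "\<lambda>(x, z). if c w' = z then W x (f w') else 0"
    have "(\<Sum>w\<in>?S. pmf P w * ((if c w' = c w then W (f w) (f w') else 0) / fiber_prob P ?fc w)) =
      (\<Sum>t\<in>?fc ` ?S. ?F t)"
      using expectation_div_fiber_prob[OF fin, of ?F ?fc] by (simp add: expectation_finite[OF fin])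
    also have "\<dots> \<le> (\<Sum>t\<in>(f ` ?S) \<times> {c w'}. ?F t)"
    proof -
      have "(\<Sum>t\<in>?fc ` ?S. ?F t) = (\<Sum>t\<in>?fc ` ?S \<inter> (f ` ?S) \<times> {c w'}. ?F t)"
        by (rule sum.mono_neutral_right) (use fin in \<open>auto split: if_splits\<close>)
      also have "\<dots> \<le> (\<Sum>t\<in>(f ` ?S) \<times> {c w'}. ?F t)"
        by (rule sum_mono2) (use fin pos in \<open>auto simp: less_imp_le\<close>)
      finally show ?thesis .
    qed
    also have "\<dots> = (\<Sum>x\<in>f ` ?S. W x (f w'))"
      by (simp add: sum.cartesian_product[symmetric])
    also have "\<dots> \<le> B" by (rule le[OF w'])
    finally show ?thesis .
  qed
  have "copy_exp P c ?a = (\<Sum>w'\<in>?S. pmf P w' * (\<Sum>w\<in>?S. pmf P w * ((if c w' = c w then W (f w) (f w') else 0) / fiber_prob P ?fc w)))"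
    unfolding copy_exp_finite[OF fin] sum_distrib_left
  proof (subst sum.swap, intro sum.cong refl)
    fix w' w assume "w' \<in> ?S" "w \<in> ?S"
    then have "0 < fiber_prob P c w" by (simp add: fiber_prob_pos)
    then show "pmf P w * pmf P w' / fiber_prob P c w * (if c w' = c w then ?a w w' else 0) =
      pmf P w' * (pmf P w * ((if c w' = c w then W (f w) (f w') else 0) / fiber_prob P ?fc w))"
      by auto
  qed
  also have "\<dots> \<le> (\<Sum>w'\<in>?S. pmf P w' * B)"
    by (intro sum_mono mult_left_mono inner) auto
  also have "\<dots> = B" by (simp add: sum_distrib_right[symmetric] sum_pmf_set[OF fin])
  finally have aB: "copy_exp P c ?a \<le> B" .
  have "copy_exp P c (\<lambda>w w'. log 2 (?a w w')) \<le> log 2 B"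
    by (rule copy_exp_log_le[OF fin \<open>0 < B\<close> _ aB]) (auto intro!: mult_pos_pos divide_pos_pos pos fiber_prob_pos)
  moreover have "copy_exp P c (\<lambda>w w'. log 2 (?a w w')) + copy_exp P c (\<lambda>w w'. - log 2 (W (f w) (f w'))) = cond_ent P f c"
    unfolding cond_ent_alt[OF fin] copy_exp_fst[OF fin, of c, symmetric] copy_exp_add[OF fin, symmetric]
  proof (rule copy_exp_cong[OF fin])
    fix w w' assume "w \<in> ?S"
    then have "0 < fiber_prob P c w / fiber_prob P ?fc w" by (intro divide_pos_pos fiber_prob_pos)
    then show "log 2 (?a w w') + - log 2 (W (f w) (f w')) = log 2 (fiber_prob P c w / fiber_prob P ?fc w)"
      using pos[of "f w" "f w'"] by (subst log_mult) auto
  qed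
  ultimately show ?thesis by simp
qed

text \<open>The correction \<open>- 2 / real N\<close> makes the induction telescope:
  \<open>1 / (1 + N^2)\<close> is at most \<open>2 / N - 2 / (N + 1)\<close>.\<close>

lemma sum_inverse_one_plus_square_nat:
  assumes "0 < N"
  shows "(\<Sum>n<N. 1 / (1 + (real n)\<^sup>2)) \<le> 3 - 2 / real N"
  using assms
proof (induction N rule: nat_induct_non_zero)
  case 1
  then show ?case by simp
next
  case (Suc N)
  have "1 / (1 + (real N)\<^sup>2) = 2 / (2 * (1 + (real N)\<^sup>2))"
    by (subst mult_divide_mult_cancel_left[of 2 1, symmetric]) simp_all
  also have "\<dots> \<le> 2 / (real N * real (Suc N))"
  proof (rule divide_left_mono)
    have "real N \<le> 1 + (real N)\<^sup>2"
      using Suc.hyps by (cases N) (auto simp: power2_eq_square algebra_simps)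
    then show "real N * real (Suc N) \<le> 2 * (1 + (real N)\<^sup>2)"
      by (simp add: power2_eq_square algebra_simps)
    show "0 < 2 * (1 + (real N)\<^sup>2) * (real N * real (Suc N))"
      using Suc.hyps by (intro mult_pos_pos add_pos_nonneg) auto
  qed simp
  also have "\<dots> = 2 / real N - 2 / real (Suc N)"
    using Suc.hyps by (simp add: field_simps)
  finally show ?case using Suc.IH by simp
qed

lemma sum_inverse_one_plus_square_int:
  fixes A :: "int set"
  assumes "finite A"
  shows "(\<Sum>x\<in>A. 1 / (1 + (real_of_int (x - y))\<^sup>2)) \<le> 6"
proof -
  let ?w = "\<lambda>z::int. 1 / (1 + (real_of_int z)\<^sup>2)"
  obtain M :: nat where M: "\<And>x. x \<in> A \<Longrightarrow> \<bar>x - y\<bar> < int M" "0 < M"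
  proof
    let ?M = "Max (insert 0 ((\<lambda>x. nat \<bar>x - y\<bar>) ` A)) + 1"
    fix x assume "x \<in> A"
    then have "nat \<bar>x - y\<bar> \<le> Max (insert 0 ((\<lambda>x. nat \<bar>x - y\<bar>) ` A))"
      using assms by (intro Max_ge) auto
    then show "\<bar>x - y\<bar> < int ?M" by linarith
  qed simp
  have "(\<Sum>x\<in>A. ?w (x - y)) = (\<Sum>z\<in>(\<lambda>x. x - y) ` A. ?w z)"
    by (subst sum.reindex) (auto simp: inj_on_def)
  also have "\<dots> \<le> (\<Sum>z\<in>int ` {..<M} \<union> (\<lambda>n. - int n) ` {..<M}. ?w z)"
  proof (rule sum_mono2)
    show "(\<lambda>x. x - y) ` A \<subseteq> int ` {..<M} \<union> (\<lambda>n. - int n) ` {..<M}"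
    proof
      fix z assume "z \<in> (\<lambda>x. x - y) ` A"
      then have "\<bar>z\<bar> < int M" using M by auto
      then have "nat \<bar>z\<bar> \<in> {..<M}" "z = int (nat \<bar>z\<bar>) \<or> z = - int (nat \<bar>z\<bar>)" by auto
      then show "z \<in> int ` {..<M} \<union> (\<lambda>n. - int n) ` {..<M}" by blast
    qed
  qed auto
  also have "\<dots> \<le> (\<Sum>z\<in>int ` {..<M}. ?w z) + (\<Sum>z\<in>(\<lambda>n. - int n) ` {..<M}. ?w z)"
    by (subst sum.union_inter[symmetric]) (auto intro!: sum_nonneg)
  also have "\<dots> = 2 * (\<Sum>n<M. 1 / (1 + (real n)\<^sup>2))"
    by (subst (1 2) sum.reindex) (auto simp: inj_on_def)
  also have "\<dots> \<le> 6"
    using sum_inverse_one_plus_square_nat[OF \<open>0 < M\<close>] by (smt (verit) divide_nonneg_nonneg of_nat_0_le_iff)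
  finally show ?thesis .
qed

text \<open>Entropy is at most logarithmic in the spread: the weights \<open>1 / (1 + d^2)\<close>
  have mass at most 6 on the integers, and Jensen's inequality turns the mean of
  \<open>log 2 (1 + d^2)\<close> into the second moment.\<close>

lemma cond_ent_le_variance:
  fixes f :: "'a \<Rightarrow> int"
  assumes fin: "finite (set_pmf P)"
    and le: "copy_exp P c (\<lambda>w w'. (real_of_int (f w - f w'))\<^sup>2) \<le> V"
  shows "cond_ent P f c \<le> log 2 (6 * (1 + V))"
proof -
  let ?W = "\<lambda>x y :: int. 1 / (1 + (real_of_int (x - y))\<^sup>2)"
  have "0 = copy_exp P c (\<lambda>w w'. 0)" using copy_exp_const[OF fin, of c 0] by simp
  also have "\<dots> \<le> copy_exp P c (\<lambda>w w'. (real_of_int (f w - f w'))\<^sup>2)"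
    by (rule copy_exp_mono[OF fin]) simp
  finally have V: "0 \<le> V" using le by simp
  have pos: "0 < 1 + (real_of_int (x - y))\<^sup>2" for x y :: int
    by (rule add_pos_nonneg) auto
  have "cond_ent P f c \<le> log 2 6 + copy_exp P c (\<lambda>w w'. - log 2 (?W (f w) (f w')))"
    by (rule cond_ent_le_weights[OF fin])
       (use pos sum_inverse_one_plus_square_int fin in \<open>auto\<close>)
  also have "copy_exp P c (\<lambda>w w'. - log 2 (?W (f w) (f w'))) =
      copy_exp P c (\<lambda>w w'. log 2 (1 + (real_of_int (f w - f w'))\<^sup>2))"
    by (rule copy_exp_cong[OF fin]) (use pos in \<open>simp add: log_divide less_imp_neq[symmetric]\<close>)
  also have "\<dots> \<le> log 2 (1 + V)"
  proof (rule copy_exp_log_le[OF fin])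
    show "copy_exp P c (\<lambda>w w'. 1 + (real_of_int (f w - f w'))\<^sup>2) \<le> 1 + V"
      using le by (subst copy_exp_add[OF fin]) (simp add: copy_exp_const[OF fin])
  qed (use V pos in auto)
  moreover have "log 2 (6 * (1 + V)) = log 2 6 + log 2 (1 + V)" using V by (subst log_mult) auto
  ultimately show ?thesis by linarith
qed

section \<open>Concentration of sums of independent symmetric variables\<close>

lemma cos_ge_half:
  fixes y :: real
  assumes "\<bar>y\<bar> \<le> 1"
  shows "1 / 2 \<le> cos y"
proof -
  have "\<bar>sin (y / 2)\<bar> \<le> \<bar>y / 2\<bar>" by (rule abs_sin_x_le_abs_x)
  then have "\<bar>sin (y / 2)\<bar>\<^sup>2 \<le> (1 / 2)\<^sup>2" using assms by (intro power_mono) auto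
  moreover have "1 - cos y = 2 * (sin (y / 2))\<^sup>2"
    using cos_double_sin[of "y / 2"] by simp
  ultimately show ?thesis by (simp add: power2_eq_square)
qed

text \<open>By the mean value theorem and \<open>cos_ge_half\<close>, |sin u| is at least |u| / 2
  for small u; this is applied at u = y / 2.\<close>

lemma one_minus_cos_ge:
  fixes y :: real
  assumes "\<bar>y\<bar> \<le> 1"
  shows "y\<^sup>2 / 8 \<le> 1 - cos y"
proof -
  have half: "\<bar>u\<bar> / 2 \<le> \<bar>sin u\<bar>" if "\<bar>u\<bar> \<le> 1 / 2" for u :: real
  proof (cases "u = 0")
    case False
    then have "0 < \<bar>u\<bar>" by simp
    from MVT2[OF this, of sin cos] obtain z where z: "0 < z" "z < \<bar>u\<bar>" "sin \<bar>u\<bar> - sin 0 = (\<bar>u\<bar> - 0) * cos z"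
      by auto
    have "\<bar>u\<bar> * (1 / 2) \<le> \<bar>u\<bar> * cos z" using z that by (intro mult_left_mono cos_ge_half) auto
    then have "\<bar>u\<bar> / 2 \<le> sin \<bar>u\<bar>" using z by simp
    then show ?thesis by (cases "0 \<le> u") auto
  qed simp
  have "(\<bar>y / 2\<bar> / 2)\<^sup>2 \<le> \<bar>sin (y / 2)\<bar>\<^sup>2"
    by (rule power_mono[OF half]) (use assms in auto)
  moreover have "1 - cos y = 2 * (sin (y / 2))\<^sup>2"
    using cos_double_sin[of "y / 2"] by simp
  ultimately show ?thesis by (simp add: power_divide)
qed

text \<open>The double sum is a Fejer kernel, the squared modulus of the sum of exp(i r x / N) over
  r < N. Hence it is nonnegative, and for |x| at most 1 every real part is at least 1/2, so that it
  is at least (N / 2)^2.\<close>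

lemma indicator_le_fejer:
  fixes x :: real
  assumes "0 < N"
  shows "(if \<bar>x\<bar> \<le> 1 then 1 else 0) \<le>
    4 / (real N)\<^sup>2 * (\<Sum>r<N. \<Sum>s<N. cos ((real r - real s) / real N * x))"
proof -
  let ?t = "\<lambda>r. real r / real N * x"
  have eq: "(\<Sum>r<N. \<Sum>s<N. cos ((real r - real s) / real N * x)) =
    (\<Sum>r<N. cos (?t r))\<^sup>2 + (\<Sum>r<N. sin (?t r))\<^sup>2"
  proof -
    have "cos ((real r - real s) / real N * x) = cos (?t r) * cos (?t s) + sin (?t r) * sin (?t s)" for r s
      by (simp add: cos_diff[symmetric] diff_divide_distrib left_diff_distrib)
    then show ?thesis by (simp add: sum.distrib power2_eq_square sum_product)
  qed
  show ?thesis
  proof (cases "\<bar>x\<bar> \<le> 1")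
    case True
    have "(\<Sum>r<N. 1 / 2) \<le> (\<Sum>r<N. cos (?t r))"
    proof (intro sum_mono cos_ge_half)
      fix r assume "r \<in> {..<N}"
      then have "\<bar>real r / real N\<bar> \<le> 1" by (auto simp: divide_le_eq_1)
      then have "\<bar>real r / real N\<bar> * \<bar>x\<bar> \<le> 1 * 1" using True by (intro mult_mono) auto
      then show "\<bar>?t r\<bar> \<le> 1" by (simp only: abs_mult)
    qed
    then have "(real N / 2)\<^sup>2 \<le> (\<Sum>r<N. cos (?t r))\<^sup>2" by (intro power_mono) auto
    then have "(real N)\<^sup>2 / 4 \<le> (\<Sum>r<N. cos (?t r))\<^sup>2 + (\<Sum>r<N. sin (?t r))\<^sup>2"
      by (simp add: power_divide add_increasing2)
    then have "4 / (real N)\<^sup>2 * ((real N)\<^sup>2 / 4) \<le> 4 / (real N)\<^sup>2 * ((\<Sum>r<N. cos (?t r))\<^sup>2 + (\<Sum>r<N. sin (?t r))\<^sup>2)"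
      by (intro mult_left_mono) auto
    moreover have "4 / (real N)\<^sup>2 * ((real N)\<^sup>2 / 4) = 1" using assms by simp
    ultimately show ?thesis unfolding eq using True by (simp only: if_True)
  next
    case False
    then show ?thesis unfolding eq by simp
  qed
qed

primrec iid_list :: "nat \<Rightarrow> 'a pmf \<Rightarrow> 'a list pmf" where
  "iid_list 0 P = return_pmf []"
| "iid_list (Suc k) P = map_pmf (\<lambda>(x, xs). x # xs) (pair_pmf P (iid_list k P))"

lemma finite_iid_list: "finite (set_pmf P) \<Longrightarrow> finite (set_pmf (iid_list k P))"
  by (induction k) auto

lemma set_iid_list: "xs \<in> set_pmf (iid_list k P) \<Longrightarrow> length xs = k \<and> set xs \<subseteq> set_pmf P"
  by (induction k arbitrary: xs) fastforce+

lemma copy_exp_iid_list_Suc: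
  "copy_exp (iid_list (Suc k) P) (map c) F =
    copy_exp (pair_pmf P (iid_list k P)) (\<lambda>(a, b). (c a, map c b)) (\<lambda>(x, xs) (x', xs'). F (x # xs) (x' # xs'))"
proof -
  have "(\<lambda>w. map c (case w of (x, xs) \<Rightarrow> x # xs)) = (\<lambda>(c, cs). c # cs) \<circ> (\<lambda>(a, b). (c a, map c b))" by auto
  moreover have "copy_exp Q (i \<circ> e) G = copy_exp Q e G" if "inj i" for Q :: "('a \<times> 'a list) pmf" and i :: "'c \<times> 'c list \<Rightarrow> 'c list" and e G
    using that by (simp add: copy_exp_def fiber_prob_def inj_eq)
  moreover have "inj (\<lambda>(c :: 'c, cs). c # cs)" by (auto simp: inj_on_def)
  ultimately show ?thesis by (simp add: copy_exp_map_pmf split_def)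
qed

text \<open>Multiplicativity of characteristic functions. In the addition formula for the cosine,
  the product of sines vanishes because a difference of copies is symmetric.\<close>

lemma copy_exp_iid_list_cos:
  assumes fin: "finite (set_pmf P)"
  shows "copy_exp (iid_list k P) (map c) (\<lambda>xs xs'. cos (t * (sum_list (map y xs) - sum_list (map y xs')))) =
    (copy_exp P c (\<lambda>x x'. cos (t * (y x - y x')))) ^ k"
proof (induction k)
  case 0
  then show ?case by (simp add: copy_exp_def fiber_prob_def)
next
  case (Suc k)
  let ?Q = "iid_list k P"
  let ?D = "\<lambda>xs xs'. sum_list (map y xs) - sum_list (map y xs')"
  have finQ: "finite (set_pmf ?Q)" by (rule finite_iid_list[OF fin])
  have finPQ: "finite (set_pmf (pair_pmf P ?Q))" using fin finQ by simp
  have "copy_exp (iid_list (Suc k) P) (map c) (\<lambda>xs xs'. cos (t * ?D xs xs')) =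
     copy_exp (pair_pmf P ?Q) (\<lambda>(a, b). (c a, map c b))
      (\<lambda>w w'. (\<lambda>(x, xs) (x', xs'). cos (t * (y x - y x')) * cos (t * ?D xs xs')) w w' +
        (-1) * (\<lambda>(x, xs) (x', xs'). sin (t * (y x - y x')) * sin (t * ?D xs xs')) w w')"
    unfolding copy_exp_iid_list_Suc
  proof (rule copy_exp_cong[OF finPQ], clarify)
    fix x xs x' xs'
    have "t * ?D (x # xs) (x' # xs') = t * (y x - y x') + t * ?D xs xs'"
      by (simp add: algebra_simps)
    then show "cos (t * ?D (x # xs) (x' # xs')) = cos (t * (y x - y x')) * cos (t * ?D xs xs') +
        (-1) * (sin (t * (y x - y x')) * sin (t * ?D xs xs'))"
      by (simp only: cos_add)
  qed
  also have "\<dots> = copy_exp P c (\<lambda>x x'. cos (t * (y x - y x'))) * copy_exp ?Q (map c) (\<lambda>xs xs'. cos (t * ?D xs xs')) -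
     copy_exp P c (\<lambda>x x'. sin (t * (y x - y x'))) * copy_exp ?Q (map c) (\<lambda>xs xs'. sin (t * ?D xs xs'))"
    unfolding copy_exp_add[OF finPQ] copy_exp_cmult[OF finPQ] copy_exp_pair_pmf[OF fin finQ] by simp
  also have "copy_exp P c (\<lambda>x x'. sin (t * (y x - y x'))) = 0"
  proof (rule copy_exp_odd[OF fin])
    fix x x' show "sin (t * (y x' - y x)) = - sin (t * (y x - y x'))"
      by (subst sin_minus[symmetric]) (simp add: algebra_simps)
  qed
  finally show ?case using Suc.IH by simp
qed

lemma copy_exp_iid_list_square:
  assumes fin: "finite (set_pmf P)"
  shows "copy_exp (iid_list k P) (map c) (\<lambda>xs xs'. (sum_list (map y xs) - sum_list (map y xs'))\<^sup>2) =
    real k * copy_exp P c (\<lambda>x x'. (y x - y x')\<^sup>2)"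
proof (induction k)
  case 0
  then show ?case by (simp add: copy_exp_def fiber_prob_def)
next
  case (Suc k)
  let ?Q = "iid_list k P"
  let ?D = "\<lambda>xs xs'. sum_list (map y xs) - sum_list (map y xs')"
  have finQ: "finite (set_pmf ?Q)" by (rule finite_iid_list[OF fin])
  have finPQ: "finite (set_pmf (pair_pmf P ?Q))" using fin finQ by simp
  have "copy_exp (iid_list (Suc k) P) (map c) (\<lambda>xs xs'. (?D xs xs')\<^sup>2) =
     copy_exp (pair_pmf P ?Q) (\<lambda>(a, b). (c a, map c b))
      (\<lambda>w w'. (\<lambda>(x, xs) (x', xs'). (y x - y x')\<^sup>2 * 1) w w' +
        (2 * (\<lambda>(x, xs) (x', xs'). (y x - y x') * ?D xs xs') w w' +
        (\<lambda>(x, xs) (x', xs'). 1 * (?D xs xs')\<^sup>2) w w'))"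
    unfolding copy_exp_iid_list_Suc
    by (rule copy_exp_cong[OF finPQ]) (auto simp: power2_eq_square algebra_simps)
  also have "\<dots> = copy_exp P c (\<lambda>x x'. (y x - y x')\<^sup>2) +
     (2 * (copy_exp P c (\<lambda>x x'. y x - y x') * copy_exp ?Q (map c) ?D) + copy_exp ?Q (map c) (\<lambda>xs xs'. (?D xs xs')\<^sup>2))"
    unfolding copy_exp_add[OF finPQ] copy_exp_cmult[OF finPQ] copy_exp_pair_pmf[OF fin finQ]
      copy_exp_const[OF fin] copy_exp_const[OF finQ] by simp
  also have "copy_exp P c (\<lambda>x x'. y x - y x') = 0"
    by (rule copy_exp_odd[OF fin]) simp
  finally show ?case using Suc.IH by (simp add: algebra_simps)
qed

text \<open>Bernoulli's inequality replaces \<open>1 + real k * x\<close> by a power, and the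
  product is \<open>(1 - x^2) ^ k\<close>. Algebraic decay is enough: at the sample points it is
  summable like \<open>1 / (1 + d^2)\<close>.\<close>

lemma one_minus_power_le_inverse:
  fixes x :: real
  assumes "0 \<le> x" "x \<le> 1"
  shows "(1 - x) ^ k \<le> 1 / (1 + real k * x)"
proof -
  have "(1 - x) ^ k * (1 + real k * x) \<le> (1 - x) ^ k * (1 + x) ^ k"
    using assms Bernoulli_inequality[of x k] by (intro mult_left_mono) auto
  also have "\<dots> = (1 - x\<^sup>2) ^ k"
    by (simp add: power_mult_distrib[symmetric] power2_eq_square algebra_simps)
  also have "\<dots> \<le> 1"
    using assms by (intro power_le_one) (auto simp: power2_eq_square intro: mult_le_one)
  finally show ?thesis using assms by (simp add: pos_le_divide_eq add_pos_nonneg)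
qed

text \<open>Esseen's smoothing argument, with the characteristic function sampled at finitely many points
  instead of integrated.\<close>

theorem small_ball_iid_list:
  assumes fin: "finite (set_pmf P)" and "0 < \<sigma>" and "0 < N"
    and bound: "\<And>x x'. x \<in> set_pmf P \<Longrightarrow> x' \<in> set_pmf P \<Longrightarrow> c x' = c x \<Longrightarrow> \<bar>y x - y x'\<bar> \<le> \<sigma>"
    and var: "(real N * \<sigma>)\<^sup>2 \<le> real k * copy_exp P c (\<lambda>x x'. (y x - y x')\<^sup>2)"
  shows "copy_exp (iid_list k P) (map c)
     (\<lambda>xs xs'. if \<bar>sum_list (map y xs) - sum_list (map y xs')\<bar> \<le> \<sigma> then 1 else 0) \<le> 192 / real N"
proof -
  let ?Q = "iid_list k P"
  let ?D = "\<lambda>xs xs'. sum_list (map y xs) - sum_list (map y xs')"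
  let ?v = "copy_exp P c (\<lambda>x x'. (y x - y x')\<^sup>2)"
  let ?\<phi> = "\<lambda>t. copy_exp P c (\<lambda>x x'. cos (t * (y x - y x')))"
  have finQ: "finite (set_pmf ?Q)" by (rule finite_iid_list[OF fin])
  have v0: "0 \<le> ?v" using copy_exp_mono[OF fin, of c "\<lambda>_ _. 0"] by (simp add: copy_exp_const[OF fin])
  \<comment> \<open>The restriction on \<open>t\<close> keeps all phases in [-1, 1], where the
    cosine is at least 1/2. So the characteristic function is nonnegative, and its quadratic upper
    bound may be raised to the power \<open>k\<close>.\<close>
  have char: "?\<phi> t ^ k \<le> 8 / (1 + real k * (t\<^sup>2 * ?v))" if t: "\<bar>t\<bar> * \<sigma> \<le> 1" for t
  proof -
    have small: "\<bar>t * (y x - y x')\<bar> \<le> 1" if "x \<in> set_pmf P" "x' \<in> set_pmf P" "c x' = c x" for x x'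
    proof -
      have "\<bar>t * (y x - y x')\<bar> \<le> \<bar>t\<bar> * \<sigma>"
        using bound[OF that] by (simp add: abs_mult mult_left_mono)
      with t show ?thesis by simp
    qed
    have "0 \<le> ?\<phi> t"
      using copy_exp_mono[OF fin, of c "\<lambda>_ _. 0" "\<lambda>x x'. cos (t * (y x - y x'))"] cos_ge_half[OF small]
      by (force simp: copy_exp_const[OF fin])
    moreover have phi_le: "?\<phi> t \<le> 1 - t\<^sup>2 * ?v / 8"
    proof -
      have "?\<phi> t \<le> copy_exp P c (\<lambda>x x'. 1 + (- t\<^sup>2 / 8) * (y x - y x')\<^sup>2)"
      proof (rule copy_exp_mono[OF fin])
        fix x x' assume "x \<in> set_pmf P" "x' \<in> set_pmf P" "c x' = c x"
        from one_minus_cos_ge[OF small[OF this]]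
        show "cos (t * (y x - y x')) \<le> 1 + (- t\<^sup>2 / 8) * (y x - y x')\<^sup>2"
          by (simp add: power_mult_distrib)
      qed
      also have "\<dots> = 1 - t\<^sup>2 * ?v / 8"
        unfolding copy_exp_add[OF fin] copy_exp_cmult[OF fin] copy_exp_const[OF fin] by simp
      finally show ?thesis .
    qed
    ultimately have "?\<phi> t ^ k \<le> (1 - t\<^sup>2 * ?v / 8) ^ k" by (intro power_mono)
    also have "\<dots> \<le> 1 / (1 + real k * (t\<^sup>2 * ?v / 8))"
      using \<open>0 \<le> ?\<phi> t\<close> phi_le v0 by (intro one_minus_power_le_inverse) auto
    also have "\<dots> = 8 / (8 * (1 + real k * (t\<^sup>2 * ?v / 8)))"
      by (subst mult_divide_mult_cancel_left[of 8 1, symmetric]) simp_all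
    also have "\<dots> \<le> 8 / (1 + real k * (t\<^sup>2 * ?v))"
      using v0 by (intro divide_left_mono mult_pos_pos add_pos_nonneg) auto
    finally show ?thesis .
  qed
  have "copy_exp ?Q (map c) (\<lambda>xs xs'. if \<bar>?D xs xs'\<bar> \<le> \<sigma> then 1 else 0) \<le>
    copy_exp ?Q (map c) (\<lambda>xs xs'. 4 / (real N)\<^sup>2 * (\<Sum>r<N. \<Sum>s<N. cos ((real r - real s) / (real N * \<sigma>) * ?D xs xs')))"
  proof (rule copy_exp_mono[OF finQ])
    fix xs xs'
    have "\<bar>?D xs xs' / \<sigma>\<bar> \<le> 1 \<longleftrightarrow> \<bar>?D xs xs'\<bar> \<le> \<sigma>" using \<open>0 < \<sigma>\<close> by simp
    with indicator_le_fejer[OF \<open>0 < N\<close>, of "?D xs xs' / \<sigma>"]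
    show "(if \<bar>?D xs xs'\<bar> \<le> \<sigma> then 1 else 0) \<le>
       4 / (real N)\<^sup>2 * (\<Sum>r<N. \<Sum>s<N. cos ((real r - real s) / (real N * \<sigma>) * ?D xs xs'))"
      by (simp add: mult.commute)
  qed
  also have "\<dots> = 4 / (real N)\<^sup>2 * (\<Sum>r<N. \<Sum>s<N. ?\<phi> ((real r - real s) / (real N * \<sigma>)) ^ k)"
    unfolding copy_exp_cmult[OF finQ]
    by (simp only: copy_exp_sum[OF finQ finite_lessThan] copy_exp_iid_list_cos[OF fin])
  also have "\<dots> \<le> 4 / (real N)\<^sup>2 * (\<Sum>r<N. \<Sum>s<N. 8 * (1 / (1 + (real_of_int (int s - int r))\<^sup>2)))"
  proof (intro mult_left_mono sum_mono)
    fix r s assume rs: "r \<in> {..<N}" "s \<in> {..<N}"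
    let ?t = "(real r - real s) / (real N * \<sigma>)"
    have "\<bar>?t\<bar> * \<sigma> \<le> 1" using rs \<open>0 < \<sigma>\<close> \<open>0 < N\<close> by (auto simp: abs_mult field_simps)
    then have "?\<phi> ?t ^ k \<le> 8 / (1 + real k * (?t\<^sup>2 * ?v))" by (rule char)
    \<comment> \<open>At a sample point, \<open>var\<close> bounds
      \<open>real k * (?t\<^sup>2 * ?v)\<close> below by the square of \<open>r - s\<close>.\<close>
    also have "\<dots> \<le> 8 / (1 + (real_of_int (int s - int r))\<^sup>2)"
    proof (intro divide_left_mono mult_pos_pos add_pos_nonneg add_left_mono)
      have "(real r - real s)\<^sup>2 = ?t\<^sup>2 * (real N * \<sigma>)\<^sup>2" using \<open>0 < \<sigma>\<close> \<open>0 < N\<close> by (simp add: power_divide)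
      also have "\<dots> \<le> ?t\<^sup>2 * (real k * ?v)" by (intro mult_left_mono var) auto
      finally show "(real_of_int (int s - int r))\<^sup>2 \<le> real k * (?t\<^sup>2 * ?v)"
        by (simp add: power2_commute mult.left_commute)
    qed (use v0 in auto)
    finally show "?\<phi> ?t ^ k \<le> 8 * (1 / (1 + (real_of_int (int s - int r))\<^sup>2))" by simp
  qed simp
  also have "\<dots> \<le> 4 / (real N)\<^sup>2 * (\<Sum>r<N. 8 * 6)"
  proof (intro mult_left_mono sum_mono)
    fix r
    have "(\<Sum>s<N. 1 / (1 + (real_of_int (int s - int r))\<^sup>2)) = (\<Sum>x\<in>int ` {..<N}. 1 / (1 + (real_of_int (x - int r))\<^sup>2))"
      by (subst sum.reindex) (auto simp: inj_on_def)
    also have "\<dots> \<le> 6" by (rule sum_inverse_one_plus_square_int) simp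
    finally show "(\<Sum>s<N. 8 * (1 / (1 + (real_of_int (int s - int r))\<^sup>2))) \<le> 8 * 6"
      by (simp only: sum_distrib_left[symmetric])
  qed auto
  \<comment> \<open>192 is 4 (Fejer kernel) times 8 (characteristic function) times 6 (mass of the
    weights).\<close>
  also have "\<dots> = 192 / real N" using \<open>0 < N\<close> by (simp add: power2_eq_square)
  finally show ?thesis .
qed

section \<open>Entropy of dyadic cells of sums of independent vectors\<close>

lemma ent_pair_pmf:
  assumes A: "finite (set_pmf A)" and B: "finite (set_pmf B)"
  shows "ent (pair_pmf A B) (\<lambda>(a, b). (f a, g b)) = ent A f + ent B g"
proof -
  have fin: "finite (set_pmf (pair_pmf A B))" using A B by simp
  have "ent (pair_pmf A B) (\<lambda>(a, b). (f a, g b)) =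
    (\<Sum>a\<in>set_pmf A. \<Sum>b\<in>set_pmf B. pmf A a * - log 2 (fiber_prob A f a) * pmf B b + pmf A a * (pmf B b * - log 2 (fiber_prob B g b)))"
    unfolding ent_finite[OF fin] set_pair_pmf sum.cartesian_product'
  proof (intro sum.cong refl)
    fix a b assume "a \<in> set_pmf A" "b \<in> set_pmf B"
    then have "log 2 (fiber_prob A f a * fiber_prob B g b) = log 2 (fiber_prob A f a) + log 2 (fiber_prob B g b)"
      using fiber_prob_pos[of a A f] fiber_prob_pos[of b B g] by (subst log_mult) auto
    then show "pmf (pair_pmf A B) (a, b) * - log 2 (fiber_prob (pair_pmf A B) (\<lambda>(a, b). (f a, g b)) (a, b)) =
      pmf A a * - log 2 (fiber_prob A f a) * pmf B b + pmf A a * (pmf B b * - log 2 (fiber_prob B g b))"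
      by (simp add: fiber_prob_pair_pmf[OF A B] pmf_pair algebra_simps)
  qed
  also have "\<dots> = (\<Sum>a\<in>set_pmf A. pmf A a * - log 2 (fiber_prob A f a)) * (\<Sum>b\<in>set_pmf B. pmf B b)
     + (\<Sum>a\<in>set_pmf A. pmf A a) * (\<Sum>b\<in>set_pmf B. pmf B b * - log 2 (fiber_prob B g b))"
    by (simp only: sum.distrib sum_product)
  finally show ?thesis
    by (simp only: sum_pmf_set[OF A] sum_pmf_set[OF B] ent_finite[OF A] ent_finite[OF B] mult_1 mult_1_right)
qed

text \<open>Each coordinate has its own level, so that levels form a lattice under
  \<open>sup\<close> and \<open>inf\<close>. Both the boxes of one scale and the mixed conditioning
  of the theorem are single levels.\<close>

definition cell :: "('n \<Rightarrow> int) \<Rightarrow> real ^ 'n \<Rightarrow> 'n \<Rightarrow> int" where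
  "cell l x = (\<lambda>i. \<lfloor>2 powi (l i) * x $ i\<rfloor>)"

definition cell_ent :: "(real ^ 'n) pmf \<Rightarrow> ('n \<Rightarrow> int) \<Rightarrow> real" where
  "cell_ent P l = ent P (cell l)"

primrec conv_power :: "'a::monoid_add pmf \<Rightarrow> nat \<Rightarrow> 'a pmf" where
  "conv_power P 0 = return_pmf 0"
| "conv_power P (Suc k) = map_pmf (\<lambda>(x, y). x + y) (pair_pmf P (conv_power P k))"

lemma finite_conv_power: "finite (set_pmf P) \<Longrightarrow> finite (set_pmf (conv_power P k))"
  by (induction k) auto

lemma conv_power_eq_sum_list: "conv_power P k = map_pmf sum_list (iid_list k P)"
proof (induction k)
  case (Suc k)
  have "conv_power P (Suc k) = map_pmf (\<lambda>(x, y). x + y) (map_pmf (\<lambda>(a, b). (id a, sum_list b)) (pair_pmf P (iid_list k P)))"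
    unfolding map_pair by (simp add: Suc)
  then show ?case by (simp add: map_pmf_comp split_def)
qed simp

lemma conv_power_add:
  "conv_power P (a + b) = map_pmf (\<lambda>(x, y). x + y) (pair_pmf (conv_power P a) (conv_power P b))"
proof (induction a)
  case 0
  then show ?case by (simp add: pair_return_pmf1 map_pmf_comp)
next
  case (Suc a)
  have "conv_power P (Suc a + b) = map_pmf (\<lambda>(x, y). x + y) (pair_pmf P (map_pmf (\<lambda>(x, y). x + y) (pair_pmf (conv_power P a) (conv_power P b))))"
    using Suc by simp
  also have "\<dots> = map_pmf (\<lambda>(x, y). x + y) (pair_pmf (conv_power P (Suc a)) (conv_power P b))"
    by (simp add: pair_map_pmf1 pair_map_pmf2 pair_pair_pmf map_pmf_comp split_def add.assoc)
  finally show ?case .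
qed

lemma conv_power_1: "conv_power P 1 = P"
  by (simp add: pair_return_pmf2 map_pmf_comp)

lemma conv_power_mult: "conv_power P (a * b) = conv_power (conv_power P a) b"
proof (induction b)
  case (Suc b)
  then show ?case by (simp add: conv_power_add)
qed simp

lemma floor_powi_cong:
  fixes x y :: real
  assumes "a \<le> b" "\<lfloor>2 powi b * x\<rfloor> = \<lfloor>2 powi b * y\<rfloor>"
  shows "\<lfloor>2 powi a * x\<rfloor> = \<lfloor>2 powi a * y\<rfloor>"
proof -
  have *: "\<lfloor>2 powi a * z\<rfloor> = \<lfloor>2 powi b * z\<rfloor> div 2 ^ nat (b - a)" for z :: real
  proof -
    have "(2::real) powi b = 2 powi a * 2 powi (b - a)" by (simp add: power_int_add[symmetric])
    also have "(2::real) powi (b - a) = 2 ^ nat (b - a)" using assms by (simp add: power_int_def)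
    finally have "2 powi a * z = 2 powi b * z / real_of_int (2 ^ nat (b - a))" by simp
    then show ?thesis by (simp only: floor_divide_real_eq_div zero_le_power zero_le_numeral)
  qed
  show ?thesis unfolding * assms(2) ..
qed

lemma cell_cong: "l \<le> l' \<Longrightarrow> cell l' x = cell l' y \<Longrightarrow> cell l x = cell l y"
  unfolding cell_def fun_eq_iff le_fun_def by (metis floor_powi_cong)

lemma cell_ent_mono: "finite (set_pmf P) \<Longrightarrow> l \<le> l' \<Longrightarrow> cell_ent P l \<le> cell_ent P l'"
  unfolding cell_ent_def by (rule ent_mono) (auto dest: cell_cong)

lemma cell_ent_submodular:
  assumes "finite (set_pmf P)"
  shows "cell_ent P (sup l l') + cell_ent P (inf l l') \<le> cell_ent P l + cell_ent P l'"
  unfolding cell_ent_def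
proof (rule ent_submodular[OF assms])
  fix x y :: "real ^ 'a"
  assume xy: "cell l x = cell l y" "cell l' x = cell l' y"
  show "cell (sup l l') x = cell (sup l l') y"
  proof
    fix i
    show "cell (sup l l') x i = cell (sup l l') y i"
      using fun_cong[OF xy(1), of i] fun_cong[OF xy(2), of i]
      by (cases "l i \<le> l' i") (simp_all add: cell_def sup_int_def max_def)
  qed
qed (auto intro: cell_cong[OF inf_le1] cell_cong[OF inf_le2])

lemma card_int_box:
  fixes A :: "'n::finite \<Rightarrow> int"
  shows "finite {z. \<forall>i. z i \<in> {A i..<A i + int m}}" "card {z. \<forall>i. z i \<in> {A i..<A i + int m}} = m ^ CARD('n)"
proof -
  have "{z. \<forall>i. z i \<in> {A i..<A i + int m}} = (\<Pi>\<^sub>E i\<in>UNIV. {A i..<A i + int m})"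
    by (auto simp: PiE_def)
  then show "finite {z. \<forall>i. z i \<in> {A i..<A i + int m}}" "card {z. \<forall>i. z i \<in> {A i..<A i + int m}} = m ^ CARD('n)"
    by (simp_all add: finite_PiE card_PiE)
qed

text \<open>An interval of the length of a cell meets at most two cells, so each coordinate costs
  one bit.\<close>

lemma cond_ent_cell_le:
  fixes S :: "'a \<Rightarrow> real ^ 'n" and A :: "'c \<Rightarrow> 'n \<Rightarrow> real"
  assumes fin: "finite (set_pmf P)"
    and lower: "\<And>w i. w \<in> set_pmf P \<Longrightarrow> A (g w) i \<le> S w $ i"
    and upper: "\<And>w i. w \<in> set_pmf P \<Longrightarrow> S w $ i \<le> A (g w) i + 2 powi (- l i)"
  shows "cond_ent P (\<lambda>w. cell l (S w)) g \<le> real CARD('n)"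
proof -
  have "cond_ent P (\<lambda>w. cell l (S w)) g \<le> log 2 (real (2 ^ CARD('n)))"
  proof (rule cond_ent_le_log_card[OF fin])
    fix y
    let ?B = "\<lambda>i. \<lfloor>2 powi (l i) * A y i\<rfloor>"
    have "(\<lambda>w. cell l (S w)) ` {w \<in> set_pmf P. g w = y} \<subseteq> {z. \<forall>i. z i \<in> {?B i..<?B i + int 2}}"
    proof clarify
      fix w i assume w: "w \<in> set_pmf P" "y = g w"
      have "2 powi (l i) * A y i \<le> 2 powi (l i) * S w $ i"
        using lower[OF w(1), of i] w by (intro mult_left_mono) auto
      moreover have "2 powi (l i) * S w $ i \<le> 2 powi (l i) * A y i + 1"
      proof -
        have "2 powi (l i) * S w $ i \<le> 2 powi (l i) * (A y i + 2 powi (- l i))"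
          using upper[OF w(1), of i] w by (intro mult_left_mono) auto
        then show ?thesis by (simp add: distrib_left power_int_minus)
      qed
      moreover have "\<lfloor>s\<rfloor> \<in> {\<lfloor>r\<rfloor>..<\<lfloor>r\<rfloor> + int 2}" if "r \<le> s" "s \<le> r + 1" for r s :: real
        using floor_mono[OF that(1)] floor_mono[OF that(2)] by simp
      ultimately show "cell l (S w) i \<in> {\<lfloor>2 powi (l i) * A (g w) i\<rfloor>..<\<lfloor>2 powi (l i) * A (g w) i\<rfloor> + int 2}"
        by (simp only: cell_def w)
    qed
    from card_mono[OF card_int_box(1) this]
    show "card ((\<lambda>w. cell l (S w)) ` {w \<in> set_pmf P. g w = y}) \<le> 2 ^ CARD('n)"
      by (simp only: card_int_box(2))
  qed simp
  then show ?thesis by (simp add: log_nat_power)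
qed

lemma cell_ent_upd_le:
  fixes l :: "'n::finite \<Rightarrow> int"
  assumes fin: "finite (set_pmf P)"
  shows "cell_ent P (l(j := l j + int a)) \<le> cell_ent P l + real a"
proof -
  let ?l = "l(j := l j + int a)"
  let ?f = "\<lambda>x. \<lfloor>2 powi (l j + int a) * x $ j\<rfloor>"
  have "ent P (cell ?l) \<le> ent P (\<lambda>x. (?f x, cell l x))"
    by (rule ent_mono[OF fin]) (auto simp: cell_def fun_eq_iff)
  also have "\<dots> = cell_ent P l + cond_ent P ?f (cell l)" by (simp add: cond_ent_def cell_ent_def)
  also have "cond_ent P ?f (cell l) \<le> log 2 (real (2 ^ a))"
  proof (rule cond_ent_le_log_card[OF fin])
    fix y
    have "?f ` {x \<in> set_pmf P. cell l x = y} \<subseteq> {y j * 2 ^ a..<y j * 2 ^ a + 2 ^ a}"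
    proof clarify
      fix x
      have 1: "real_of_int (cell l x j) \<le> 2 powi (l j) * x $ j" "2 powi (l j) * x $ j < real_of_int (cell l x j) + 1"
        by (auto simp: cell_def)
      have eq: "2 powi (l j + int a) * x $ j = 2 ^ a * (2 powi (l j) * x $ j)" by (simp add: power_int_add)
      have "2 ^ a * real_of_int (cell l x j) \<le> 2 powi (l j + int a) * x $ j"
        unfolding eq using 1 by (intro mult_left_mono) auto
      then have "real_of_int (cell l x j * 2 ^ a) \<le> 2 powi (l j + int a) * x $ j" by (simp add: mult.commute)
      moreover have "2 powi (l j + int a) * x $ j < 2 ^ a * (real_of_int (cell l x j) + 1)"
        unfolding eq using 1 by (intro mult_strict_left_mono) auto
      then have "2 powi (l j + int a) * x $ j < real_of_int (cell l x j * 2 ^ a + 2 ^ a)" by (simp add: algebra_simps)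
      ultimately show "?f x \<in> {cell l x j * 2 ^ a..<cell l x j * 2 ^ a + 2 ^ a}"
        by (simp only: atLeastLessThan_iff le_floor_iff floor_less_iff)
    qed
    then have "card (?f ` {x \<in> set_pmf P. cell l x = y}) \<le> card {y j * 2 ^ a..<y j * 2 ^ a + 2 ^ a}"
      by (intro card_mono) auto
    then show "card (?f ` {x \<in> set_pmf P. cell l x = y}) \<le> 2 ^ a" by (simp add: nat_power_eq)
  qed simp
  also have "log 2 (real (2 ^ a)) = real a" by (simp add: log_nat_power)
  finally show ?thesis by (simp only: cell_ent_def)
qed

lemma cell_interval:
  "real_of_int (cell l x i) * 2 powi (- l i) \<le> x $ i"
  "x $ i \<le> real_of_int (cell l x i) * 2 powi (- l i) + 2 powi (- l i)"
proof -
  have p: "0 < (2::real) powi (l i)" by simp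
  have eq: "x $ i = (2 powi (l i) * x $ i) * 2 powi (- l i)" by (simp add: power_int_minus)
  have 1: "real_of_int (cell l x i) \<le> 2 powi (l i) * x $ i" "2 powi (l i) * x $ i \<le> real_of_int (cell l x i) + 1"
    unfolding cell_def by linarith+
  have "real_of_int (cell l x i) * 2 powi (- l i) \<le> (2 powi (l i) * x $ i) * 2 powi (- l i)"
    by (intro mult_right_mono 1) simp
  then show "real_of_int (cell l x i) * 2 powi (- l i) \<le> x $ i"
    by (simp only: eq[symmetric])
  have "(2 powi (l i) * x $ i) * 2 powi (- l i) \<le> (real_of_int (cell l x i) + 1) * 2 powi (- l i)"
    by (intro mult_right_mono 1) simp
  then show "x $ i \<le> real_of_int (cell l x i) * 2 powi (- l i) + 2 powi (- l i)"
    by (simp only: eq[symmetric] distrib_right mult_1)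
qed

text \<open>The loss of \<open>2 * CARD('n)\<close> accounts for the two cells per coordinate that a translated cell
  may meet.\<close>

lemma cell_ent_convolution_ge:
  fixes A B :: "(real ^ 'n) pmf"
  assumes A: "finite (set_pmf A)" and B: "finite (set_pmf B)" and "l \<le> l'"
  defines "Q \<equiv> map_pmf (\<lambda>(x, y). x + y) (pair_pmf A B)"
  shows "cell_ent A l' - cell_ent A l - 2 * real CARD('n) \<le> cell_ent Q l' - cell_ent Q l"
proof -
  let ?P = "pair_pmf A B"
  let ?s = "\<lambda>w. fst w + snd w"
  let ?h = "\<lambda>w. (cell l (fst w), snd w)"
  have fin: "finite (set_pmf ?P)" using A B by simp
  have Q: "cell_ent Q m = ent ?P (\<lambda>w. cell m (?s w))" for m
    unfolding Q_def cell_ent_def ent_map_pmf by (simp add: split_def)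
  \<comment> \<open>By independence, revealing the second summand does not affect the entropy of the
    first. Given the second summand, the cells of the first summand and of the sum determine each
    other up to two per coordinate; this is used once at \<open>l'\<close> and once at
    \<open>l\<close>.\<close>
  have "cell_ent A l' - cell_ent A l = cond_ent ?P (\<lambda>w. cell l' (fst w)) ?h"
  proof -
    have "ent ?P ?h = cell_ent A l + ent B id"
      using ent_pair_pmf[OF A B, of "cell l" id] by (simp add: split_def cell_ent_def)
    moreover have "ent ?P (\<lambda>w. (cell l' (fst w), ?h w)) = ent ?P (\<lambda>w. (cell l' (fst w), snd w))"
      by (rule ent_cong[OF fin]) (auto dest: cell_cong[OF \<open>l \<le> l'\<close>])
    moreover have "ent ?P (\<lambda>w. (cell l' (fst w), snd w)) = cell_ent A l' + ent B id"
      using ent_pair_pmf[OF A B, of "cell l'" id] by (simp add: split_def cell_ent_def)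
    ultimately show ?thesis by (simp add: cond_ent_def)
  qed
  also have "\<dots> \<le> cond_ent ?P (\<lambda>w. (cell l' (fst w), cell l' (?s w))) ?h"
    by (rule cond_ent_mono[OF fin]) auto
  also have "\<dots> = cond_ent ?P (\<lambda>w. cell l' (?s w)) ?h + cond_ent ?P (\<lambda>w. cell l' (fst w)) (\<lambda>w. (cell l' (?s w), ?h w))"
    by (rule cond_ent_chain[OF fin])
  also have "cond_ent ?P (\<lambda>w. cell l' (fst w)) (\<lambda>w. (cell l' (?s w), ?h w)) \<le> real CARD('n)"
  proof (rule cond_ent_cell_le[OF fin, where A = "\<lambda>(z, _, b) i. real_of_int (z i) * 2 powi (- l' i) - b $ i"])
    fix w :: "(real ^ 'n) \<times> (real ^ 'n)" and i
    show "(case (cell l' (?s w), ?h w) of (z, uu, b) \<Rightarrow> \<lambda>i. real_of_int (z i) * 2 powi (- l' i) - b $ i) i \<le> fst w $ i"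
      using cell_interval(1)[of l' "?s w" i] by simp
    show "fst w $ i \<le> (case (cell l' (?s w), ?h w) of (z, uu, b) \<Rightarrow> \<lambda>i. real_of_int (z i) * 2 powi (- l' i) - b $ i) i + 2 powi (- l' i)"
      using cell_interval(2)[of "?s w" i l'] by simp
  qed
  also have "cond_ent ?P (\<lambda>w. cell l' (?s w)) ?h \<le> cond_ent ?P (\<lambda>w. (cell l' (?s w), cell l (?s w))) ?h"
    by (rule cond_ent_mono[OF fin]) auto
  also have "\<dots> = cond_ent ?P (\<lambda>w. cell l (?s w)) ?h + cond_ent ?P (\<lambda>w. cell l' (?s w)) (\<lambda>w. (cell l (?s w), ?h w))"
    by (rule cond_ent_chain[OF fin])
  also have "cond_ent ?P (\<lambda>w. cell l (?s w)) ?h \<le> real CARD('n)"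
  proof (rule cond_ent_cell_le[OF fin, where A = "\<lambda>(z, b) i. real_of_int (z i) * 2 powi (- l i) + b $ i"])
    fix w :: "(real ^ 'n) \<times> (real ^ 'n)" and i
    show "(case ?h w of (z, b) \<Rightarrow> \<lambda>i. real_of_int (z i) * 2 powi (- l i) + b $ i) i \<le> ?s w $ i"
      using cell_interval(1)[of l "fst w" i] by simp
    show "?s w $ i \<le> (case ?h w of (z, b) \<Rightarrow> \<lambda>i. real_of_int (z i) * 2 powi (- l i) + b $ i) i + 2 powi (- l i)"
      using cell_interval(2)[of "fst w" i l] by simp
  qed
  also have "cond_ent ?P (\<lambda>w. cell l' (?s w)) (\<lambda>w. (cell l (?s w), ?h w)) \<le>
      cond_ent ?P (\<lambda>w. cell l' (?s w)) (\<lambda>w. cell l (?s w))"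
    by (rule cond_ent_antimono[OF fin])
  also have "\<dots> = cell_ent Q l' - cell_ent Q l"
  proof -
    have "ent ?P (\<lambda>w. (cell l' (?s w), cell l (?s w))) = ent ?P (\<lambda>w. cell l' (?s w))"
      by (rule ent_cong[OF fin]) (auto dest: cell_cong[OF \<open>l \<le> l'\<close>])
    then show ?thesis by (simp add: cond_ent_def Q)
  qed
  finally show ?thesis by simp
qed

text \<open>The number \<open>k\<close> of summands is chosen such that the standard deviation of the sum of the
  \<open>j\<close>-th coordinates, conditioned on the cells of the summands, is about \<open>2 ^ b\<close> cells. The other
  coordinates of the sum are then known up to two cells of level \<open>l'\<close>.\<close>

lemma cell_ent_conv_power_full:
  fixes P :: "(real ^ 'n) pmf" and a b :: nat
  assumes fin: "finite (set_pmf P)"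
    and nontrivial: "5 \<le> cell_ent P (l(j := l j + int a)) - cell_ent P l"
  obtains k where "k \<le> 4 ^ (a + b)"
    "\<And>l'. l' j = l j - int b \<Longrightarrow> (\<And>i. i \<noteq> j \<Longrightarrow> l' i \<le> l i - 2 * int (a + b)) \<Longrightarrow>
      real b - 14 - real CARD('n) \<le> cell_ent (conv_power P k) (l'(j := l j)) - cell_ent (conv_power P k) l'"
proof -
  define y where "y = (\<lambda>x :: real ^ 'n. x $ j)"
  define \<sigma> :: real where "\<sigma> = 2 powi (- l j)"
  define v where "v = copy_exp P (cell l) (\<lambda>x x'. (y x - y x')\<^sup>2)"
  have four_power: "(4::real) ^ n = (2 ^ n)\<^sup>2" for n
    by (simp add: power2_eq_square power_mult_distrib[symmetric])
  have \<sigma>: "0 < \<sigma>" by (simp add: \<sigma>_def)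
  have bound: "\<bar>y x - y x'\<bar> \<le> \<sigma>" if "cell l x' = cell l x" for x x'
    using cell_interval[where l = l and x = x and i = j] cell_interval[where l = l and x = x' and i = j] that
    by (simp add: y_def \<sigma>_def abs_le_iff)
  have floor_diff: "(real_of_int (\<lfloor>2 powi p * u\<rfloor> - \<lfloor>2 powi p * w\<rfloor>))\<^sup>2 \<le> 2 * (2 powi p)\<^sup>2 * (u - w)\<^sup>2 + 2"
    for p :: int and u w :: real
  proof -
    let ?d = "2 powi p * u - 2 powi p * w"
    have "\<bar>real_of_int (\<lfloor>2 powi p * u\<rfloor> - \<lfloor>2 powi p * w\<rfloor>)\<bar> \<le> \<bar>?d\<bar> + 1" by linarith
    then have "\<bar>real_of_int (\<lfloor>2 powi p * u\<rfloor> - \<lfloor>2 powi p * w\<rfloor>)\<bar>\<^sup>2 \<le> (\<bar>?d\<bar> + 1)\<^sup>2" by (intro power_mono) auto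
    also have "\<dots> \<le> 2 * ?d\<^sup>2 + 2" using zero_le_power2[of "\<bar>?d\<bar> - 1"] by (simp add: power2_eq_square algebra_simps)
    also have "?d\<^sup>2 = (2 powi p)\<^sup>2 * (u - w)\<^sup>2" by (simp add: power_mult_distrib[symmetric] right_diff_distrib)
    finally show ?thesis by simp
  qed
  \<comment> \<open>Otherwise the label of coordinate \<open>j\<close> at level
    \<open>l j + int a\<close> would have second moment at most 4 between copies, hence fewer than 5
    bits given the cell. The 5 in \<open>nontrivial\<close> comes from
    \<open>6 * (1 + 4) < 2 ^ 5\<close>.\<close>
  have \<sigma>2: "\<sigma>\<^sup>2 \<le> 4 ^ a * v"
  proof (rule ccontr)
    assume "\<not> \<sigma>\<^sup>2 \<le> 4 ^ a * v"
    then have less: "4 ^ a * v / \<sigma>\<^sup>2 \<le> 1" using \<sigma> by (simp add: divide_le_eq)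
    let ?f = "\<lambda>x. \<lfloor>2 powi (l j + int a) * y x\<rfloor>"
    have p: "(2 powi (l j + int a))\<^sup>2 = (4 ^ a / \<sigma>\<^sup>2 :: real)"
      by (simp add: \<sigma>_def power_int_add power_int_minus power_mult_distrib four_power field_simps)
    have "cond_ent P ?f (cell l) \<le> log 2 (6 * (1 + 4))"
    proof (rule cond_ent_le_variance[OF fin])
      have "copy_exp P (cell l) (\<lambda>x x'. (real_of_int (?f x - ?f x'))\<^sup>2) \<le>
        copy_exp P (cell l) (\<lambda>x x'. 2 * (2 powi (l j + int a))\<^sup>2 * (y x - y x')\<^sup>2 + 2)"
        by (rule copy_exp_mono[OF fin]) (rule floor_diff)
      also have "\<dots> = 2 * (2 powi (l j + int a))\<^sup>2 * v + 2"
        unfolding copy_exp_add[OF fin] copy_exp_cmult[OF fin] copy_exp_const[OF fin] v_def ..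
      also have "\<dots> = 2 * (4 ^ a * v / \<sigma>\<^sup>2) + 2" unfolding p by simp
      also have "\<dots> \<le> 4" using less by simp
      finally show "copy_exp P (cell l) (\<lambda>x x'. (real_of_int (?f x - ?f x'))\<^sup>2) \<le> 4" .
    qed
    also have "\<dots> < log 2 (2 ^ 5)" by (subst log_less_cancel_iff) auto
    also have "\<dots> = 5" by (subst log_nat_power) auto
    finally have "cond_ent P ?f (cell l) < 5" .
    moreover have "cell_ent P (l(j := l j + int a)) \<le> ent P (\<lambda>x. (?f x, cell l x))"
      unfolding cell_ent_def by (rule ent_mono[OF fin]) (auto simp: cell_def fun_eq_iff y_def)
    ultimately show False using nontrivial by (simp add: cond_ent_def cell_ent_def)
  qed
  have v: "0 < v" using \<sigma>2 \<sigma> by (smt (verit) zero_less_mult_pos zero_less_power)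
  have v_le: "v \<le> \<sigma>\<^sup>2"
  proof -
    have "v \<le> copy_exp P (cell l) (\<lambda>_ _. \<sigma>\<^sup>2)"
      unfolding v_def
    proof (rule copy_exp_mono[OF fin])
      fix x x' assume "cell l x' = cell l x"
      from power_mono[OF bound[OF this], of 2] show "(y x - y x')\<^sup>2 \<le> \<sigma>\<^sup>2" by simp
    qed
    then show ?thesis by (simp add: copy_exp_const[OF fin])
  qed
  \<comment> \<open>For this \<open>k\<close> the mean square \<open>real k * v\<close> of the
    difference of two copies of the sum lies between \<open>4 ^ b * \<sigma>\<^sup>2\<close> and
    twice that.\<close>
  define k where "k = nat \<lceil>4 ^ b * \<sigma>\<^sup>2 / v\<rceil>"
  have "0 \<le> 4 ^ b * \<sigma>\<^sup>2 / v" using v by simp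
  then have k_real: "4 ^ b * \<sigma>\<^sup>2 / v \<le> real k" "real k \<le> 4 ^ b * \<sigma>\<^sup>2 / v + 1"
    unfolding k_def by linarith+
  have kv1: "4 ^ b * \<sigma>\<^sup>2 \<le> real k * v" using k_real(1) v by (simp add: divide_le_eq)
  have kv2: "real k * v \<le> 2 * (4 ^ b * \<sigma>\<^sup>2)"
  proof -
    have "real k * v \<le> (4 ^ b * \<sigma>\<^sup>2 / v + 1) * v" using k_real(2) v by (intro mult_right_mono) auto
    also have "\<dots> = 4 ^ b * \<sigma>\<^sup>2 + v" using v by (simp add: distrib_right)
    also have "\<dots> \<le> 4 ^ b * \<sigma>\<^sup>2 + 1 * \<sigma>\<^sup>2" using v_le by simp
    also have "\<dots> \<le> 4 ^ b * \<sigma>\<^sup>2 + 4 ^ b * \<sigma>\<^sup>2" by (intro add_left_mono mult_right_mono) auto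
    finally show ?thesis by linarith
  qed
  have k_le: "k \<le> 4 ^ (a + b)"
  proof -
    have "4 ^ b * \<sigma>\<^sup>2 / v \<le> 4 ^ b * (4 ^ a * v) / v" using \<sigma>2 v by (intro divide_right_mono mult_left_mono) auto
    also have "\<dots> = real_of_int (4 ^ (a + b))" using v by (simp add: power_add)
    finally have "\<lceil>4 ^ b * \<sigma>\<^sup>2 / v\<rceil> \<le> 4 ^ (a + b)" by (simp only: ceiling_le_iff)
    then show ?thesis unfolding k_def by (simp add: nat_le_iff)
  qed
  show thesis
  proof (rule that[OF k_le])
    fix l' assume l'j: "l' j = l j - int b" and l'i: "\<And>i. i \<noteq> j \<Longrightarrow> l' i \<le> l i - 2 * int (a + b)"
    let ?R = "iid_list k P"
    let ?c = "map (cell l)"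
    let ?Y = "\<lambda>xs. sum_list (map y xs)"
    let ?f = "\<lambda>xs. \<lfloor>2 powi (l j) * ?Y xs\<rfloor>"
    let ?g = "\<lambda>xs. \<lfloor>2 powi (l j - int b) * ?Y xs\<rfloor>"
    let ?h = "\<lambda>xs. cell l' (sum_list xs)"
    have finR: "finite (set_pmf ?R)" by (rule finite_iid_list[OF fin])
    have sum_nth: "sum_list xs $ i = sum_list (map (\<lambda>x. x $ i) xs)" for xs :: "(real ^ 'n) list" and i
      by (induction xs) auto
    have Yj: "?Y xs = sum_list xs $ j" for xs by (simp add: sum_nth y_def)
    \<comment> \<open>Equal labels at level \<open>l j\<close> force a difference of at most
      \<open>\<sigma>\<close>. The small ball estimate with \<open>2 ^ b\<close> sample points
      bounds the collision probability by \<open>192 / 2 ^ b\<close>, and 192 is at most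
      \<open>2 ^ 8\<close>.\<close>
    have lower: "real b - 8 \<le> cond_ent ?R ?f ?c"
    proof -
      have "copy_exp ?R ?c (\<lambda>xs xs'. if ?f xs = ?f xs' then 1 else 0) \<le>
        copy_exp ?R ?c (\<lambda>xs xs'. if \<bar>?Y xs - ?Y xs'\<bar> \<le> \<sigma> then 1 else 0)"
      proof (rule copy_exp_mono[OF finR])
        fix xs xs'
        have "\<bar>?Y xs - ?Y xs'\<bar> \<le> \<sigma>" if "?f xs = ?f xs'"
        proof -
          have "\<bar>2 powi (l j) * ?Y xs - 2 powi (l j) * ?Y xs'\<bar> \<le> 1" using that by linarith
          then have "2 powi (l j) * \<bar>?Y xs - ?Y xs'\<bar> \<le> 1"
            by (simp only: right_diff_distrib[symmetric] abs_mult) simp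
          then show ?thesis by (simp add: \<sigma>_def power_int_minus field_simps)
        qed
        then show "(if ?f xs = ?f xs' then 1 else 0 :: real) \<le> (if \<bar>?Y xs - ?Y xs'\<bar> \<le> \<sigma> then 1 else 0)" by auto
      qed
      also have "\<dots> \<le> 192 / real (2 ^ b)"
      proof (rule small_ball_iid_list[OF fin \<sigma>])
        have "(real (2 ^ b) * \<sigma>)\<^sup>2 = 4 ^ b * \<sigma>\<^sup>2"
          by (simp add: power_mult_distrib four_power)
        with kv1 show "(real (2 ^ b) * \<sigma>)\<^sup>2 \<le> real k * copy_exp P (cell l) (\<lambda>x x'. (y x - y x')\<^sup>2)"
          by (simp add: v_def)
      qed (use bound in auto)
      also have "\<dots> \<le> 2 ^ 8 / 2 ^ b" by (simp add: divide_right_mono)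
      finally have "- log 2 (2 ^ 8 / 2 ^ b) \<le> cond_ent ?R ?f ?c"
        by (intro cond_ent_ge_collision[OF finR]) auto
      moreover have "log 2 (2 ^ 8 / 2 ^ b) = 8 - real b"
      proof -
        have pow: "log 2 (2 ^ n) = real n" for n by simp
        have "log 2 (2 ^ 8 / 2 ^ b) = log 2 (2 ^ 8) - log 2 (2 ^ b)" by (rule log_divide_pos) auto
        then show ?thesis by (simp only: pow of_nat_numeral)
      qed
      ultimately show ?thesis by simp
    qed
    \<comment> \<open>On the scale coarser by \<open>b\<close> levels the sum spreads over about one
      cell: second moment at most 6, hence at most \<open>log 2 42\<close> bits. With the 8 above
      this makes 13.5, rounded up to 14.\<close>
    have upper: "cond_ent ?R ?g ?c \<le> 5.5"
    proof -
      have p: "(2 powi (l j - int b))\<^sup>2 = 1 / (4 ^ b * \<sigma>\<^sup>2 :: real)"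
        by (simp add: \<sigma>_def power_int_diff power_int_minus power_divide four_power field_simps)
      have "cond_ent ?R ?g ?c \<le> log 2 (6 * (1 + 6))"
      proof (rule cond_ent_le_variance[OF finR])
        have "copy_exp ?R ?c (\<lambda>x x'. (real_of_int (?g x - ?g x'))\<^sup>2) \<le>
          copy_exp ?R ?c (\<lambda>x x'. 2 * (2 powi (l j - int b))\<^sup>2 * (?Y x - ?Y x')\<^sup>2 + 2)"
          by (rule copy_exp_mono[OF finR]) (rule floor_diff)
        also have "\<dots> = 2 * (2 powi (l j - int b))\<^sup>2 * (real k * v) + 2"
          unfolding copy_exp_add[OF finR] copy_exp_cmult[OF finR] copy_exp_const[OF finR]
            copy_exp_iid_list_square[OF fin] v_def ..
        also have "\<dots> \<le> 2 * (2 powi (l j - int b))\<^sup>2 * (2 * (4 ^ b * \<sigma>\<^sup>2)) + 2"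
          by (intro add_right_mono mult_left_mono kv2) auto
        also have "\<dots> = 6" unfolding p using \<sigma> by simp
        finally show "copy_exp ?R ?c (\<lambda>x x'. (real_of_int (?g x - ?g x'))\<^sup>2) \<le> 6" .
      qed
      also have "\<dots> = log 2 42" by simp
      also have "\<dots> \<le> 5.5"
      proof -
        have "2 * log 2 42 = log 2 (42 ^ 2)" by (subst log_nat_power) auto
        also have "\<dots> \<le> log 2 (2 ^ 11)" by (subst log_le_cancel_iff) auto
        also have "\<dots> = 11" by (subst log_nat_power) auto
        finally show ?thesis by simp
      qed
      finally show ?thesis .
    qed
    \<comment> \<open>In the other coordinates the cells of the summands locate the sum up to
      \<open>real k * 2 powi (- l i)\<close>, which is at most a cell of level \<open>l'\<close> by
      the gap of \<open>2 * int (a + b)\<close> digits.\<close>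
    have other: "cond_ent ?R ?h (\<lambda>xs. (?g xs, ?c xs)) \<le> real CARD('n)"
    proof (rule cond_ent_cell_le[OF finR, where A = "\<lambda>(g, zs) i. if i = j then real_of_int g * 2 powi (- l' j)
        else sum_list (map (\<lambda>z. real_of_int (z i) * 2 powi (- l i)) zs)"])
      fix xs i assume "xs \<in> set_pmf ?R"
      then have len: "length xs = k" using set_iid_list by blast
      have low: "sum_list (map (\<lambda>x. real_of_int (cell l x i) * 2 powi (- l i)) xs) \<le> sum_list (map (\<lambda>x. x $ i) xs)"
        by (intro sum_list_mono cell_interval(1))
      have up: "sum_list (map (\<lambda>x. x $ i) xs) \<le>
          sum_list (map (\<lambda>x. real_of_int (cell l x i) * 2 powi (- l i)) xs) + real (length xs) * 2 powi (- l i)"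
        by (induction xs) (auto simp: algebra_simps intro!: add_mono[OF cell_interval(2), THEN order_trans])
      have kl: "real k * 2 powi (- l i) \<le> 2 powi (- l' i)" if "i \<noteq> j"
      proof -
        have "real k \<le> 4 ^ (a + b)" using k_le by (metis of_nat_le_iff of_nat_numeral of_nat_power)
        also have "(4::real) ^ (a + b) = 2 ^ (2 * (a + b))"
          by (subst power_mult) (simp del: power_add)
        also have "\<dots> = 2 powi int (2 * (a + b))" by (simp only: power_int_of_nat)
        also have "int (2 * (a + b)) = 2 * int (a + b)" by simp
        finally have "real k * 2 powi (- l i) \<le> 2 powi (2 * int (a + b)) * 2 powi (- l i)"
          by (intro mult_right_mono) auto
        also have "\<dots> = 2 powi (2 * int (a + b) + - l i)" by (subst power_int_add) auto
        also have "\<dots> \<le> 2 powi (- l' i)" using l'i[OF that] by (intro power_int_increasing) auto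
        finally show ?thesis .
      qed
      have gj: "?g xs = cell l' (sum_list xs) j" by (simp add: cell_def l'j Yj)
      show "(case (?g xs, ?c xs) of (g, zs) \<Rightarrow> \<lambda>i. if i = j then real_of_int g * 2 powi (- l' j)
        else sum_list (map (\<lambda>z. real_of_int (z i) * 2 powi (- l i)) zs)) i \<le> sum_list xs $ i"
        using low cell_interval(1)[of l' "sum_list xs" j] by (auto simp: gj sum_nth comp_def simp del: of_int_floor_le)
      show "sum_list xs $ i \<le> (case (?g xs, ?c xs) of (g, zs) \<Rightarrow> \<lambda>i. if i = j then real_of_int g * 2 powi (- l' j)
        else sum_list (map (\<lambda>z. real_of_int (z i) * 2 powi (- l i)) zs)) i + 2 powi (- l' i)"
        using up kl cell_interval(2)[of "sum_list xs" j l'] by (auto simp: gj sum_nth comp_def len)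
    qed
    have E: "cell_ent (conv_power P k) m = ent ?R (\<lambda>xs. cell m (sum_list xs))" for m
      by (simp add: cell_ent_def conv_power_eq_sum_list ent_map_pmf)
    \<comment> \<open>Given the cells of the summands, \<open>?h\<close> costs no more than
      \<open>?g\<close> and the other coordinates, so most of the entropy of \<open>?f\<close> is
      left. Only then is the conditioning on the summands dropped, which cannot decrease it.\<close>
    have "real b - 8 \<le> cond_ent ?R ?f ?c" by (rule lower)
    also have "\<dots> \<le> cond_ent ?R (\<lambda>xs. (?f xs, ?h xs)) ?c" by (rule cond_ent_mono[OF finR]) auto
    also have "\<dots> = cond_ent ?R ?h ?c + cond_ent ?R ?f (\<lambda>xs. (?h xs, ?c xs))" by (rule cond_ent_chain[OF finR])
    also have "cond_ent ?R ?h ?c \<le> cond_ent ?R (\<lambda>xs. (?h xs, ?g xs)) ?c" by (rule cond_ent_mono[OF finR]) auto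
    also have "\<dots> = cond_ent ?R ?g ?c + cond_ent ?R ?h (\<lambda>xs. (?g xs, ?c xs))" by (rule cond_ent_chain[OF finR])
    also have "\<dots> \<le> 5.5 + real CARD('n)" by (intro add_mono upper other)
    also have "cond_ent ?R ?f (\<lambda>xs. (?h xs, ?c xs)) \<le> cond_ent ?R ?f ?h" by (rule cond_ent_antimono[OF finR])
    also have "\<dots> = cell_ent (conv_power P k) (l'(j := l j)) - cell_ent (conv_power P k) l'"
    proof -
      have "ent ?R (\<lambda>xs. (?f xs, ?h xs)) = ent ?R (\<lambda>xs. cell (l'(j := l j)) (sum_list xs))"
      proof (rule ent_cong[OF finR])
        fix xs xs'
        have le: "l' \<le> l'(j := l j)" by (simp add: le_fun_def l'j)
        have upd: "cell (l'(j := l j)) (sum_list xs) = (?h xs)(j := ?f xs)" for xs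
          by (rule ext) (simp add: cell_def Yj)
        show "cell (l'(j := l j)) (sum_list xs) = cell (l'(j := l j)) (sum_list xs') \<longleftrightarrow> (?f xs, ?h xs) = (?f xs', ?h xs')"
        proof
          assume eq: "cell (l'(j := l j)) (sum_list xs) = cell (l'(j := l j)) (sum_list xs')"
          have "?f xs = ?f xs'" using fun_cong[OF eq[unfolded upd], of j] by simp
          with cell_cong[OF le eq] show "(?f xs, ?h xs) = (?f xs', ?h xs')" by simp
        next
          assume "(?f xs, ?h xs) = (?f xs', ?h xs')"
          then show "cell (l'(j := l j)) (sum_list xs) = cell (l'(j := l j)) (sum_list xs')"
            by (simp only: upd prod.inject)
        qed
      qed
      then show ?thesis by (simp add: E cond_ent_def)
    qed
    finally show "real b - 14 - real CARD('n) \<le> cell_ent (conv_power P k) (l'(j := l j)) - cell_ent (conv_power P k) l'"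
      by simp
  qed
qed

section \<open>Multiscale analysis of lattice-submodular entropies\<close>

definition scale_levels :: "('n \<Rightarrow> real) \<Rightarrow> int \<Rightarrow> 'n \<Rightarrow> int" where
  "scale_levels chi q = (\<lambda>i. \<lfloor>chi i * of_int q\<rfloor>)"

text \<open>The properties of \<open>E K l\<close>, the entropy at the cells of level \<open>l\<close> of the \<open>K\<close>-th convolution
  power of a fixed distribution, on which the multiscale argument rests.\<close>

locale multiscale =
  fixes chi :: "'n::finite \<Rightarrow> real" and E :: "nat \<Rightarrow> ('n \<Rightarrow> int) \<Rightarrow> real" and c :: real
  assumes chi_pos: "0 < chi i"
    and c_nonneg: "0 \<le> c"
    and E_mono: "l \<le> l' \<Longrightarrow> E K l \<le> E K l'"
    and E_submod: "E K (sup l l') + E K (inf l l') \<le> E K l + E K l'"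
    and E_upd: "E K (l(i := l i + int a)) \<le> E K l + real a"
    and E_conv: "K \<le> K' \<Longrightarrow> l \<le> l' \<Longrightarrow> E K l' - E K l - c \<le> E K' l' - E K' l"
    and E_full: "5 \<le> E K (l(i := l i + int a)) - E K l \<Longrightarrow> K * 4 ^ (a + b) \<le> K' \<Longrightarrow>
      l' i = l i - int b \<Longrightarrow> (\<And>x. x \<noteq> i \<Longrightarrow> l' x \<le> l x - 2 * int (a + b)) \<Longrightarrow>
      real b - c \<le> E K' (l'(i := l i)) - E K' l'"
begin

abbreviation lv :: "int \<Rightarrow> 'n \<Rightarrow> int" where "lv \<equiv> scale_levels chi"

text \<open>\<open>G K J q L\<close> is the entropy of the coordinates in \<open>J\<close> at scale \<open>q + L\<close>, conditioned on all
  coordinates at scale \<open>q\<close>. It is superadditive in \<open>L\<close> only, because the other coordinates are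
  known at scale \<open>q + a\<close> in the second term of the \<open>defect\<close>.\<close>

definition lev :: "'n set \<Rightarrow> int \<Rightarrow> int \<Rightarrow> 'n \<Rightarrow> int" where
  "lev J q L = (\<lambda>i. if i \<in> J then lv (q + L) i else lv q i)"

definition G :: "nat \<Rightarrow> 'n set \<Rightarrow> int \<Rightarrow> int \<Rightarrow> real" where
  "G K J q L = E K (lev J q L) - E K (lv q)"

definition defect :: "nat \<Rightarrow> 'n set \<Rightarrow> int \<Rightarrow> int \<Rightarrow> int \<Rightarrow> real" where
  "defect K J q a b = G K J q (a + b) - G K J q a - G K J (q + a) b"

lemma lv_mono: "q \<le> q' \<Longrightarrow> lv q i \<le> lv q' i"
  unfolding scale_levels_def using chi_pos[of i] by (intro floor_mono mult_left_mono) auto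

lemma lv_diff:
  "real_of_int (lv q' i - lv q i) \<le> chi i * real_of_int (q' - q) + 1"
  "chi i * real_of_int (q' - q) - 1 \<le> real_of_int (lv q' i - lv q i)"
proof -
  have eq: "chi i * real_of_int (q' - q) = chi i * real_of_int q' - chi i * real_of_int q"
    by (simp add: right_diff_distrib)
  show "real_of_int (lv q' i - lv q i) \<le> chi i * real_of_int (q' - q) + 1"
    "chi i * real_of_int (q' - q) - 1 \<le> real_of_int (lv q' i - lv q i)"
    unfolding eq scale_levels_def by linarith+
qed

lemma lev_empty: "lev {} q L = lv q" by (simp add: lev_def)

lemma G_empty: "G K {} q L = 0" by (simp add: G_def lev_empty)

lemma G_mono: "J \<subseteq> J' \<Longrightarrow> 0 \<le> L \<Longrightarrow> G K J q L \<le> G K J' q L"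
  unfolding G_def by (intro diff_right_mono E_mono) (auto simp: lev_def le_fun_def intro!: lv_mono)

lemma G_nonneg: "0 \<le> L \<Longrightarrow> 0 \<le> G K J q L"
  using G_mono[of "{}" J L K q] by (simp add: G_empty)

lemma G_insert_le:
  assumes "0 \<le> L" "i \<notin> J"
  shows "G K (insert i J) q L \<le> G K J q L + (chi i * of_int L + 1)"
proof -
  let ?a = "nat (lv (q + L) i - lv q i)"
  have le: "lv q i \<le> lv (q + L) i" using assms by (intro lv_mono) auto
  have "lev (insert i J) q L = (lev J q L)(i := lev J q L i + int ?a)"
    using assms le by (auto simp: lev_def fun_eq_iff)
  then have "E K (lev (insert i J) q L) \<le> E K (lev J q L) + real ?a" using E_upd by metis
  also have "real ?a \<le> chi i * of_int L + 1" using lv_diff(1)[of "q + L" i q] le by simp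
  finally show ?thesis by (simp add: G_def)
qed

lemma G_submod:
  assumes "J' \<subseteq> J" "i \<notin> J" "0 \<le> L"
  shows "G K (insert i J) q L - G K J q L \<le> G K (insert i J') q L - G K J' q L"
proof -
  have le: "lv q x \<le> lv (q + L) x" for x using assms by (intro lv_mono) auto
  have "sup (lev (insert i J') q L) (lev J q L) = lev (insert i J) q L"
    "inf (lev (insert i J') q L) (lev J q L) = lev J' q L"
    using assms le by (auto simp: lev_def fun_eq_iff sup_int_def inf_int_def)
  then show ?thesis using E_submod[of K "lev (insert i J') q L" "lev J q L"] by (simp add: G_def)
qed

text \<open>Submodularity: for the second part of the block, coarser knowledge of the coordinates
  outside \<open>J\<close> leaves more entropy.\<close>

lemma defect_nonneg:
  assumes "0 \<le> a" "0 \<le> b"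
  shows "0 \<le> defect K J q a b"
proof -
  have le: "lv q x \<le> lv (q + a) x" "lv (q + a) x \<le> lv (q + (a + b)) x" for x
    using assms by (auto intro!: lv_mono)
  have "sup (lev J q (a + b)) (lv (q + a)) = lev J (q + a) b"
    "inf (lev J q (a + b)) (lv (q + a)) = lev J q a"
    using le by (auto simp: lev_def fun_eq_iff sup_int_def inf_int_def add.assoc)
  then show ?thesis using E_submod[of K "lev J q (a + b)" "lv (q + a)"] by (simp add: G_def defect_def)
qed

lemma G_conv: "K \<le> K' \<Longrightarrow> 0 \<le> L \<Longrightarrow> G K J q L - c \<le> G K' J q L"
  unfolding G_def by (rule E_conv) (auto simp: lev_def le_fun_def intro!: lv_mono)

text \<open>Some entropy of \<open>i\<close> after \<open>q\<close> becomes saturation of the block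
  before \<open>q\<close>, for more copies. \<open>E_full\<close> coarsens the other coordinates by
  \<open>2 * int (a + b)\<close> digits, for which \<open>R\<close> scales suffice. So
  \<open>J\<close> is taken at \<open>q + L + R\<close> to end at \<open>q\<close>, and the
  remaining coordinates drop from \<open>q\<close> to \<open>q - m - R\<close>. The extension of
  \<open>J\<close> beyond \<open>q + L\<close> is paid for by the \<open>defect\<close> in
  \<open>five\<close>.\<close>

lemma promote:
  assumes i: "i \<notin> J" and L: "0 \<le> R" "0 \<le> m" "m \<le> L" and X: "chi i \<le> X"
    and five: "5 \<le> G K (insert i J) q L - G K J q L - defect K J q L R"
    and K': "K * 4 ^ (2 * nat \<lceil>X * of_int L\<rceil> + 2) \<le> K'"
    and R: "\<And>x. 4 * X * of_int L + 9 \<le> chi x * of_int R"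
  defines "l' \<equiv> (\<lambda>x. if x = i then lv (q - m) x else if x \<in> J then lv q x else lv (q - m - R) x)"
  shows "chi i * of_int m - 1 - c \<le> E K' (l'(i := lv q i)) - E K' l'"
proof -
  let ?l = "lev J q (L + R)"
  let ?a = "nat (lv (q + L) i - lv q i)" and ?b = "nat (lv q i - lv (q - m) i)"
  let ?M = "?l(i := lv (q + L) i)"
  have a: "lv q i \<le> lv (q + L) i" using L by (intro lv_mono) auto
  have b: "lv (q - m) i \<le> lv q i" using L by (intro lv_mono) auto
  have XL: "0 \<le> X * of_int L" using chi_pos[of i] X L by auto
  have ceil: "chi i * of_int L' \<le> of_int \<lceil>X * of_int L\<rceil>" if "0 \<le> L'" "L' \<le> L" for L'
  proof -
    have "chi i * of_int L' \<le> X * of_int L" using that X chi_pos[of i] by (intro mult_mono) auto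
    then show ?thesis by linarith
  qed
  have a_le: "?a \<le> nat \<lceil>X * of_int L\<rceil> + 1"
    using lv_diff(1)[of "q + L" i q] ceil[of L] L a XL by simp
  have b_le: "?b \<le> nat \<lceil>X * of_int L\<rceil> + 1"
    using lv_diff(1)[of q i "q - m"] ceil[of m] L b XL by simp
  have ab: "?a + ?b \<le> 2 * nat \<lceil>X * of_int L\<rceil> + 2" using a_le b_le by simp
  have ab_real: "2 * real_of_int (int (?a + ?b)) \<le> 4 * X * of_int L + 8"
  proof -
    have "real (?a + ?b) \<le> real (2 * nat \<lceil>X * of_int L\<rceil> + 2)" using ab by (simp only: of_nat_le_iff)
    also have "\<dots> = 2 * of_int \<lceil>X * of_int L\<rceil> + 2" using XL by simp
    also have "\<dots> \<le> 2 * (X * of_int L + 1) + 2" by (intro add_mono mult_left_mono) linarith+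
    finally have "2 * real (?a + ?b) \<le> 2 * (2 * (X * of_int L + 1) + 2)" by (rule mult_left_mono) simp
    also have "2 * (2 * (X * of_int L + 1) + 2) = 4 * X * of_int L + 8" by (simp add: algebra_simps)
    finally show ?thesis by (simp only: of_int_of_nat_eq)
  qed
  \<comment> \<open>The constant 9 is the 8 of \<open>ab_real\<close> plus 1 for the floors in the
    levels.\<close>
  have far: "lv p x \<le> lv p' x - 2 * int (?a + ?b)" if "p + R \<le> p'" for p p' x
  proof -
    have "chi x * of_int R \<le> chi x * of_int (p' - p)" using chi_pos[of x] that by (intro mult_left_mono) auto
    then have "4 * X * of_int L + 9 \<le> chi x * of_int (p' - p)" using R[of x] by linarith
    then have "real_of_int (2 * int (?a + ?b)) \<le> real_of_int (lv p' x - lv p x)"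
      using lv_diff(2)[of x p' p] ab_real by simp
    then show ?thesis by linarith
  qed
  have "real ?b - c \<le> E K' (l'(i := ?l i)) - E K' l'"
  proof (rule E_full[of K ?l i ?a ?b K' l'])
    \<comment> \<open>Submodularity for \<open>?M\<close> and the uniform level at
      \<open>q + L\<close>: raising \<open>i\<close> on top of \<open>?l\<close> gains at least the
      increment of \<open>G\<close> less the defect.\<close>
    have sub: "sup ?M (lv (q + L)) = lev J (q + L) R" "inf ?M (lv (q + L)) = lev (insert i J) q L"
    proof -
      have le: "lv q x \<le> lv (q + L) x" "lv (q + L) x \<le> lv (q + (L + R)) x" for x
        using L by (auto intro!: lv_mono)
      show "sup ?M (lv (q + L)) = lev J (q + L) R" "inf ?M (lv (q + L)) = lev (insert i J) q L"
        using i le by (auto simp: lev_def fun_eq_iff sup_int_def inf_int_def add.assoc)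
    qed
    have "?l(i := ?l i + int ?a) = ?M" using i a by (simp add: lev_def)
    then show "5 \<le> E K (?l(i := ?l i + int ?a)) - E K ?l"
      using five E_submod[of K ?M "lv (q + L)"] unfolding sub by (simp add: G_def defect_def)
    show "K * 4 ^ (?a + ?b) \<le> K'"
      by (rule order_trans[OF mult_le_mono2[OF power_increasing[OF ab]] K']) simp
    show "l' i = ?l i - int ?b" using i b by (simp add: l'_def lev_def)
    fix x assume "x \<noteq> i"
    then show "l' x \<le> ?l x - 2 * int (?a + ?b)"
      using far[of q "q + (L + R)" x] far[of "q - m - R" q x] L unfolding l'_def lev_def by auto
  qed
  moreover have "?l i = lv q i" using i by (simp add: lev_def)
  moreover have "chi i * of_int m - 1 \<le> real ?b" using lv_diff(2)[of i q "q - m"] b by simp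
  ultimately show ?thesis by simp
qed

text \<open>In \<open>promote\<close> the coordinates outside \<open>insert i J\<close> are known at
  \<open>q - m - R\<close>, whereas \<open>G\<close> at \<open>q - m\<close> has them at
  \<open>q - m\<close>. Submodularity exchanges the two for a defect starting \<open>R\<close>
  scales before the block.\<close>

lemma promote_G:
  assumes i: "i \<notin> J" and L: "0 \<le> R" "0 \<le> m" "m \<le> L" and X: "chi i \<le> X"
    and five: "5 \<le> G K (insert i J) q L - G K J q L - defect K J q L R"
    and K': "K * 4 ^ (2 * nat \<lceil>X * of_int L\<rceil> + 2) \<le> K'"
    and R: "\<And>x. 4 * X * of_int L + 9 \<le> chi x * of_int R"
  shows "chi i * of_int m - 1 - c \<le> G K' (insert i J) (q - m) m - G K' J (q - m) m +
    defect K' (insert i J) (q - m - R) R m"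
proof -
  define l' where "l' = (\<lambda>x. if x = i then lv (q - m) x else if x \<in> J then lv q x else lv (q - m - R) x)"
  have main: "chi i * of_int m - 1 - c \<le> E K' (l'(i := lv q i)) - E K' l'"
    unfolding l'_def by (rule promote[OF assms])
  have le: "lv (q - m - R) x \<le> lv (q - m) x" "lv (q - m) x \<le> lv q x" for x
    using L by (auto intro!: lv_mono)
  have "l'(i := lv q i) = lev (insert i J) (q - m - R) (R + m)"
    by (auto simp: l'_def lev_def fun_eq_iff)
  moreover have "sup l' (lv (q - m)) = lev J (q - m) m" "inf l' (lv (q - m)) = lev (insert i J) (q - m - R) R"
    using i le by (auto simp: l'_def lev_def fun_eq_iff sup_int_def inf_int_def)
  ultimately show ?thesis
    using main E_submod[of K' l' "lv (q - m)"] by (simp add: G_def defect_def)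
qed

end

text \<open>Such a \<open>g\<close> is close to the total weight of the non-negligible points: a minimal set violating
  this would have the same total weight after the removal of any of its points, but the weights are
  distinct.\<close>

lemma submodular_dichotomy:
  fixes g :: "'n::finite set \<Rightarrow> real" and w :: "'n \<Rightarrow> real"
  assumes g_empty: "g {} = 0"
    and g_mono: "\<And>J J'. J \<subseteq> J' \<Longrightarrow> g J \<le> g J'"
    and g_step: "\<And>i J. i \<notin> J \<Longrightarrow> g (insert i J) \<le> g J + (w i + \<kappa>)"
    and g_submod: "\<And>i J J'. J' \<subseteq> J \<Longrightarrow> i \<notin> J \<Longrightarrow> g (insert i J) - g J \<le> g (insert i J') - g J'"
    and dich: "\<And>i J. i \<notin> J \<Longrightarrow> g (insert i J) - g J < \<kappa> \<or> w i - \<gamma> \<le> g (insert i J) - g J"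
    and sep: "\<And>i i'. i \<noteq> i' \<Longrightarrow> 3 * real CARD('n) * \<gamma> < \<bar>w i - w i'\<bar>"
    and \<kappa>: "0 < \<kappa>" "\<kappa> \<le> \<gamma>" and j: "\<kappa> \<le> g {j}"
  shows "w j - 3 * real CARD('n) * \<gamma> \<le> g UNIV - g (UNIV - {j})"
proof -
  define A where "A = {i. \<kappa> \<le> g {i}}"
  have upper: "g J \<le> (\<Sum>i\<in>J. w i + \<kappa>)" for J
  proof (induction J rule: finite_induct[OF finite])
    case (2 i J)
    then show ?case using g_step[of i J] by simp
  qed (simp add: g_empty)
  have lower: "(\<Sum>i\<in>J. w i - \<gamma>) \<le> g J" if "J \<subseteq> A" for J
    using that
  proof (induction "card J" arbitrary: J rule: less_induct)
    case less
    have IH: "(\<Sum>x\<in>J - {i}. w x - \<gamma>) \<le> g (J - {i})" if "i \<in> J" for i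
      using less.prems by (intro less.hyps card_Diff1_less that) auto
    have split: "(\<Sum>x\<in>J. f x) = f i + (\<Sum>x\<in>J - {i}. f x)" if "i \<in> J" for i and f :: "'n \<Rightarrow> real"
      by (rule sum.remove[OF finite that])
    show ?case
    proof (cases "\<exists>i\<in>J. w i - \<gamma> \<le> g J - g (J - {i})")
      case True
      then obtain i where i: "i \<in> J" "w i - \<gamma> \<le> g J - g (J - {i})" by blast
      show ?thesis using IH[OF i(1)] i(2) unfolding split[OF i(1)] by linarith
    next
      case False
      have small: "g J - g (J - {i}) < \<kappa>" if "i \<in> J" for i
        using dich[of i "J - {i}"] False that by (auto simp: insert_absorb)
      show ?thesis
      proof (cases "J = {}")
        case True
        then show ?thesis by (simp add: g_empty)
      next
        case False
        then obtain i0 where i0: "i0 \<in> J" by blast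
        have "J \<noteq> {i0}"
        proof
          assume "J = {i0}"
          then show False using small[of i0] less.prems by (auto simp: A_def g_empty)
        qed
        with i0 obtain i1 where i1: "i1 \<in> J" "i1 \<noteq> i0" by blast
        \<comment> \<open>With \<open>i'\<close> the lighter point, \<open>g J\<close> is at least
          about the weight of \<open>J - {i'}\<close> and at most about that of
          \<open>J - {i}\<close>, although the former is larger by
          \<open>w i - w i'\<close>.\<close>
        obtain i i' where ii: "i \<in> J" "i' \<in> J" "i \<noteq> i'" "w i' \<le> w i"
          using i0 i1 by (cases "w i1 \<le> w i0") (force, metis linear)
        have gap: "3 * real CARD('n) * \<gamma> < w i - w i'" using sep[of i i'] ii by simp
        have cardJ: "real (card J) \<le> real CARD('n)" by (simp add: card_mono)
        have "(\<Sum>x\<in>J - {i'}. w x - \<gamma>) \<le> g (J - {i'})" by (rule IH[OF ii(2)])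
        also have "\<dots> \<le> g J" by (rule g_mono) auto
        also have "\<dots> \<le> g (J - {i}) + \<kappa>" using small[OF ii(1)] by simp
        also have "\<dots> \<le> (\<Sum>x\<in>J - {i}. w x + \<kappa>) + \<kappa>" using upper by simp
        finally have "(\<Sum>x\<in>J. w x - \<gamma>) - (w i' - \<gamma>) \<le> (\<Sum>x\<in>J. w x + \<kappa>) - (w i + \<kappa>) + \<kappa>"
          unfolding split[OF ii(1), of "\<lambda>x. w x + \<kappa>"] split[OF ii(2), of "\<lambda>x. w x - \<gamma>"] by simp
        then have "w i - w i' \<le> real (card J) * (\<gamma> + \<kappa>)"
          using \<kappa> by (simp add: sum.distrib sum_subtractf algebra_simps)
        also have "\<dots> \<le> real CARD('n) * (\<gamma> + \<gamma>)" using \<kappa> cardJ by (intro mult_mono) auto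
        also have "\<dots> \<le> 3 * real CARD('n) * \<gamma>" using \<kappa> by simp
        finally show ?thesis using gap by simp
      qed
    qed
  qed
  have negl: "g (J \<union> F) \<le> g J + real (card F) * \<kappa>" if "F \<inter> A = {}" for J F
    using that
  proof (induction F rule: finite_induct[OF finite])
    case (2 i F)
    show ?case
    proof (cases "i \<in> J \<union> F")
      case True
      have "J \<union> insert i F = J \<union> F" using True by auto
      moreover have "real (card F) * \<kappa> \<le> real (card (insert i F)) * \<kappa>" using \<kappa> by (intro mult_right_mono) (auto intro: card_mono)
      ultimately show ?thesis using 2 by simp
    next
      case False
      have "g (insert i (J \<union> F)) - g (J \<union> F) \<le> g {i} - g {}" using False by (intro g_submod) auto
      moreover have "g {i} < \<kappa>" using 2 by (auto simp: A_def)
      ultimately show ?thesis using 2 by (simp add: g_empty distrib_right)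
    qed
  qed simp
  have jA: "j \<in> A" using j by (simp add: A_def)
  have cardA: "real (card A) \<le> real CARD('n)" by (simp add: card_mono)
  have "g (UNIV - {j}) \<le> g (A - {j}) + real (card (UNIV - A)) * \<kappa>"
  proof -
    have "(A - {j}) \<union> (UNIV - A) = UNIV - {j}" using jA by auto
    then show ?thesis using negl[of "UNIV - A" "A - {j}"] by auto
  qed
  also have "\<dots> \<le> (\<Sum>i\<in>A - {j}. w i + \<kappa>) + real CARD('n) * \<kappa>"
    using upper \<kappa> by (intro add_mono mult_right_mono) (auto simp: card_mono)
  finally have 1: "g (UNIV - {j}) \<le> (\<Sum>i\<in>A. w i + \<kappa>) - (w j + \<kappa>) + real CARD('n) * \<kappa>"
    using sum.remove[OF finite jA, of "\<lambda>i. w i + \<kappa>"] by simp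
  have 2: "(\<Sum>i\<in>A. w i - \<gamma>) \<le> g UNIV" using lower[of A] g_mono[of A UNIV] by simp
  \<comment> \<open>The factor 3 consists of \<open>\<gamma>\<close> and \<open>\<kappa>\<close> for
    each point of \<open>A\<close> and of \<open>\<kappa>\<close> for each negligible point.\<close>
  have "real (card A) * (\<gamma> + \<kappa>) + real CARD('n) * \<kappa> \<le> real CARD('n) * (\<gamma> + \<gamma>) + real CARD('n) * \<gamma>"
    using \<kappa> cardA by (intro add_mono mult_mono) auto
  then show ?thesis using 1 2 \<kappa> by (simp add: sum.distrib sum_subtractf algebra_simps)
qed

text \<open>Only the first \<open>s\<close> terms leave the window, an error that does not grow with
  \<open>n\<close>.\<close>

lemma sum_int_shift:
  fixes F :: "int \<Rightarrow> real"
  assumes "0 \<le> s" and F: "\<And>q. 0 \<le> F q" "\<And>q. F q \<le> U"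
  shows "(\<Sum>q\<in>{0..<n}. F q) - of_int s * U \<le> (\<Sum>q\<in>{0..<n}. F (q + s))"
proof -
  have "(\<Sum>q\<in>{0..<n}. F q) \<le> (\<Sum>q\<in>{0..<s} \<union> {s..<n + s}. F q)"
    using F \<open>0 \<le> s\<close> by (intro sum_mono2) auto
  also have "\<dots> = (\<Sum>q\<in>{0..<s}. F q) + (\<Sum>q\<in>{s..<n + s}. F q)"
    by (rule sum.union_disjoint) auto
  also have "(\<Sum>q\<in>{0..<s}. F q) \<le> (\<Sum>q\<in>{0..<s}. U)" by (intro sum_mono F)
  also have "\<dots> = of_int s * U" using \<open>0 \<le> s\<close> by simp
  also have "(\<Sum>q\<in>{s..<n + s}. F q) = (\<Sum>q\<in>{0..<n}. F (q + s))"
    by (rule sum.reindex_bij_witness[of _ "\<lambda>q. q + s" "\<lambda>q. q - s"]) auto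
  finally show ?thesis by simp
qed

text \<open>Markov's inequality for the counting measure.\<close>

lemma card_le_sum_div:
  fixes F :: "int \<Rightarrow> real"
  assumes "finite S" "0 < a" "\<And>q. q \<in> S \<Longrightarrow> 0 \<le> F q"
  shows "real (card {q\<in>S. a \<le> F q}) \<le> (\<Sum>q\<in>S. F q) / a"
proof -
  have "a * real (card {q\<in>S. a \<le> F q}) = (\<Sum>q\<in>{q\<in>S. a \<le> F q}. a)" by simp
  also have "\<dots> \<le> (\<Sum>q\<in>{q\<in>S. a \<le> F q}. F q)" by (rule sum_mono) auto
  also have "\<dots> \<le> (\<Sum>q\<in>S. F q)" using assms by (intro sum_mono2) auto
  finally show ?thesis using \<open>0 < a\<close> by (simp add: le_divide_eq mult.commute)
qed

section \<open>Averages over the position of the block: superadditivity, boundary errors,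
  stationarity\<close>

context multiscale
begin

definition T :: "int \<Rightarrow> nat \<Rightarrow> 'n set \<Rightarrow> int \<Rightarrow> real" where
  "T n K J L = (\<Sum>q\<in>{0..<n}. G K J q L)"

definition weight :: real where "weight = (\<Sum>i\<in>UNIV. chi i + 1)"

lemma weight_nonneg: "0 \<le> weight"
  unfolding weight_def by (intro sum_nonneg add_nonneg_nonneg) (auto intro: less_imp_le chi_pos)

lemma G_le:
  assumes "1 \<le> L"
  shows "G K J q L \<le> weight * of_int L"
proof -
  have "G K J q L \<le> (\<Sum>i\<in>J. chi i * of_int L + 1)"
  proof (induction J rule: finite_induct[OF finite])
    case (2 i J)
    then show ?case using G_insert_le[of L i J K q] assms by simp
  qed (simp add: G_empty)
  also have "\<dots> \<le> (\<Sum>i\<in>UNIV. chi i * of_int L + 1)"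
    using assms chi_pos by (intro sum_mono2) (auto intro!: add_nonneg_nonneg mult_nonneg_nonneg intro: less_imp_le)
  also have "\<dots> \<le> (\<Sum>i\<in>UNIV. (chi i + 1) * of_int L)"
    using assms by (intro sum_mono) (simp add: distrib_right)
  finally show ?thesis by (simp add: weight_def sum_distrib_right)
qed

lemma T_bounds: "1 \<le> L \<Longrightarrow> 0 \<le> n \<Longrightarrow> 0 \<le> T n K J L \<and> T n K J L \<le> weight * of_int L * of_int n"
  unfolding T_def using sum_mono[of "{0..<n}" "\<lambda>q. G K J q L" "\<lambda>_. weight * of_int L"] G_le[of L K J]
  by (auto intro!: sum_nonneg G_nonneg simp: mult.commute)

lemma T_conv:
  assumes "K \<le> K'" "0 \<le> L" "0 \<le> n"
  shows "T n K J L - c * of_int n \<le> T n K' J L"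
proof -
  have "(\<Sum>q\<in>{0..<n}. G K J q L - c) \<le> T n K' J L"
    unfolding T_def by (intro sum_mono G_conv assms)
  then show ?thesis using \<open>0 \<le> n\<close> by (simp add: sum_subtractf T_def mult.commute)
qed

lemma T_add:
  assumes "1 \<le> a" "1 \<le> b"
  shows "T n K J a + T n K J b - of_int a * (weight * of_int b) + (\<Sum>q\<in>{0..<n}. defect K J q a b) \<le> T n K J (a + b)"
proof -
  have "T n K J b - of_int a * (weight * of_int b) \<le> (\<Sum>q\<in>{0..<n}. G K J (q + a) b)"
    unfolding T_def using assms by (intro sum_int_shift G_nonneg G_le) auto
  moreover have "(\<Sum>q\<in>{0..<n}. defect K J q a b) = T n K J (a + b) - T n K J a - (\<Sum>q\<in>{0..<n}. G K J (q + a) b)"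
    by (simp add: T_def defect_def sum_subtractf)
  ultimately show ?thesis by simp
qed

lemma sum_defect_nonneg: "0 \<le> a \<Longrightarrow> 0 \<le> b \<Longrightarrow> 0 \<le> (\<Sum>q\<in>{0..<n}. defect K J q a b)"
  by (intro sum_nonneg defect_nonneg)

text \<open>Iterated superadditivity. The quadratic error collects the shifts of the window; it is
  harmless because it does not depend on \<open>n\<close>.\<close>

lemma T_mult:
  assumes "1 \<le> L" "1 \<le> b"
  shows "of_nat b * T n K J L - (of_nat b)\<^sup>2 * (of_int L)\<^sup>2 * weight \<le> T n K J (int b * L)"
  using \<open>1 \<le> b\<close>
proof (induction b rule: dec_induct)
  case base
  then show ?case using weight_nonneg by simp
next
  case (step b)
  have "1 * 1 \<le> int b * L" using step assms by (intro mult_mono) auto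
  then have b: "1 \<le> int b * L" by simp
  have "0 \<le> (\<Sum>q\<in>{0..<n}. defect K J q (int b * L) L)" using b assms by (intro sum_defect_nonneg) auto
  then have "T n K J (int b * L) + T n K J L - of_int (int b * L) * (weight * of_int L) \<le> T n K J (int b * L + L)"
    using T_add[OF b \<open>1 \<le> L\<close>, of n K J] by simp
  moreover have "int b * L + L = int (Suc b) * L" by (simp add: algebra_simps)
  moreover have "(of_nat b)\<^sup>2 * (of_int L)\<^sup>2 * weight + of_int (int b * L) * (weight * of_int L) \<le> (of_nat (Suc b))\<^sup>2 * (of_int L)\<^sup>2 * weight"
  proof -
    have "(of_nat (Suc b))\<^sup>2 * (of_int L)\<^sup>2 * weight - ((of_nat b)\<^sup>2 * (of_int L)\<^sup>2 * weight + of_int (int b * L) * (weight * of_int L)) = (of_nat b + 1) * ((of_int L)\<^sup>2 * weight)"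
      by (simp add: power2_eq_square algebra_simps)
    also have "\<dots> \<ge> 0" using weight_nonneg by simp
    finally show ?thesis by simp
  qed
  ultimately show ?case using step.IH by (simp add: distrib_right)
qed

text \<open>Cutting a block of \<open>B\<close> pieces into one and \<open>b\<close> pieces, in
  either order, has total defect at most the excess of \<open>T\<close> over \<open>B\<close> single
  pieces, because all further cuts lose nothing but boundary errors. So almost stationary averages
  force small defects.\<close>

lemma sum_defect_le:
  assumes "1 \<le> L" "1 \<le> b"
  defines "R \<equiv> int b * L" and "B \<equiv> b + 1"
  defines "W \<equiv> int B * L"
  shows "(\<Sum>q\<in>{0..<n}. defect K J q L R) \<le> T n K J W - of_nat B * T n K J L + (of_nat B)\<^sup>2 * (of_int L)\<^sup>2 * weight"
    and "(\<Sum>q\<in>{0..<n}. defect K J q R L) \<le> T n K J W - of_nat B * T n K J L + (of_nat B)\<^sup>2 * (of_int L)\<^sup>2 * weight"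
proof -
  have "1 * 1 \<le> int b * L" using assms by (intro mult_mono) auto
  then have R: "1 \<le> R" by (simp add: R_def)
  have W: "L + R = W" "R + L = W" by (simp_all add: R_def W_def B_def algebra_simps)
  have TR: "of_nat b * T n K J L - (of_nat b)\<^sup>2 * (of_int L)\<^sup>2 * weight \<le> T n K J R"
    unfolding R_def by (rule T_mult[OF assms(1,2)])
  have le: "(of_nat b)\<^sup>2 * (of_int L)\<^sup>2 * weight + of_int L * (weight * of_int R) \<le> (of_nat B)\<^sup>2 * (of_int L)\<^sup>2 * weight"
  proof -
    have "(of_nat B)\<^sup>2 * (of_int L)\<^sup>2 * weight - ((of_nat b)\<^sup>2 * (of_int L)\<^sup>2 * weight + of_int L * (weight * of_int R)) = (of_nat b + 1) * ((of_int L)\<^sup>2 * weight)"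
      by (simp add: R_def B_def power2_eq_square algebra_simps)
    also have "\<dots> \<ge> 0" using weight_nonneg by simp
    finally show ?thesis by simp
  qed
  show "(\<Sum>q\<in>{0..<n}. defect K J q L R) \<le> T n K J W - of_nat B * T n K J L + (of_nat B)\<^sup>2 * (of_int L)\<^sup>2 * weight"
    using T_add[OF \<open>1 \<le> L\<close> R, of n K J] TR le unfolding W by (simp add: B_def distrib_right)
  show "(\<Sum>q\<in>{0..<n}. defect K J q R L) \<le> T n K J W - of_nat B * T n K J L + (of_nat B)\<^sup>2 * (of_int L)\<^sup>2 * weight"
    using T_add[OF R \<open>1 \<le> L\<close>, of n K J] TR le unfolding W by (simp add: B_def distrib_right mult_ac)
qed

definition rate :: "int \<Rightarrow> nat \<Rightarrow> 'n set \<Rightarrow> int \<Rightarrow> real" where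
  "rate n K J L = T n K J L / (of_int L * of_int n)"

lemma rate_bounds: "1 \<le> L \<Longrightarrow> 1 \<le> n \<Longrightarrow> 0 \<le> rate n K J L \<and> rate n K J L \<le> weight"
  using T_bounds[of L n K J] by (auto simp: rate_def divide_le_eq mult_ac)

lemma rate_conv:
  assumes "K \<le> K'" "1 \<le> L" "1 \<le> n" "c \<le> e * of_int L"
  shows "rate n K J L - e \<le> rate n K' J L"
proof -
  have "T n K J L - e * of_int L * of_int n \<le> T n K J L - c * of_int n"
    using assms by (intro diff_left_mono mult_right_mono) auto
  also have "\<dots> \<le> T n K' J L" using assms by (intro T_conv) auto
  finally have "(T n K J L - e * of_int L * of_int n) / (of_int L * of_int n) \<le> rate n K' J L"
    unfolding rate_def using assms by (intro divide_right_mono) auto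
  then show ?thesis using assms by (simp add: rate_def diff_divide_distrib)
qed

lemma rate_mult:
  assumes "1 \<le> L" "1 \<le> n" "1 \<le> b" "of_nat b * of_int L * weight \<le> e * of_int n"
  shows "rate n K J L - e \<le> rate n K J (int b * L)"
proof -
  have "(of_nat b)\<^sup>2 * (of_int L)\<^sup>2 * weight = of_nat b * of_int L * (of_nat b * of_int L * weight)"
    by (simp add: power2_eq_square)
  also have "\<dots> \<le> of_nat b * of_int L * (e * of_int n)"
    using assms by (intro mult_left_mono) auto
  finally have "of_nat b * T n K J L - of_nat b * of_int L * (e * of_int n) \<le> T n K J (int b * L)"
    using T_mult[OF assms(1,3), of n K J] by linarith
  then have "(of_nat b * T n K J L - of_nat b * of_int L * (e * of_int n)) / (of_nat b * of_int L * of_int n) \<le> rate n K J (int b * L)"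
    unfolding rate_def using assms by (auto intro!: divide_right_mono)
  then show ?thesis using assms by (simp add: rate_def diff_divide_distrib)
qed

text \<open>The rates are bounded and increase, up to small errors, both in the scale and in the number of
  convolved copies; hence the pigeonhole principle applies.\<close>

lemma stationary_step:
  fixes Ls :: "nat \<Rightarrow> int" and Ks :: "nat \<Rightarrow> nat"
  assumes n: "1 \<le> n" and L: "\<And>t. 1 \<le> Ls t" "\<And>t. Ls (Suc t) = int B * Ls t"
    and K: "\<And>t. Ks t \<le> Ks (Suc t)" and B: "1 \<le> B"
    and e: "0 < e" "2 * e * 2 ^ CARD('n) \<le> \<eta>"
    and c_le: "\<And>t. c \<le> e * of_int (Ls t)"
    and n_ge: "\<And>t. t < N \<Longrightarrow> of_nat B * of_int (Ls t) * weight \<le> e * of_int n"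
    and N: "2 ^ CARD('n) * weight < real N * \<eta>"
  shows "\<exists>t<N. \<forall>J. rate n (Ks (Suc t)) J (Ls (Suc t)) \<le> rate n (Ks t) J (Ls t) + 2 * \<eta>"
proof -
  define r where "r t J = rate n (Ks t) J (Ls t)" for t J
  \<comment> \<open>One index \<open>t\<close> must serve every \<open>J\<close>, hence the sum over
    all \<open>J\<close>. As each single rate drops by at most \<open>2 * e\<close>, a small
    increase of the sum bounds the increase of every summand.\<close>
  define \<Psi> where "\<Psi> t = (\<Sum>J\<in>UNIV. r t J)" for t
  have incr: "r t J - 2 * e \<le> r (Suc t) J" if "t < N" for t J
  proof -
    have "rate n (Ks t) J (Ls t) - e \<le> rate n (Ks t) J (Ls (Suc t))"
      unfolding L(2) using that by (intro rate_mult L n B n_ge)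
    moreover have "rate n (Ks t) J (Ls (Suc t)) - e \<le> rate n (Ks (Suc t)) J (Ls (Suc t))"
      by (intro rate_conv K L(1) n c_le)
    ultimately show ?thesis by (simp add: r_def)
  qed
  have card: "card (UNIV :: 'n set set) = 2 ^ CARD('n)" by (simp add: card_UNIV_set)
  have "\<exists>t<N. \<Psi> (Suc t) \<le> \<Psi> t + \<eta>"
  proof (rule ccontr)
    assume "\<not> ?thesis"
    then have gt: "\<Psi> t + \<eta> < \<Psi> (Suc t)" if "t < N" for t using that by force
    have "real t * \<eta> \<le> \<Psi> t" if "t \<le> N" for t
      using that
    proof (induction t)
      case 0
      then show ?case using rate_bounds[OF L(1) n] by (auto simp: \<Psi>_def r_def intro!: sum_nonneg)
    next
      case (Suc t)
      then show ?case using gt[of t] by (simp add: distrib_right)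
    qed
    then have "real N * \<eta> \<le> \<Psi> N" by simp
    also have "\<Psi> N \<le> (\<Sum>J\<in>(UNIV :: 'n set set). weight)"
      unfolding \<Psi>_def r_def using rate_bounds[OF L(1) n] by (intro sum_mono) auto
    also have "\<dots> = 2 ^ CARD('n) * weight" by (simp add: card)
    finally show False using N by simp
  qed
  then obtain t where t: "t < N" "\<Psi> (Suc t) \<le> \<Psi> t + \<eta>" by blast
  have "r (Suc t) J \<le> r t J + 2 * \<eta>" for J
  proof -
    have "r (Suc t) J - r t J = (\<Psi> (Suc t) - \<Psi> t) - (\<Sum>J'\<in>UNIV - {J}. r (Suc t) J' - r t J')"
      unfolding \<Psi>_def using sum.remove[of UNIV J "r (Suc t)"] sum.remove[of UNIV J "r t"]
      by (simp add: sum_subtractf)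
    also have "\<dots> \<le> \<eta> - (\<Sum>J'\<in>UNIV - {J}. - 2 * e)"
    proof (rule diff_mono)
      show "(\<Sum>J'\<in>UNIV - {J}. - 2 * e) \<le> (\<Sum>J'\<in>UNIV - {J}. r (Suc t) J' - r t J')"
        using incr[OF t(1)] by (intro sum_mono) (simp add: algebra_simps)
    qed (use t in simp)
    also have "\<dots> = \<eta> + 2 * e * real (card (UNIV - {J}))" by simp
    also have "\<dots> \<le> \<eta> + 2 * e * real (card (UNIV :: 'n set set))"
      using e by (intro add_left_mono mult_left_mono) (auto intro!: card_mono)
    also have "\<dots> \<le> \<eta> + \<eta>" using e by (simp add: card)
    finally show ?thesis by simp
  qed
  with t(1) show ?thesis by (auto simp: r_def)
qed

text \<open>The positions \<open>N1\<close> with a noticeable increment get promoted, so the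
  increments \<open>d'\<close> for \<open>K'\<close> sum up to almost \<open>card N1\<close> times
  the maximum \<open>chi i * of_int L\<close>. By \<open>S3\<close> and \<open>S4\<close> the sums
  of \<open>d'\<close> and \<open>d\<close> nearly agree, and \<open>d\<close> contributes little
  outside \<open>N1\<close>. Since \<open>d\<close> cannot exceed the maximum by more than 1, it
  must be almost maximal at most positions of \<open>N1\<close>.\<close>

lemma dichotomy_count:
  fixes L R n :: int
  assumes i: "i \<notin> J" and L: "1 \<le> L" "1 \<le> R" "1 \<le> n" and X: "chi i \<le> X"
    and \<kappa>: "0 < \<kappa>" "\<kappa> \<le> 1" and \<gamma>: "0 < \<gamma>" "\<gamma> \<le> 1"
    and s: "0 \<le> s" "4 * s * (X + 1) \<le> \<kappa>\<^sup>2"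
    and S1: "(\<Sum>q\<in>{0..<n}. defect K J q L R) \<le> s * of_int L * of_int n"
    and S2: "(\<Sum>q\<in>{0..<n}. defect K' (insert i J) q R L) \<le> s * of_int L * of_int n"
    and S3: "T n K' (insert i J) L \<le> T n K (insert i J) L + s * of_int L * of_int n"
    and S4: "T n K J L - s * of_int L * of_int n \<le> T n K' J L"
    and K': "K * 4 ^ (2 * nat \<lceil>X * of_int L\<rceil> + 2) \<le> K'"
    and R: "\<And>x. 4 * X * of_int L + 9 \<le> chi x * of_int R"
    and \<kappa>L: "10 \<le> \<kappa> * of_int L" "2 + c \<le> \<kappa> * of_int L"
    and W: "of_int (L + R) * (X + 1) \<le> \<kappa> * of_int n"
  defines "d \<equiv> \<lambda>q. G K (insert i J) q L - G K J q L"
  shows "real (card {q\<in>{0..<n}. \<kappa> * of_int L \<le> d q \<and> d q < (chi i - \<gamma>) * of_int L}) \<le> 6 * \<kappa> / \<gamma> * of_int n"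
proof -
  let ?I = "{0..<n}"
  let ?D = "\<lambda>q. defect K J q L R"
  define d' where "d' q = G K' (insert i J) q L - G K' J q L" for q
  define D' where "D' q = defect K' (insert i J) q R L" for q
  \<comment> \<open>The condition \<open>L + R \<le> q\<close> keeps the shifted positions
    \<open>q - L\<close> and \<open>q - L - R\<close> in the window. The bound on the defect leaves
    \<open>\<kappa> * of_int L / 2\<close>, at least 5, for \<open>promote_G\<close>.\<close>
  define N1 where "N1 = {q\<in>?I. L + R \<le> q \<and> \<kappa> * of_int L \<le> d q \<and> ?D q \<le> \<kappa> * of_int L / 2}"
  define Big where "Big = {q\<in>?I. \<kappa> * of_int L / 2 \<le> ?D q}"
  have X0: "0 < X" using chi_pos[of i] X by simp
  have Lr: "1 \<le> real_of_int L" "0 < real_of_int L" "0 < real_of_int n" using L by auto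
  have d0: "0 \<le> d q" "0 \<le> d' q" "0 \<le> D' q" "0 \<le> ?D q" for q
    using L unfolding d_def d'_def D'_def
    by (auto intro!: defect_nonneg G_mono[OF subset_insertI])
  have d_le: "d q \<le> chi i * of_int L + 1" for q
    using G_insert_le[OF _ i, of L K q] L by (simp add: d_def)
  have d_le': "d q \<le> (X + 1) * of_int L" for q
  proof -
    have "chi i * of_int L + 1 \<le> X * of_int L + 1 * of_int L" using X Lr by (intro add_mono mult_right_mono) auto
    then show ?thesis using d_le[of q] by (simp add: distrib_right)
  qed
  have s_small: "4 * s \<le> \<kappa>" "2 * s * (X + 1) / \<kappa> \<le> \<kappa> / 2" "2 * s / \<kappa> \<le> \<kappa> / 2"
  proof -
    have "4 * s * 1 \<le> 4 * s * (X + 1)" using s X0 by (intro mult_left_mono) auto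
    also have "\<dots> \<le> \<kappa> * \<kappa>" using s by (simp add: power2_eq_square)
    finally have s\<kappa>: "4 * s \<le> \<kappa> * \<kappa>" by simp
    also have "\<dots> \<le> \<kappa> * 1" using \<kappa> by (intro mult_left_mono) auto
    finally show "4 * s \<le> \<kappa>" by simp
    show "2 * s * (X + 1) / \<kappa> \<le> \<kappa> / 2" "2 * s / \<kappa> \<le> \<kappa> / 2"
      using s s\<kappa> \<kappa> by (auto simp: divide_le_eq power2_eq_square)
  qed
  have cardBig: "real (card Big) \<le> 2 * s / \<kappa> * of_int n"
  proof -
    have "real (card Big) \<le> (\<Sum>q\<in>?I. ?D q) / (\<kappa> * of_int L / 2)"
      unfolding Big_def by (rule card_le_sum_div) (use \<kappa> Lr d0 in auto)
    also have "\<dots> \<le> (s * of_int L * of_int n) / (\<kappa> * of_int L / 2)"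
      using S1 \<kappa> Lr by (intro divide_right_mono) auto
    also have "\<dots> = 2 * s / \<kappa> * of_int n" using Lr by simp
    finally show ?thesis .
  qed
  have N1I: "N1 \<subseteq> ?I" "Big \<subseteq> ?I" unfolding N1_def Big_def by auto
  then have N1I: "N1 \<subseteq> ?I" "finite N1" "finite Big" by (auto intro: finite_subset)
  have "(\<Sum>q\<in>N1. chi i * of_int L - 1 - c) \<le> (\<Sum>q\<in>N1. d' (q - L) + D' (q - L - R))"
  proof (rule sum_mono)
    fix q assume q: "q \<in> N1"
    then have "5 \<le> d q - ?D q" using \<kappa>L by (auto simp: N1_def)
    then show "chi i * of_int L - 1 - c \<le> d' (q - L) + D' (q - L - R)"
      using promote_G[OF i _ _ _ X _ K' R, of L q] L by (simp add: d_def d'_def D'_def)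
  qed
  also have "\<dots> = (\<Sum>q\<in>(\<lambda>q. q - L) ` N1. d' q) + (\<Sum>q\<in>(\<lambda>q. q - L - R) ` N1. D' q)"
    by (simp add: sum.reindex inj_on_def sum.distrib)
  also have "\<dots> \<le> (\<Sum>q\<in>?I. d' q) + (\<Sum>q\<in>?I. D' q)"
    using d0 L by (intro add_mono sum_mono2) (auto simp: N1_def)
  also have "\<dots> \<le> (\<Sum>q\<in>?I. d q) + 3 * (s * of_int L * of_int n)"
    using S2 S3 S4 by (simp add: d_def d'_def D'_def T_def sum_subtractf)
  finally have A: "(\<Sum>q\<in>N1. chi i * of_int L - 1 - c) \<le> (\<Sum>q\<in>?I. d q) + 3 * (s * of_int L * of_int n)" .
  have "(\<Sum>q\<in>?I - N1. d q) \<le> (\<Sum>q\<in>?I - N1. \<kappa> * of_int L + (X + 1) * of_int L * (of_bool (q \<in> {0..<L + R}) + of_bool (q \<in> Big)))"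
  proof (rule sum_mono)
    fix q assume q: "q \<in> ?I - N1"
    have "0 \<le> \<kappa> * of_int L" "0 \<le> (X + 1) * of_int L" using \<kappa> X0 Lr by auto
    then show "d q \<le> \<kappa> * of_int L + (X + 1) * of_int L * (of_bool (q \<in> {0..<L + R}) + of_bool (q \<in> Big))"
      using q d_le'[of q] by (auto simp: N1_def Big_def of_bool_def)
  qed
  also have "\<dots> \<le> (\<Sum>q\<in>?I. \<kappa> * of_int L + (X + 1) * of_int L * (of_bool (q \<in> {0..<L + R}) + of_bool (q \<in> Big)))"
    using \<kappa> X0 Lr by (intro sum_mono2) auto
  also have "\<dots> = \<kappa> * of_int L * of_int n + (X + 1) * of_int L * (real (card (?I \<inter> {0..<L + R})) + real (card (?I \<inter> Big)))"
  proof -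
    have cnt: "(\<Sum>q\<in>?I. of_bool (q \<in> A)) = real (card (?I \<inter> A))" for A
      by (simp add: Int_def)
    have "(\<Sum>q\<in>?I. \<kappa> * of_int L) = \<kappa> * of_int L * of_int n" using L by simp
    then show ?thesis by (simp only: sum.distrib sum_distrib_left[symmetric] cnt)
  qed
  also have "\<dots> \<le> \<kappa> * of_int L * of_int n + (X + 1) * of_int L * (of_int (L + R) + 2 * s / \<kappa> * of_int n)"
  proof (intro add_left_mono mult_left_mono add_mono)
    have "card (?I \<inter> {0..<L + R}) \<le> card {0..<L + R}" by (intro card_mono) auto
    then show "real (card (?I \<inter> {0..<L + R})) \<le> of_int (L + R)" using L by simp
    have "card (?I \<inter> Big) \<le> card Big" using N1I by (intro card_mono) auto
    then show "real (card (?I \<inter> Big)) \<le> 2 * s / \<kappa> * of_int n" using cardBig by simp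
  qed (use X0 Lr in auto)
  also have "\<dots> = \<kappa> * of_int L * of_int n + of_int L * (of_int (L + R) * (X + 1)) + (2 * s * (X + 1) / \<kappa>) * of_int L * of_int n"
    by (simp add: algebra_simps)
  also have "\<dots> \<le> \<kappa> * of_int L * of_int n + of_int L * (\<kappa> * of_int n) + (\<kappa> / 2) * of_int L * of_int n"
    using W s_small Lr by (intro add_mono mult_left_mono mult_right_mono order_refl) auto
  also have "\<dots> = 5 / 2 * \<kappa> * of_int L * of_int n" by (simp add: algebra_simps)
  finally have out: "(\<Sum>q\<in>?I - N1. d q) \<le> 5 / 2 * \<kappa> * of_int L * of_int n" .
  have split: "(\<Sum>q\<in>?I. d q) = (\<Sum>q\<in>?I - N1. d q) + (\<Sum>q\<in>N1. d q)"
    by (rule sum.subset_diff[OF N1I(1)]) simp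
  have cardN1: "real (card N1) \<le> of_int n"
    using card_mono[of ?I N1] N1I L by simp
  have "(\<Sum>q\<in>N1. chi i * of_int L + 1 - d q) = (\<Sum>q\<in>N1. chi i * of_int L - 1 - c) + (2 + c) * real (card N1) - (\<Sum>q\<in>N1. d q)"
    by (simp add: sum_subtractf algebra_simps)
  also have "\<dots> \<le> 5 / 2 * \<kappa> * of_int L * of_int n + 3 * (s * of_int L * of_int n) + (2 + c) * of_int n"
  proof -
    have "(2 + c) * real (card N1) \<le> (2 + c) * of_int n" using cardN1 c_nonneg by (intro mult_left_mono) auto
    then show ?thesis using A out split by linarith
  qed
  also have "\<dots> \<le> 5 / 2 * \<kappa> * of_int L * of_int n + \<kappa> * of_int L * of_int n + \<kappa> * of_int L * of_int n"
  proof (intro add_mono order_refl)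
    have "3 * s * (of_int L * of_int n) \<le> \<kappa> * (of_int L * of_int n)"
      using s_small s Lr by (intro mult_right_mono) auto
    then show "3 * (s * of_int L * of_int n) \<le> \<kappa> * of_int L * of_int n" by simp
    show "(2 + c) * of_int n \<le> \<kappa> * of_int L * of_int n"
      using \<kappa>L Lr by (intro mult_right_mono) auto
  qed
  finally have total: "(\<Sum>q\<in>N1. chi i * of_int L + 1 - d q) \<le> 9 / 2 * \<kappa> * of_int L * of_int n" by simp
  let ?Bad = "{q\<in>?I. \<kappa> * of_int L \<le> d q \<and> d q < (chi i - \<gamma>) * of_int L}"
  have "real (card {q\<in>N1. \<gamma> * of_int L \<le> chi i * of_int L + 1 - d q}) \<le> (\<Sum>q\<in>N1. chi i * of_int L + 1 - d q) / (\<gamma> * of_int L)"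
    by (rule card_le_sum_div) (use N1I \<gamma> Lr d_le in auto)
  also have "\<dots> \<le> (9 / 2 * \<kappa> * of_int L * of_int n) / (\<gamma> * of_int L)"
    using total \<gamma> Lr by (intro divide_right_mono) auto
  also have "\<dots> = 9 / 2 * \<kappa> / \<gamma> * of_int n" using Lr by simp
  finally have bad1: "real (card {q\<in>N1. \<gamma> * of_int L \<le> chi i * of_int L + 1 - d q}) \<le> 9 / 2 * \<kappa> / \<gamma> * of_int n" .
  have "?Bad \<subseteq> {q\<in>N1. \<gamma> * of_int L \<le> chi i * of_int L + 1 - d q} \<union> ({0..<L + R} \<union> Big)"
    by (auto simp: N1_def Big_def left_diff_distrib)
  then have "card ?Bad \<le> card ({q\<in>N1. \<gamma> * of_int L \<le> chi i * of_int L + 1 - d q} \<union> ({0..<L + R} \<union> Big))"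
    using N1I by (intro card_mono) auto
  also have "\<dots> \<le> card {q\<in>N1. \<gamma> * of_int L \<le> chi i * of_int L + 1 - d q} + (card {0..<L + R} + card Big)"
    by (meson add_left_mono card_Un_le order_trans)
  finally have "real (card ?Bad) \<le> real (card {q\<in>N1. \<gamma> * of_int L \<le> chi i * of_int L + 1 - d q}) + (real (card {0..<L + R}) + real (card Big))"
    by (simp only: of_nat_add[symmetric] of_nat_le_iff)
  also have "\<dots> \<le> 9 / 2 * \<kappa> / \<gamma> * of_int n + (\<kappa> * of_int n + \<kappa> / 2 * of_int n)"
  proof (intro add_mono bad1)
    have "of_int (L + R) * 1 \<le> of_int (L + R) * (X + 1)" using L X0 by (intro mult_left_mono) auto
    moreover have "real (card {0..<L + R}) = of_int (L + R)" using L by simp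
    ultimately show "real (card {0..<L + R}) \<le> \<kappa> * of_int n" using W by (metis mult_1_right order_trans)
    show "real (card Big) \<le> \<kappa> / 2 * of_int n"
      using cardBig mult_right_mono[OF s_small(3), of "of_int n"] Lr by linarith
  qed
  also have "\<dots> = (9 / 2 * \<kappa> / \<gamma> + 3 / 2 * \<kappa>) * of_int n" by (simp add: distrib_right)
  also have "\<dots> \<le> (6 * \<kappa> / \<gamma>) * of_int n"
  proof (rule mult_right_mono)
    have "\<kappa> \<le> \<kappa> / \<gamma>" using \<kappa> \<gamma> by (simp add: le_divide_eq mult_left_le)
    then show "9 / 2 * \<kappa> / \<gamma> + 3 / 2 * \<kappa> \<le> 6 * \<kappa> / \<gamma>" by simp
  qed (use Lr in auto)
  finally show ?thesis .
qed

end

section \<open>Saturation of one direction given all other coordinates\<close>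

context multiscale
begin

text \<open>The positions \<open>H\<close> where \<open>j\<close> carries entropy have density about
  \<open>\<rho> / (X + 1)\<close>, and \<open>budget\<close> lets the exceptional ones (no
  dichotomy, large defect, too early) use up at most half of it. At the remaining positions
  \<open>submodular_dichotomy\<close>, applied to \<open>G\<close> divided by \<open>L\<close>,
  shows that \<open>j\<close> has entropy given all other coordinates. Then \<open>promote\<close>
  applies once more, now to a block of length \<open>m\<close> and any \<open>K''\<close> beyond
  \<open>K'\<close>.\<close>

lemma good_scales:
  fixes L R n m :: int
  assumes L: "1 \<le> L" "1 \<le> R" "1 \<le> n" and X: "\<And>i. chi i \<le> X"
    and \<kappa>: "0 < \<kappa>" "\<kappa> \<le> \<gamma>" and \<gamma>: "\<gamma> \<le> 1"
    and s: "0 \<le> s" "4 * s * (X + 1) \<le> \<kappa>\<^sup>2"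
    and S1: "\<And>J. (\<Sum>q\<in>{0..<n}. defect K J q L R) \<le> s * of_int L * of_int n"
    and S2: "\<And>J. (\<Sum>q\<in>{0..<n}. defect K' J q R L) \<le> s * of_int L * of_int n"
    and S3: "\<And>J. T n K' J L \<le> T n K J L + s * of_int L * of_int n"
    and S4: "\<And>J. T n K J L - s * of_int L * of_int n \<le> T n K' J L"
    and K': "K * 4 ^ (2 * nat \<lceil>X * of_int L\<rceil> + 2) \<le> K'" "K' \<le> K''"
    and R: "\<And>x. 4 * X * of_int L + 9 \<le> chi x * of_int R"
    and \<kappa>L: "10 \<le> \<kappa> * of_int L" "2 + c \<le> \<kappa> * of_int L"
    and W: "of_int (L + R) * (X + 1) \<le> \<kappa> * of_int n"
    and sep: "\<And>i i'. i \<noteq> i' \<Longrightarrow> 3 * real CARD('n) * \<gamma> < \<bar>chi i - chi i'\<bar>"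
    and low: "3 * real CARD('n) * \<gamma> + 2 * \<kappa> \<le> chi j"
    and m: "1 \<le> m" "m \<le> L"
    and \<rho>: "\<rho> * of_int L * of_int n \<le> T n K {j} L"
    and budget: "\<kappa> * (1 + (X + 1) * (2 ^ CARD('n) * real CARD('n) * 6 / \<gamma> + 2)) \<le> \<rho> / 2"
  shows "\<rho> / (2 * (X + 1)) * of_int n \<le> real (card {q\<in>{1..n}. chi j * of_int m - 1 - c \<le>
     E K'' (lv (q + m)) - E K'' ((lv (q + m))(j := lv q j))})"
proof -
  let ?I = "{0..<n}"
  let ?N = "real CARD('n)"
  define Bad where "Bad = (\<lambda>(J, i). {q\<in>?I. \<kappa> * of_int L \<le> G K (insert i J) q L - G K J q L \<and>
    G K (insert i J) q L - G K J q L < (chi i - \<gamma>) * of_int L})"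
  define Ps where "Ps = {(J, i). i \<notin> J} \<inter> (UNIV :: ('n set \<times> 'n) set)"
  define H where "H = {q\<in>?I. \<kappa> * of_int L \<le> G K {j} q L}"
  define Def where "Def = {q\<in>?I. \<kappa> * of_int L \<le> defect K (UNIV - {j}) q L R}"
  define Good where "Good = H - ((\<Union>p\<in>Ps. Bad p) \<union> (Def \<union> {0..<L + R}))"
  have X0: "0 < X" using chi_pos[of j] X[of j] by simp
  have \<gamma>0: "0 < \<gamma>" using \<kappa> by simp
  have Lr: "1 \<le> real_of_int L" "0 < real_of_int L" "0 < real_of_int n" using L by auto
  have \<kappa>1: "\<kappa> \<le> 1" using \<kappa> \<gamma> by simp
  have fin: "finite H" "finite Def" "finite (Bad p)" for p
    by (auto simp: H_def Def_def Bad_def split_def intro: finite_subset[of _ ?I])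
  have H_card: "(\<rho> - \<kappa>) * of_int n \<le> (X + 1) * real (card H)"
  proof -
    have "\<rho> * of_int L * of_int n \<le> (\<Sum>q\<in>?I. G K {j} q L)" using \<rho> by (simp add: T_def)
    also have "\<dots> \<le> (\<Sum>q\<in>?I. \<kappa> * of_int L + (X + 1) * of_int L * of_bool (q \<in> H))"
    proof (rule sum_mono)
      fix q assume q: "q \<in> ?I"
      have "G K {j} q L \<le> chi j * of_int L + 1" using G_insert_le[of L j "{}" K q] L by (simp add: G_empty)
      also have "\<dots> \<le> X * of_int L + 1 * of_int L" using X[of j] Lr by (intro add_mono mult_right_mono) auto
      finally have 1: "G K {j} q L \<le> (X + 1) * of_int L" by (simp add: distrib_right)
      have "0 \<le> \<kappa> * of_int L" using \<kappa> Lr by auto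
      then show "G K {j} q L \<le> \<kappa> * of_int L + (X + 1) * of_int L * of_bool (q \<in> H)"
        using q 1 by (auto simp: H_def)
    qed
    also have "\<dots> = \<kappa> * of_int L * of_int n + (X + 1) * of_int L * real (card H)"
    proof -
      have "(\<Sum>q\<in>?I. of_bool (q \<in> H)) = real (card (?I \<inter> H))" by (simp add: Int_def)
      also have "?I \<inter> H = H" by (auto simp: H_def)
      finally have cnt: "(\<Sum>q\<in>?I. of_bool (q \<in> H)) = real (card H)" .
      have "(\<Sum>q\<in>?I. \<kappa> * of_int L) = \<kappa> * of_int L * of_int n" using L by simp
      then show ?thesis by (simp only: sum.distrib sum_distrib_left[symmetric] cnt)
    qed
    finally have "of_int L * ((\<rho> - \<kappa>) * of_int n) \<le> of_int L * ((X + 1) * real (card H))"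
      by (simp add: algebra_simps)
    then show ?thesis using Lr by simp
  qed
  have Bad_card: "real (card (\<Union>p\<in>Ps. Bad p)) \<le> 2 ^ CARD('n) * ?N * 6 / \<gamma> * \<kappa> * of_int n"
  proof -
    have each: "real (card (Bad p)) \<le> 6 * \<kappa> / \<gamma> * of_int n" if "p \<in> Ps" for p
    proof -
      obtain J i where p: "p = (J, i)" by (cases p)
      with that have i: "i \<notin> J" by (simp add: Ps_def)
      show ?thesis unfolding p Bad_def prod.case
        by (rule dichotomy_count[OF i L X \<kappa>(1) \<kappa>1 \<gamma>0 \<gamma> s S1 S2 S3 S4 K'(1) R \<kappa>L W])
    qed
    have cardPs: "card Ps \<le> 2 ^ CARD('n) * CARD('n)"
    proof -
      have "card Ps \<le> card (UNIV :: ('n set \<times> 'n) set)" by (rule card_mono) auto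
      then show ?thesis by (simp add: card_UNIV_set)
    qed
    have "real (card (\<Union>p\<in>Ps. Bad p)) \<le> real (\<Sum>p\<in>Ps. card (Bad p))"
      by (simp only: of_nat_le_iff) (rule card_UN_le, simp)
    also have "\<dots> \<le> (\<Sum>p\<in>Ps. 6 * \<kappa> / \<gamma> * of_int n)" unfolding of_nat_sum by (rule sum_mono) (rule each)
    also have "\<dots> = real (card Ps) * (6 * \<kappa> / \<gamma> * of_int n)" by simp
    also have "\<dots> \<le> real (2 ^ CARD('n) * CARD('n)) * (6 * \<kappa> / \<gamma> * of_int n)"
      using cardPs \<kappa> \<gamma>0 Lr by (intro mult_right_mono) (simp only: of_nat_le_iff, auto)
    finally show ?thesis by (simp add: mult_ac)
  qed
  have Def_card: "real (card Def) \<le> \<kappa> * of_int n"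
  proof -
    have "real (card Def) \<le> (\<Sum>q\<in>?I. defect K (UNIV - {j}) q L R) / (\<kappa> * of_int L)"
      unfolding Def_def by (rule card_le_sum_div) (use \<kappa> Lr L in \<open>auto intro!: defect_nonneg\<close>)
    also have "\<dots> \<le> (s * of_int L * of_int n) / (\<kappa> * of_int L)" using S1 \<kappa> Lr by (intro divide_right_mono) auto
    also have "\<dots> = s / \<kappa> * of_int n" using Lr by simp
    also have "\<dots> \<le> \<kappa> * of_int n"
    proof (rule mult_right_mono)
      have "s * 1 \<le> s * (4 * (X + 1))" using s X0 by (intro mult_left_mono) auto
      also have "\<dots> \<le> \<kappa> * \<kappa>" using s by (simp add: power2_eq_square mult_ac)
      finally show "s / \<kappa> \<le> \<kappa>" using \<kappa> by (simp add: divide_le_eq)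
    qed (use Lr in auto)
    finally show ?thesis .
  qed
  have Low_card: "real (card {0..<L + R}) \<le> \<kappa> * of_int n"
  proof -
    have "of_int (L + R) * 1 \<le> of_int (L + R) * (X + 1)" using L X0 by (intro mult_left_mono) auto
    moreover have "real (card {0..<L + R}) = of_int (L + R)" using L by simp
    ultimately show ?thesis using W by (metis mult_1_right order_trans)
  qed
  have finU: "finite (\<Union>p\<in>Ps. Bad p)" using fin by auto
  have "card H \<le> card (Good \<union> ((\<Union>p\<in>Ps. Bad p) \<union> (Def \<union> {0..<L + R})))"
    using fin finU by (intro card_mono) (auto simp: Good_def)
  also have "\<dots> \<le> card Good + (card (\<Union>p\<in>Ps. Bad p) + (card Def + card {0..<L + R}))"
    by (meson add_left_mono card_Un_le order_trans)
  finally have "real (card H) \<le> real (card Good) + (real (card (\<Union>p\<in>Ps. Bad p)) + (real (card Def) + real (card {0..<L + R})))"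
    by (simp only: of_nat_add[symmetric] of_nat_le_iff)
  then have "real (card H) \<le> real (card Good) + (2 ^ CARD('n) * ?N * 6 / \<gamma> + 2) * \<kappa> * of_int n"
    using Bad_card Def_card Low_card by (simp add: distrib_right)
  then have "(X + 1) * real (card H) \<le> (X + 1) * (real (card Good) + (2 ^ CARD('n) * ?N * 6 / \<gamma> + 2) * \<kappa> * of_int n)"
    using X0 by (intro mult_left_mono) auto
  also have "\<dots> = (X + 1) * real (card Good) + \<kappa> * (1 + (X + 1) * (2 ^ CARD('n) * ?N * 6 / \<gamma> + 2)) * of_int n - \<kappa> * of_int n"
    by (simp add: algebra_simps)
  also have "\<dots> \<le> (X + 1) * real (card Good) + \<rho> / 2 * of_int n - \<kappa> * of_int n"
    using budget Lr by (intro diff_right_mono add_left_mono mult_right_mono) auto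
  finally have "\<rho> / 2 * of_int n \<le> (X + 1) * real (card Good)"
    using H_card by (simp add: left_diff_distrib)
  then have Good_card: "\<rho> / (2 * (X + 1)) * of_int n \<le> real (card Good)"
    using X0 by (simp add: field_simps)
  let ?Q = "{q\<in>{1..n}. chi j * of_int m - 1 - c \<le> E K'' (lv (q + m)) - E K'' ((lv (q + m))(j := lv q j))}"
  have "(\<lambda>q. q - m) ` Good \<subseteq> ?Q"
  proof clarify
    fix q assume q: "q \<in> Good"
    then have qI: "q \<in> ?I" "L + R \<le> q" by (auto simp: Good_def H_def)
    let ?g = "\<lambda>J. G K J q L / of_int L"
    have "chi j - 3 * ?N * \<gamma> \<le> ?g UNIV - ?g (UNIV - {j})"
    proof (rule submodular_dichotomy)
      show "?g {} = 0" by (simp add: G_empty)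
      show "?g J \<le> ?g J'" if "J \<subseteq> J'" for J J' using G_mono[OF that, of L K q] Lr L by (intro divide_right_mono) auto
      show "?g (insert i J) \<le> ?g J + (chi i + \<kappa>)" if "i \<notin> J" for i J
      proof -
        have "G K (insert i J) q L \<le> G K J q L + (chi i * of_int L + \<kappa> * of_int L)"
          using G_insert_le[OF _ that, of L K q] L \<kappa>L by simp
        then have "?g (insert i J) \<le> (G K J q L + (chi i * of_int L + \<kappa> * of_int L)) / of_int L"
          using Lr by (intro divide_right_mono) auto
        also have "\<dots> = ?g J + (chi i + \<kappa>)" using Lr by (simp add: add_divide_distrib)
        finally show ?thesis .
      qed
      show "?g (insert i J) - ?g J \<le> ?g (insert i J') - ?g J'" if "J' \<subseteq> J" "i \<notin> J" for i J J'
        unfolding diff_divide_distrib[symmetric] using G_submod[OF that, of L K q] L Lr by (intro divide_right_mono) auto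
      show "?g (insert i J) - ?g J < \<kappa> \<or> chi i - \<gamma> \<le> ?g (insert i J) - ?g J" if "i \<notin> J" for i J
      proof -
        have "q \<notin> Bad (J, i)" using q that by (auto simp: Good_def Ps_def)
        then have "G K (insert i J) q L - G K J q L < \<kappa> * of_int L \<or> (chi i - \<gamma>) * of_int L \<le> G K (insert i J) q L - G K J q L"
          using qI by (auto simp: Bad_def)
        then show ?thesis
          unfolding diff_divide_distrib[symmetric] using Lr by (simp add: divide_less_eq le_divide_eq)
      qed
      show "\<kappa> \<le> ?g {j}" using q Lr by (auto simp: Good_def H_def le_divide_eq)
    qed (use sep \<kappa> in auto)
    \<comment> \<open>Of this \<open>2 * \<kappa>\<close>, one half pays for the defect, and the
      other leaves \<open>\<kappa> * of_int L\<close>, at least 10, where \<open>promote\<close>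
      asks for 5.\<close>
    then have "2 * \<kappa> \<le> ?g UNIV - ?g (UNIV - {j})" using low by linarith
    then have "2 * \<kappa> * of_int L \<le> G K UNIV q L - G K (UNIV - {j}) q L"
      unfolding diff_divide_distrib[symmetric] using Lr by (simp add: le_divide_eq)
    moreover have "defect K (UNIV - {j}) q L R < \<kappa> * of_int L"
      using q qI by (auto simp: Good_def Def_def)
    moreover have ins: "insert j (UNIV - {j}) = UNIV" by auto
    ultimately have five: "5 \<le> G K (insert j (UNIV - {j})) q L - G K (UNIV - {j}) q L - defect K (UNIV - {j}) q L R"
      using \<kappa>L by (simp only: ins)
    have "chi j * of_int m - 1 - c \<le> E K'' ((\<lambda>x. if x = j then lv (q - m) x else if x \<in> UNIV - {j} then lv q x else lv (q - m - R) x)(j := lv q j)) -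
      E K'' (\<lambda>x. if x = j then lv (q - m) x else if x \<in> UNIV - {j} then lv q x else lv (q - m - R) x)"
      by (rule promote[OF _ _ _ m(2) X five order_trans[OF K'] R]) (use L m in auto)
    \<comment> \<open>For \<open>J = UNIV - {j}\<close> no coordinate remains at
      \<open>q - m - R\<close>. What is left is the conditioning of the theorem, at the scale
      \<open>q - m\<close>.\<close>
    moreover have "(\<lambda>x. if x = j then lv (q - m) x else if x \<in> UNIV - {j} then lv q x else lv (q - m - R) x) = (lv q)(j := lv (q - m) j)"
      by auto
    ultimately show "q - m \<in> {1..n} \<and> chi j * of_int m - 1 - c \<le> E K'' (lv (q - m + m)) - E K'' ((lv (q - m + m))(j := lv (q - m) j))"
      using qI L m by simp
  qed
  then have "card ((\<lambda>q. q - m) ` Good) \<le> card ?Q"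
    by (intro card_mono) (auto intro: finite_subset[of _ "{1..n}"])
  moreover have "card ((\<lambda>q. q - m) ` Good) = card Good" by (intro card_image) (auto simp: inj_on_def)
  ultimately show ?thesis using Good_card by linarith
qed

end

section \<open>The abstract multiscale theorem and the choice of its parameters\<close>

definition coord_increments :: "('n \<Rightarrow> real) \<Rightarrow> (nat \<Rightarrow> ('n \<Rightarrow> int) \<Rightarrow> real) \<Rightarrow> nat \<Rightarrow> 'n \<Rightarrow> real" where
  "coord_increments chi E n j =
    (\<Sum>q\<in>{0..<int n}. E 1 ((scale_levels chi q)(j := scale_levels chi (q + 1) j)) - E 1 (scale_levels chi q))"

text \<open>Counterpart of \<open>high_entropy_scales\<close>, with the conditional entropy as a
  difference of \<open>E\<close> at two levels. The additive loss will be absorbed into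
  \<open>\<epsilon>\<close> times \<open>m\<close> for large \<open>m\<close>.\<close>

definition saturated_scales ::
  "('n \<Rightarrow> real) \<Rightarrow> real \<Rightarrow> (nat \<Rightarrow> ('n \<Rightarrow> int) \<Rightarrow> real) \<Rightarrow> nat \<Rightarrow> nat \<Rightarrow> nat \<Rightarrow> 'n \<Rightarrow> int set"
where
  "saturated_scales chi c E m k n j = {q\<in>{1..int n}. chi j * real m - 1 - c \<le>
    E k (scale_levels chi (q + int m)) - E k ((scale_levels chi (q + int m))(j := scale_levels chi q j))}"

text \<open>The gap ratio \<open>b\<close>, the separation \<open>\<gamma>\<close>, then
  \<open>\<kappa>\<close>, \<open>s\<close>, \<open>\<eta>\<close>, \<open>e\<close> and the number
  \<open>N\<close> of pigeonhole steps depend on \<open>chi\<close> and \<open>\<rho>\<close> only.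
  Next come \<open>m\<close> and the thresholds for \<open>k\<close> and \<open>n\<close>. The
  almost stationary step depends on \<open>E\<close>, but it is among the first \<open>N\<close>, so
  that \<open>Ks N\<close> and \<open>Ls N\<close> bound everything that can occur.\<close>

theorem multiscale_main:
  fixes chi :: "'n::finite \<Rightarrow> real" and c \<rho> :: real
  assumes chi_pos: "\<And>i. 0 < chi i" and inj: "inj chi" and c: "0 \<le> c" and \<rho>: "0 < \<rho>"
  shows "\<exists>\<delta>>0. \<exists>M0::nat. \<forall>m\<ge>M0. \<exists>K0 N0::nat. \<forall>k\<ge>K0. \<forall>n\<ge>N0. \<forall>E j. multiscale chi E c \<longrightarrow>
    \<rho> * real n \<le> coord_increments chi E n j \<longrightarrow>
    \<delta> * real n \<le> real (card (saturated_scales chi c E m k n j))"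
proof -
  let ?N = "real CARD('n)"
  define X where "X = (\<Sum>i\<in>UNIV. chi i)"
  define w where "w = (\<Sum>i\<in>UNIV. chi i + 1)"
  have X: "chi i \<le> X" for i unfolding X_def using chi_pos by (intro member_le_sum) (auto intro: less_imp_le)
  have X0: "0 < X" using chi_pos X less_le_trans by blast
  have w0: "0 \<le> w" unfolding w_def using chi_pos by (intro sum_nonneg add_nonneg_nonneg) (auto intro: less_imp_le)
  define \<nu> where "\<nu> = Min (range chi)"
  have \<nu>0: "0 < \<nu>" unfolding \<nu>_def using chi_pos by (subst Min_gr_iff) auto
  have \<nu>_le: "\<nu> \<le> chi i" for i unfolding \<nu>_def by (rule Min_le) auto
  \<comment> \<open>Chosen so that \<open>R = int b * L\<close> scales cover
    \<open>4 * X * L + 9\<close> binary digits in every coordinate, as \<open>promote\<close>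
    requires.\<close>
  define b where "b = nat \<lceil>(4 * X + 9) / \<nu>\<rceil> + 1"
  have b: "4 * X + 9 \<le> chi x * real b" for x
  proof -
    have "4 * X + 9 = \<nu> * ((4 * X + 9) / \<nu>)" using \<nu>0 by simp
    also have "\<dots> \<le> chi x * real b"
    proof (rule mult_mono)
      show "(4 * X + 9) / \<nu> \<le> real b" unfolding b_def by linarith
    qed (use \<nu>0 \<nu>_le X0 chi_pos[of x] in \<open>auto intro: less_imp_le\<close>)
    finally show ?thesis .
  qed
  have b1: "1 \<le> b" by (simp add: b_def)
  define B where "B = b + 1"
  \<comment> \<open>A common lower bound \<open>\<mu>\<close> for 1, the exponents and their gaps.
    Dividing by \<open>6 * ?N\<close> makes \<open>3 * ?N * \<gamma>\<close> half of it, which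
    leaves room for strict separation and for \<open>2 * \<kappa>\<close> below each
    exponent.\<close>
  define S where "S = insert 1 (range chi \<union> (\<lambda>(i, i'). \<bar>chi i - chi i'\<bar>) ` {(i, i'). i \<noteq> i'})"
  define \<mu> where "\<mu> = Min S"
  have finS: "finite S" "S \<noteq> {}" by (auto simp: S_def)
  have \<mu>0: "0 < \<mu>" unfolding \<mu>_def using finS chi_pos inj by (subst Min_gr_iff) (auto simp: S_def inj_eq)
  have \<mu>_le: "\<mu> \<le> x" if "x \<in> S" for x unfolding \<mu>_def using finS that by auto
  define \<gamma> where "\<gamma> = \<mu> / (6 * ?N)"
  have N1: "1 \<le> ?N" by (simp add: Suc_le_eq)
  have \<gamma>N: "?N * \<gamma> = \<mu> / 6" by (simp add: \<gamma>_def)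
  have \<gamma>0: "0 < \<gamma>" using \<mu>0 N1 by (simp add: \<gamma>_def)
  have \<gamma>_le: "\<gamma> \<le> ?N * \<gamma>" using \<gamma>0 N1 by simp
  have \<gamma>1: "\<gamma> \<le> 1" using \<mu>_le[of 1] \<gamma>_le \<mu>0 by (simp add: \<gamma>N S_def)
  define Z where "Z = 1 + (X + 1) * (2 ^ CARD('n) * ?N * 6 / \<gamma> + 2)"
  have Z0: "0 < Z" unfolding Z_def using X0 \<gamma>0 by (intro add_pos_nonneg mult_nonneg_nonneg) auto
  define \<kappa> where "\<kappa> = min \<gamma> (\<rho> / 4 / Z)"
  have \<kappa>: "0 < \<kappa>" "\<kappa> \<le> \<gamma>" using \<gamma>0 \<rho> Z0 by (auto simp: \<kappa>_def)
  have budget: "\<kappa> * Z \<le> \<rho> / 2 / 2"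
  proof -
    have "\<kappa> \<le> \<rho> / 4 / Z" by (simp add: \<kappa>_def)
    then show ?thesis using Z0 by (simp add: le_divide_eq)
  qed
  define s where "s = \<kappa>\<^sup>2 / (4 * (X + 1))"
  have s: "0 < s" "4 * s * (X + 1) \<le> \<kappa>\<^sup>2"
  proof -
    have "s * (4 * (X + 1)) = \<kappa>\<^sup>2" using X0 by (simp only: s_def) simp
    then show "4 * s * (X + 1) \<le> \<kappa>\<^sup>2" by (simp add: mult_ac)
  qed (use \<kappa> X0 in \<open>simp add: s_def\<close>)
  define \<eta> where "\<eta> = s / (8 * real B)"
  have B1: "1 \<le> B" "1 \<le> real B" by (auto simp: B_def)
  have \<eta>: "0 < \<eta>" "8 * \<eta> * real B = s" using s B1 by (auto simp: \<eta>_def)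
  have \<eta>s: "8 * \<eta> \<le> s" using \<eta> B1 by (metis mult_le_cancel_left1 mult_nonneg_nonneg less_imp_le zero_le_numeral not_less)
  define e where "e = \<eta> / (2 * 2 ^ CARD('n))"
  have e: "0 < e" "2 * e * 2 ^ CARD('n) \<le> \<eta>" "e \<le> \<eta>"
  proof -
    show "0 < e" "2 * e * 2 ^ CARD('n) \<le> \<eta>" using \<eta> by (auto simp: e_def)
    have "\<eta> / (2 * 2 ^ CARD('n)) \<le> \<eta> / 1" using \<eta> by (intro divide_left_mono) (auto simp: mult_ge1_I)
    then show "e \<le> \<eta>" by (simp add: e_def)
  qed
  define N where "N = nat \<lceil>2 ^ CARD('n) * w / \<eta>\<rceil> + 1"
  have N: "2 ^ CARD('n) * w < real N * \<eta>"
  proof -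
    have "2 ^ CARD('n) * w / \<eta> < real N" unfolding N_def by linarith
    then show ?thesis using \<eta> by (simp add: divide_less_eq)
  qed
  define M0 where "M0 = nat \<lceil>c / e + 10 / \<kappa> + (2 + c) / \<kappa> + 4 * c / \<rho>\<rceil> + 1"
  define \<delta> where "\<delta> = \<rho> / 2 / (2 * (X + 1))"
  have \<delta>: "0 < \<delta>" using \<rho> X0 by (simp add: \<delta>_def)
  have "\<exists>K0 N0::nat. \<forall>k\<ge>K0. \<forall>n\<ge>N0. \<forall>E j. multiscale chi E c \<longrightarrow>
    \<rho> * real n \<le> coord_increments chi E n j \<longrightarrow>
    \<delta> * real n \<le> real (card (saturated_scales chi c E m k n j))"
    if m: "M0 \<le> m" for m
  proof -
    have m1: "1 \<le> m" using m by (simp add: M0_def)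
    have "c / e + 10 / \<kappa> + (2 + c) / \<kappa> + 4 * c / \<rho> \<le> real m" using m unfolding M0_def by linarith
    moreover have "0 \<le> c / e" "0 \<le> 10 / \<kappa>" "0 \<le> (2 + c) / \<kappa>" "0 \<le> 4 * c / \<rho>" using c e \<kappa> \<rho> by auto
    ultimately have m_ge: "c / e \<le> real m" "10 / \<kappa> \<le> real m" "(2 + c) / \<kappa> \<le> real m" "4 * c / \<rho> \<le> real m" by linarith+
    \<comment> \<open>All block lengths are multiples of \<open>m\<close>: the block of length
      \<open>m\<close> fits into each of them, and a lower bound on \<open>m\<close> alone makes the
      losses \<open>c\<close> negligible.\<close>
    define Ls where "Ls t = int m * int B ^ t" for t
    \<comment> \<open>Each step multiplies the number of copies by the amount that one application
      of \<open>promote\<close> requires.\<close>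
    define Ks :: "nat \<Rightarrow> nat" where "Ks = rec_nat 1 (\<lambda>t K. K * 4 ^ (2 * nat \<lceil>X * of_int (Ls t)\<rceil> + 2))"
    have Ks0: "Ks 0 = 1" and KsS: "Ks (Suc t) = Ks t * 4 ^ (2 * nat \<lceil>X * of_int (Ls t)\<rceil> + 2)" for t
      by (simp_all add: Ks_def)
    have Ks_mono: "Ks t \<le> Ks (Suc t)" for t unfolding KsS by simp
    have Ks_le: "Ks t \<le> Ks t'" if "t \<le> t'" for t t' using that by (rule lift_Suc_mono_le[of Ks, OF Ks_mono])
    have Ls1: "int m \<le> Ls t" for t unfolding Ls_def using B1 by (simp add: mult_le_cancel_left1)
    have Ls1': "1 \<le> Ls t" for t using Ls1[of t] m1 by linarith
    have LsS: "Ls (Suc t) = int B * Ls t" for t by (simp add: Ls_def)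
    have Ls_mono: "Ls t \<le> Ls t'" if "t \<le> t'" for t t'
      unfolding Ls_def using that B1 by (intro mult_left_mono power_increasing) auto
    have Lm: "real m \<le> of_int (Ls t)" for t using Ls1[of t] by (metis of_int_le_iff of_int_of_nat_eq)
    have up: "x \<le> y * of_int (Ls t)" if "x / y \<le> real m" "0 < y" for x y t
    proof -
      have "x \<le> y * real m" using that by (simp add: divide_le_eq mult.commute)
      also have "\<dots> \<le> y * of_int (Ls t)" using that Lm by (intro mult_left_mono) auto
      finally show ?thesis .
    qed
    define Lmax where "Lmax = real_of_int (Ls N)"
    have Lmax: "0 \<le> Lmax" using Ls1'[of N] by (simp add: Lmax_def)
    define A where "A = real B * Lmax * w / e + real B * Lmax * (X + 1) / \<kappa> + Lmax * w * 4 / \<rho>"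
    define N0 where "N0 = nat \<lceil>A\<rceil> + 1"
    show ?thesis
    proof (rule exI[of _ "Ks N"], rule exI[of _ N0], intro allI impI)
      fix k n :: nat and E j
      assume k: "Ks N \<le> k" and n: "N0 \<le> n" and ms: "multiscale chi E c"
        and hyp: "\<rho> * real n \<le> coord_increments chi E n j"
      interpret multiscale chi E c by (rule ms)
      have weight: "weight = w" by (simp add: weight_def w_def)
      have n1: "1 \<le> int n" "0 < real n" using n by (auto simp: N0_def)
      have "A \<le> real n" using n unfolding N0_def by linarith
      moreover have "0 \<le> real B * Lmax * w / e" "0 \<le> real B * Lmax * (X + 1) / \<kappa>" "0 \<le> Lmax * w * 4 / \<rho>"
        using Lmax w0 e X0 \<kappa> \<rho> by auto
      ultimately have n_ge': "real B * Lmax * w / e \<le> real n" "real B * Lmax * (X + 1) / \<kappa> \<le> real n" "Lmax * w * 4 / \<rho> \<le> real n"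
        unfolding A_def by linarith+
      have n_ge: "real B * Lmax * w \<le> e * real n" "real B * Lmax * (X + 1) \<le> \<kappa> * real n" "Lmax * w \<le> \<rho> / 4 * real n"
        using n_ge' e \<kappa> \<rho> by (simp_all add: divide_le_eq mult.commute)
      have Lt: "real_of_int (Ls t) \<le> Lmax" if "t < N" for t using Ls_mono[of t N] that by (simp add: Lmax_def)
      have BLw: "real B * of_int (Ls t) * w \<le> e * real n" if "t < N" for t
        using n_ge(1) mult_right_mono[OF mult_left_mono[OF Lt[OF that]], of "real B" w] w0 by simp
      have "\<exists>t<N. \<forall>J. rate (int n) (Ks (Suc t)) J (Ls (Suc t)) \<le> rate (int n) (Ks t) J (Ls t) + 2 * \<eta>"
      proof (rule stationary_step[where B = B and e = e])
        show "c \<le> e * of_int (Ls t)" for t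
          by (rule up[OF m_ge(1) e(1)])
        show "real B * of_int (Ls t) * weight \<le> e * of_int (int n)" if "t < N" for t
          using BLw[OF that] by (simp add: weight)
        show "2 ^ CARD('n) * weight < real N * \<eta>" using N by (simp add: weight)
      qed (use n1 Ls1' LsS Ks_mono B1 e in auto)
      then obtain t where t: "t < N"
        and stat: "\<And>J. rate (int n) (Ks (Suc t)) J (Ls (Suc t)) \<le> rate (int n) (Ks t) J (Ls t) + 2 * \<eta>" by blast
      define L where "L = Ls t"
      define R where "R = int b * L"
      define K where "K = Ks t"
      define K' where "K' = Ks (Suc t)"
      have L1: "1 \<le> L" "int m \<le> L" "1 \<le> real_of_int L" using Ls1'[of t] Ls1[of t] by (auto simp: L_def)
      have "1 * 1 \<le> int b * L" using b1 L1 by (intro mult_mono) auto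
      then have R1: "1 \<le> R" by (simp add: R_def)
      have BL: "Ls (Suc t) = int B * L" "L + R = int B * L" by (simp_all add: LsS L_def R_def B_def algebra_simps)
      have LrM: "real_of_int L \<le> Lmax" using Lt[OF t] by (simp add: L_def)
      have KK': "K \<le> K'" unfolding K_def K'_def by (rule Ks_mono)
      have c_le: "c \<le> e * of_int L"
        unfolding L_def by (rule up[OF m_ge(1) e(1)])
      have c_le': "c \<le> e * of_int (int B * L)"
      proof -
        have "e * of_int L * 1 \<le> e * of_int L * real B" using e L1 B1 by (intro mult_left_mono) auto
        with c_le show ?thesis by (simp add: mult_ac)
      qed
      have BLw': "of_nat B * of_int L * weight \<le> e * of_int (int n)" using BLw[OF t] by (simp add: weight L_def)
      have stat': "rate (int n) K' J (int B * L) \<le> rate (int n) K J L + 2 * \<eta>" for J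
        using stat[of J] by (simp add: BL K_def K'_def L_def[symmetric])
      have BL1: "1 \<le> int B * L" using BL R1 L1 by simp
      have r1: "rate (int n) K J (int B * L) \<le> rate (int n) K J L + 3 * \<eta>" for J
        using rate_conv[OF KK' BL1 n1(1) c_le', of J] stat'[of J] e by simp
      have r2: "rate (int n) K' J (int B * L) \<le> rate (int n) K' J L + 3 * \<eta>" for J
        using rate_conv[OF KK' L1(1) n1(1) c_le, of J] stat'[of J] e by simp
      have r3: "rate (int n) K' J L \<le> rate (int n) K J L + 3 * \<eta>" for J
        using rate_mult[OF L1(1) n1(1) B1(1) BLw', of K' J] stat'[of J] e by simp
      have r4: "rate (int n) K J L - \<eta> \<le> rate (int n) K' J L" for J
        using rate_conv[OF KK' L1(1) n1(1) c_le, of J] e by simp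
      have T_rate: "T (int n) Ka J La = of_int La * real n * rate (int n) Ka J La" if "1 \<le> La" for Ka J La
        using that n1 by (simp add: rate_def)
      \<comment> \<open>\<open>3 * \<eta>\<close> comes from stationarity and a further
        \<open>\<eta>\<close> from the boundary error; the total, times \<open>B\<close>, is at most
        \<open>s\<close> by the choice of \<open>\<eta>\<close>.\<close>
      have Tdiff: "T (int n) Ka J (int B * L) - of_nat B * T (int n) Ka J L + (of_nat B)\<^sup>2 * (of_int L)\<^sup>2 * weight \<le> s * of_int L * of_int (int n)"
        if "rate (int n) Ka J (int B * L) \<le> rate (int n) Ka J L + 3 * \<eta>" for Ka J
      proof -
        have "(of_nat B)\<^sup>2 * (of_int L)\<^sup>2 * weight = of_nat B * of_int L * (of_nat B * of_int L * weight)" by (simp add: power2_eq_square)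
        also have "\<dots> \<le> of_nat B * of_int L * (\<eta> * real n)"
        proof (intro mult_left_mono)
          have "e * real n \<le> \<eta> * real n" using e by (intro mult_right_mono) auto
          then show "of_nat B * of_int L * weight \<le> \<eta> * real n" using BLw' by simp
        qed (use L1 in auto)
        finally have 1: "(of_nat B)\<^sup>2 * (of_int L)\<^sup>2 * weight \<le> of_nat B * of_int L * (\<eta> * real n)" .
        have "T (int n) Ka J (int B * L) - of_nat B * T (int n) Ka J L = of_nat B * of_int L * real n * (rate (int n) Ka J (int B * L) - rate (int n) Ka J L)"
          unfolding T_rate[OF BL1] T_rate[OF L1(1)] by (simp add: right_diff_distrib)
        also have "\<dots> \<le> of_nat B * of_int L * real n * (3 * \<eta>)" using that L1 by (intro mult_left_mono) auto
        finally have "T (int n) Ka J (int B * L) - of_nat B * T (int n) Ka J L + (of_nat B)\<^sup>2 * (of_int L)\<^sup>2 * weight \<le>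
          of_nat B * of_int L * real n * (3 * \<eta>) + of_nat B * of_int L * (\<eta> * real n)" using 1 by linarith
        also have "\<dots> = (4 * \<eta> * real B) * (of_int L * real n)" by (simp add: algebra_simps)
        also have "\<dots> \<le> s * (of_int L * real n)" using \<eta> s L1 by (intro mult_right_mono) auto
        finally show ?thesis by simp
      qed
      have defects: "(\<Sum>q\<in>{0..<int n}. defect K J q L R) \<le> s * of_int L * of_int (int n)"
        "(\<Sum>q\<in>{0..<int n}. defect K' J q R L) \<le> s * of_int L * of_int (int n)" for J
        using sum_defect_le(1)[OF L1(1) b1, of K J "int n"] sum_defect_le(2)[OF L1(1) b1, of K' J "int n"]
          Tdiff[OF r1, of J] Tdiff[OF r2, of J] unfolding R_def B_def by linarith+
      have "\<rho> / 2 / (2 * (X + 1)) * of_int (int n) \<le> real (card {q\<in>{1..int n}. chi j * of_int (int m) - 1 - c \<le>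
        E k (scale_levels chi (q + int m)) - E k ((scale_levels chi (q + int m))(j := scale_levels chi q j))})"
      proof (rule good_scales[where L = L and R = R and X = X and \<kappa> = \<kappa> and \<gamma> = \<gamma> and s = s and K = K and K' = K'])
        show "T (int n) K' J L \<le> T (int n) K J L + s * of_int L * of_int (int n)" for J
        proof -
          have "of_int L * real n * rate (int n) K' J L \<le> of_int L * real n * (rate (int n) K J L + s)"
            using r3[of J] \<eta>s \<eta> L1 by (intro mult_left_mono) auto
          then show ?thesis unfolding T_rate[OF L1(1)] by (simp add: algebra_simps)
        qed
        show "T (int n) K J L - s * of_int L * of_int (int n) \<le> T (int n) K' J L" for J
        proof -
          have "of_int L * real n * (rate (int n) K J L - s) \<le> of_int L * real n * rate (int n) K' J L"
            using r4[of J] \<eta>s \<eta> L1 by (intro mult_left_mono) auto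
          then show ?thesis unfolding T_rate[OF L1(1)] by (simp add: algebra_simps)
        qed
        show "K * 4 ^ (2 * nat \<lceil>X * of_int L\<rceil> + 2) \<le> K'" by (simp add: K_def K'_def KsS L_def)
        show "K' \<le> k" using Ks_le[of "Suc t" N] t k by (simp add: K'_def)
        show "4 * X * of_int L + 9 \<le> chi x * of_int R" for x
        proof -
          have "4 * X * of_int L + 9 * 1 \<le> 4 * X * of_int L + 9 * of_int L" using L1 by simp
          also have "\<dots> = (4 * X + 9) * of_int L" by (simp add: distrib_right)
          also have "\<dots> \<le> chi x * real b * of_int L" using b L1 by (intro mult_right_mono) auto
          finally show ?thesis by (simp add: R_def)
        qed
        show "10 \<le> \<kappa> * of_int L" "2 + c \<le> \<kappa> * of_int L"
          unfolding L_def by (rule up[OF m_ge(2) \<kappa>(1)], rule up[OF m_ge(3) \<kappa>(1)])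
        show "of_int (L + R) * (X + 1) \<le> \<kappa> * of_int (int n)"
        proof -
          have "of_int (L + R) * (X + 1) = real B * of_int L * (X + 1)" by (simp add: BL)
          also have "\<dots> \<le> real B * Lmax * (X + 1)" using LrM X0 by (intro mult_right_mono mult_left_mono) auto
          finally show ?thesis using n_ge(2) by simp
        qed
        show "3 * ?N * \<gamma> < \<bar>chi i - chi i'\<bar>" if "i \<noteq> i'" for i i'
        proof -
          have "\<mu> \<le> \<bar>chi i - chi i'\<bar>" using that by (intro \<mu>_le) (auto simp: S_def)
          then show ?thesis using \<gamma>N \<mu>0 by simp
        qed
        show "3 * ?N * \<gamma> + 2 * \<kappa> \<le> chi j"
        proof -
          have "\<mu> \<le> chi j" by (intro \<mu>_le) (auto simp: S_def)
          moreover have "3 * ?N * \<gamma> = \<mu> / 2" using \<gamma>N by simp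
          ultimately show ?thesis using \<mu>0 \<kappa> \<gamma>_le unfolding \<gamma>N by linarith
        qed
        \<comment> \<open>Passing from single scales to blocks of length \<open>L\<close>, and from
          one copy to \<open>K\<close> copies, costs at most a quarter of \<open>\<rho>\<close>
          each.\<close>
        show "\<rho> / 2 * of_int L * of_int (int n) \<le> T (int n) K {j} L"
        proof -
          have "T (int n) 1 {j} 1 = coord_increments chi E n j"
            unfolding T_def G_def coord_increments_def by (intro sum.cong refl arg_cong2[of _ _ _ _ "(-)"] arg_cong[of _ _ "E 1"]) (auto simp: lev_def)
          then have T1: "\<rho> * real n \<le> T (int n) 1 {j} 1" using hyp by simp
          have "of_nat (nat L) * T (int n) 1 {j} 1 - (of_nat (nat L))\<^sup>2 * (of_int 1)\<^sup>2 * weight \<le> T (int n) 1 {j} (int (nat L) * 1)"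
            by (rule T_mult) (use L1 in auto)
          then have TL: "of_int L * T (int n) 1 {j} 1 - of_int L * (of_int L * w) \<le> T (int n) 1 {j} L"
            using L1 by (simp add: weight power2_eq_square)
          have "of_int L * (\<rho> * real n) \<le> of_int L * T (int n) 1 {j} 1" using T1 L1 by (intro mult_left_mono) auto
          moreover have "of_int L * (of_int L * w) \<le> of_int L * (\<rho> / 4 * real n)"
          proof (intro mult_left_mono)
            have "of_int L * w \<le> Lmax * w" using LrM w0 by (intro mult_right_mono) auto
            then show "of_int L * w \<le> \<rho> / 4 * real n" using n_ge(3) by simp
          qed (use L1 in auto)
          moreover have "T (int n) 1 {j} L - c * of_int (int n) \<le> T (int n) K {j} L"
            using Ks_le[of 0 t] Ks0 L1 by (intro T_conv) (auto simp: K_def)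
          moreover have "c * of_int (int n) \<le> of_int L * (\<rho> / 4 * real n)"
          proof -
            have "c \<le> \<rho> / 4 * real m" using m_ge(4) \<rho> by (simp add: divide_le_eq mult.commute)
            also have "\<dots> \<le> \<rho> / 4 * of_int L" using Lm[of t] \<rho> by (intro mult_left_mono) (auto simp: L_def)
            finally have "c * real n \<le> \<rho> / 4 * of_int L * real n" by (intro mult_right_mono) auto
            then show ?thesis by (simp add: mult_ac)
          qed
          ultimately have "of_int L * (\<rho> * real n) - of_int L * (\<rho> / 4 * real n) - of_int L * (\<rho> / 4 * real n) \<le> T (int n) K {j} L"
            using TL by linarith
          then show ?thesis by (simp add: algebra_simps)
        qed
        show "\<kappa> * (1 + (X + 1) * (2 ^ CARD('n) * ?N * 6 / \<gamma> + 2)) \<le> \<rho> / 2 / 2"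
          using budget by (simp only: Z_def)
      qed (use L1 R1 n1 X \<kappa> \<gamma>1 s m1 defects in auto)
      then show "\<delta> * real n \<le> real (card (saturated_scales chi c E m k n j))"
        by (simp add: \<delta>_def saturated_scales_def)
    qed
  qed
  with \<delta> show ?thesis by blast
qed

text \<open>In the constant, \<open>14 + CARD('n)\<close> comes from the saturation estimate, and
  \<open>2 * CARD('n)\<close> from passing from the \<open>K * k\<close> copies that it provides to
  an arbitrary larger number \<open>K'\<close>.\<close>

lemma multiscale_cell_ent:
  fixes chi :: "'n::finite \<Rightarrow> real" and P :: "(real ^ 'n) pmf"
  assumes fin: "finite (set_pmf P)" and chi: "\<And>i. 0 < chi i"
  shows "multiscale chi (\<lambda>K. cell_ent (conv_power P K)) (14 + 3 * real CARD('n))"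
proof
  have finK: "finite (set_pmf (conv_power P K))" for K by (rule finite_conv_power[OF fin])
  have conv: "cell_ent (conv_power P K) l' - cell_ent (conv_power P K) l - 2 * real CARD('n) \<le>
      cell_ent (conv_power P K') l' - cell_ent (conv_power P K') l"
    if "K \<le> K'" "l \<le> l'" for K K' l l'
  proof -
    have "conv_power P K' = map_pmf (\<lambda>(x, y). x + y) (pair_pmf (conv_power P K) (conv_power P (K' - K)))"
      using conv_power_add[of P K "K' - K"] that by simp
    then show ?thesis using cell_ent_convolution_ge[OF finK finK that(2)] by simp
  qed
  show "0 < chi i" for i by (rule chi)
  show "0 \<le> 14 + 3 * real CARD('n)" by simp
  show "cell_ent (conv_power P K) l \<le> cell_ent (conv_power P K) l'" if "l \<le> l'" for l l' K
    by (rule cell_ent_mono[OF finK that])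
  show "cell_ent (conv_power P K) (sup l l') + cell_ent (conv_power P K) (inf l l') \<le>
      cell_ent (conv_power P K) l + cell_ent (conv_power P K) l'" for K l l'
    by (rule cell_ent_submodular[OF finK])
  show "cell_ent (conv_power P K) (l(i := l i + int a)) \<le> cell_ent (conv_power P K) l + real a" for K l i a
    by (rule cell_ent_upd_le[OF finK])
  show "cell_ent (conv_power P K) l' - cell_ent (conv_power P K) l - (14 + 3 * real CARD('n)) \<le>
      cell_ent (conv_power P K') l' - cell_ent (conv_power P K') l"
    if "K \<le> K'" "l \<le> l'" for K K' l l'
    using conv[OF that] by simp
  show "real b - (14 + 3 * real CARD('n)) \<le> cell_ent (conv_power P K') (l'(i := l i)) - cell_ent (conv_power P K') l'"
    if nontriv: "5 \<le> cell_ent (conv_power P K) (l(i := l i + int a)) - cell_ent (conv_power P K) l"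
      and K': "K * 4 ^ (a + b) \<le> K'" and l'i: "l' i = l i - int b"
      and l': "\<And>x. x \<noteq> i \<Longrightarrow> l' x \<le> l x - 2 * int (a + b)" for K l i a b K' l'
  proof -
    obtain k where k: "k \<le> 4 ^ (a + b)"
      "real b - 14 - real CARD('n) \<le> cell_ent (conv_power (conv_power P K) k) (l'(i := l i)) - cell_ent (conv_power (conv_power P K) k) l'"
      using cell_ent_conv_power_full[OF finK nontriv, of b] l'i l' by metis
    have "K * k \<le> K'" using K' k(1) by (meson le_trans mult_le_mono2)
    moreover have "l' \<le> l'(i := l i)" using l'i by (simp add: le_fun_def)
    ultimately show ?thesis using conv[of "K * k" K' l' "l'(i := l i)"] k(2) by (simp add: conv_power_mult)
  qed
qed

section \<open>Laws of discrete random variables\<close>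

text \<open>The atoms carry all the mass, because countably many points of measure 0 form a null
  set.\<close>

lemma pmf_of_countable_law:
  fixes h :: "'a \<Rightarrow> 'b::countable"
  assumes M: "prob_space M" and h: "h \<in> measurable M (count_space UNIV)"
  obtains P :: "'b pmf" where "\<And>A. measure_pmf.prob P A = measure M (h -` A \<inter> space M)"
proof -
  let ?D = "distr M (count_space UNIV) h"
  interpret prob_space M by fact
  interpret D: prob_space ?D by (rule prob_space_distr[OF h])
  have "{x. measure ?D {x} = 0} \<in> null_sets ?D"
  proof -
    have "(\<Union>x\<in>{x. measure ?D {x} = 0}. {x}) \<in> null_sets ?D"
      by (rule null_sets_UN') (auto simp: null_sets_def D.emeasure_eq_measure)
    then show ?thesis by simp
  qed
  then have AE: "AE x in ?D. measure ?D {x} \<noteq> 0" by (rule AE_I') auto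
  have eq: "measure_pmf (Abs_pmf ?D) = ?D"
    by (rule Abs_pmf_inverse) (use AE D.prob_space_axioms in auto)
  show ?thesis
    by (rule that[of "Abs_pmf ?D"]) (simp add: eq measure_distr[OF h])
qed

text \<open>Partitions are compared up to the empty set, which contributes 0 to the entropy.
  Nonempty fibres of different values are different sets, so the sum over sets becomes a sum over
  values.\<close>

lemma partition_entropy_fibers:
  assumes fin: "finite S"
    and out: "\<And>w. w \<notin> S \<Longrightarrow> measure N (h -` {w}) = 0"
    and ne: "\<And>w. w \<in> S \<Longrightarrow> h -` {w} \<noteq> {}"
    and Q: "Q - {{}} = {h -` {w} | w. True} - {{}}"
  shows "partition_entropy N Q = - (\<Sum>w\<in>S. measure N (h -` {w}) * log 2 (measure N (h -` {w})))"
proof -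
  let ?t = "\<lambda>D. measure N D * log 2 (measure N D)"
  have "(\<Sum>\<^sub>\<infinity>D\<in>Q. ?t D) = (\<Sum>\<^sub>\<infinity>D\<in>(\<lambda>w. h -` {w}) ` S. ?t D)"
  proof (rule infsum_cong_neutral)
    fix D assume D: "D \<in> (\<lambda>w. h -` {w}) ` S - Q"
    then have "D \<in> {h -` {w} | w. True} - {{}}" using ne by auto
    then have "D \<in> Q" unfolding Q[symmetric] by simp
    with D show "?t D = 0" by simp
  next
    fix D assume D: "D \<in> Q - (\<lambda>w. h -` {w}) ` S"
    show "?t D = 0"
    proof (cases "D = {}")
      case False
      then have "D \<in> {h -` {w} | w. True} - {{}}" using D unfolding Q[symmetric] by simp
      then obtain w where w: "D = h -` {w}" by auto
      then have "w \<notin> S" using D by auto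
      then show ?thesis by (simp add: w out)
    qed simp
  qed simp
  also have "\<dots> = (\<Sum>D\<in>(\<lambda>w. h -` {w}) ` S. ?t D)" using fin by simp
  also have "\<dots> = (\<Sum>w\<in>S. ?t (h -` {w}))"
  proof (subst sum.reindex)
    show "inj_on (\<lambda>w. h -` {w}) S" using ne by (fastforce simp: inj_on_def)
  qed simp
  finally show ?thesis by (simp add: partition_entropy_def)
qed

lemma fiber_prob_id: "fiber_prob P (\<lambda>x. x) w = pmf P w"
  by (simp add: fiber_prob_def pmf.rep_eq)

lemma partition_entropy_eq_ent:
  fixes h :: "'a \<Rightarrow> 'b"
  assumes P: "\<And>A. measure_pmf.prob P A = measure M (h -` A)" and fin: "finite (set_pmf P)"
    and Q: "Q - {{}} = {h -` {w} | w. True} - {{}}"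
  shows "partition_entropy M Q = ent P (\<lambda>w. w)"
proof -
  have pmf: "pmf P w = measure M (h -` {w})" for w by (simp add: P[symmetric] pmf.rep_eq)
  have "partition_entropy M Q = - (\<Sum>w\<in>set_pmf P. measure M (h -` {w}) * log 2 (measure M (h -` {w})))"
  proof (rule partition_entropy_fibers[OF fin _ _ Q])
    show "measure M (h -` {w}) = 0" if "w \<notin> set_pmf P" for w
      using that by (simp add: pmf[symmetric] set_pmf_iff)
    show "h -` {w} \<noteq> {}" if "w \<in> set_pmf P" for w
      using that pmf[of w] by (auto simp: set_pmf_iff)
  qed
  then show ?thesis by (simp add: ent_finite[OF fin] fiber_prob_id pmf sum_negf)
qed

text \<open>Each cell of \<open>R\<close> is a union of cells of \<open>Q\<close>, grouped by
  \<open>r\<close>; hence the chain rule expresses the conditional entropy as a difference.\<close>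

lemma cond_partition_entropy_eq_ent:
  fixes h :: "'a \<Rightarrow> 'b"
  assumes M: "prob_space M" and sp: "space M = UNIV"
    and meas: "\<And>A. h -` A \<in> sets M"
    and P: "\<And>A. measure_pmf.prob P A = measure M (h -` A)" and fin: "finite (set_pmf P)"
    and Q: "Q - {{}} = {h -` {w} | w. True} - {{}}"
    and R: "R - {{}} = {h -` r -` {z} | z. True} - {{}}"
  shows "cond_partition_entropy M Q R = ent P (\<lambda>w. w) - ent P r"
proof -
  interpret prob_space M by fact
  let ?S = "set_pmf P"
  let ?E = "\<lambda>z. h -` r -` {z}"
  have pmf: "pmf P w = measure M (h -` {w})" for w by (simp add: P[symmetric] pmf.rep_eq)
  have fib: "fiber_prob P r w = measure M (?E (r w))" for w
    unfolding fiber_prob_def P by (rule arg_cong[of _ _ "measure M"]) auto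
  have posE: "0 < measure M (?E z) \<longleftrightarrow> z \<in> r ` ?S" for z
  proof -
    have "0 < measure_pmf.prob P (r -` {z}) \<longleftrightarrow> \<not> (AE w in measure_pmf P. w \<notin> r -` {z})"
      using measure_pmf.prob_eq_0[of "r -` {z}" P] by (simp add: zero_less_measure_iff)
    then show ?thesis unfolding P by (auto simp: AE_measure_pmf_iff)
  qed
  have H: "measure M (?E z) * partition_entropy (uniform_measure M (?E z)) Q =
    (\<Sum>w\<in>{w\<in>?S. r w = z}. pmf P w * - log 2 (pmf P w) - pmf P w * - log 2 (fiber_prob P r w))"
    if z: "z \<in> r ` ?S" for z
  proof -
    have pos: "0 < measure M (?E z)" using z posE by blast
    have U: "measure (uniform_measure M (?E z)) (h -` {w}) = measure M (?E z \<inter> h -` {w}) / measure M (?E z)" for w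
      using pos meas by (intro measure_uniform_measure) (auto simp: emeasure_eq_measure)
    have cap: "?E z \<inter> h -` {w} = (if r w = z then h -` {w} else {})" for w by auto
    have U': "measure (uniform_measure M (?E z)) (h -` {w}) = (if r w = z then pmf P w / measure M (?E z) else 0)" for w
      unfolding U cap by (simp add: pmf)
    have "partition_entropy (uniform_measure M (?E z)) Q =
      - (\<Sum>w\<in>?S. measure (uniform_measure M (?E z)) (h -` {w}) * log 2 (measure (uniform_measure M (?E z)) (h -` {w})))"
    proof (rule partition_entropy_fibers[OF fin _ _ Q])
      show "measure (uniform_measure M (?E z)) (h -` {w}) = 0" if "w \<notin> ?S" for w
        using that by (simp add: U' set_pmf_iff)
      show "h -` {w} \<noteq> {}" if "w \<in> ?S" for w
        using that pmf[of w] by (auto simp: set_pmf_iff)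
    qed
    also have "\<dots> = (\<Sum>w\<in>?S. if r w = z then - (pmf P w / measure M (?E z) * log 2 (pmf P w / measure M (?E z))) else 0)"
      unfolding U' sum_negf[symmetric] by (intro sum.cong) auto
    also have "\<dots> = (\<Sum>w\<in>{w\<in>?S. r w = z}. - (pmf P w / measure M (?E z) * log 2 (pmf P w / measure M (?E z))))"
      by (rule sum.inter_filter[OF fin, symmetric])
    finally have "measure M (?E z) * partition_entropy (uniform_measure M (?E z)) Q =
      (\<Sum>w\<in>{w\<in>?S. r w = z}. measure M (?E z) * - (pmf P w / measure M (?E z) * log 2 (pmf P w / measure M (?E z))))"
      by (simp only: sum_distrib_left)
    also have "\<dots> = (\<Sum>w\<in>{w\<in>?S. r w = z}. pmf P w * - log 2 (pmf P w) - pmf P w * - log 2 (fiber_prob P r w))"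
    proof (rule sum.cong[OF refl])
      fix w assume "w \<in> {w\<in>?S. r w = z}"
      then have w: "0 < pmf P w" "r w = z" by (auto simp: set_pmf_iff pmf_positive_iff)
      have *: "log 2 (pmf P w / measure M (?E z)) = log 2 (pmf P w) - log 2 (fiber_prob P r w)"
        using w pos by (simp add: fib log_divide_pos)
      have "measure M (?E z) * - (pmf P w / measure M (?E z) * x) = - (pmf P w * x)" for x
        using pos by simp
      then show "measure M (?E z) * - (pmf P w / measure M (?E z) * log 2 (pmf P w / measure M (?E z))) =
        pmf P w * - log 2 (pmf P w) - pmf P w * - log 2 (fiber_prob P r w)"
        by (simp only: *) (simp add: right_diff_distrib)
    qed
    finally show ?thesis .
  qed
  have set: "{E\<in>R. 0 < measure M E} = ?E ` r ` ?S"
  proof -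
    have "{E\<in>R. 0 < measure M E} = {E\<in>R - {{}}. 0 < measure M E}" by auto
    also have "\<dots> = {E\<in>{?E z | z. True} - {{}}. 0 < measure M E}" unfolding R ..
    also have "\<dots> = ?E ` {z. 0 < measure M (?E z)}" by auto
    also have "{z. 0 < measure M (?E z)} = r ` ?S" using posE by auto
    finally show ?thesis .
  qed
  have "cond_partition_entropy M Q R = (\<Sum>E\<in>?E ` r ` ?S. measure M E * partition_entropy (uniform_measure M E) Q)"
    unfolding cond_partition_entropy_def set using fin by simp
  also have "\<dots> = (\<Sum>z\<in>r ` ?S. measure M (?E z) * partition_entropy (uniform_measure M (?E z)) Q)"
  proof (subst sum.reindex)
    show "inj_on ?E (r ` ?S)"
    proof (rule inj_onI)
      fix z z' assume z: "z \<in> r ` ?S" "?E z = ?E z'"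
      then have "?E z \<noteq> {}" using posE[of z] by force
      then show "z = z'" using z(2) by fastforce
    qed
  qed simp
  also have "\<dots> = (\<Sum>z\<in>r ` ?S. \<Sum>w\<in>{w\<in>?S. r w = z}. pmf P w * - log 2 (pmf P w) - pmf P w * - log 2 (fiber_prob P r w))"
    by (rule sum.cong[OF refl H])
  also have "\<dots> = (\<Sum>w\<in>?S. pmf P w * - log 2 (pmf P w) - pmf P w * - log 2 (fiber_prob P r w))"
    by (rule sum.image_gen[OF fin, symmetric])
  also have "\<dots> = ent P (\<lambda>w. w) - ent P r"
    by (simp add: ent_finite[OF fin] fiber_prob_id sum_subtractf sum_negf)
  finally show ?thesis .
qed

lemma floor_powi_eq_iff:
  fixes x :: real
  shows "\<lfloor>2 powi t * x\<rfloor> = k \<longleftrightarrow> x \<in> {of_int k * 2 powi (- t) ..< (of_int k + 1) * 2 powi (- t)}"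
proof -
  have p: "0 < (2::real) powi t" by simp
  have "of_int k * 2 powi (- t) \<le> x \<longleftrightarrow> of_int k \<le> 2 powi t * x"
    "x < (of_int k + 1) * 2 powi (- t) \<longleftrightarrow> 2 powi t * x < of_int k + 1"
    using p by (simp_all add: power_int_minus field_simps)
  then show ?thesis by (auto simp: floor_eq_iff)
qed

lemma box_partition_eq: "box_partition chi n = {cell (scale_levels chi n) -` {z} | z. True}"
proof -
  have dy: "D \<in> dyadic t \<longleftrightarrow> (\<exists>k. D = {x. \<lfloor>2 powi \<lfloor>t\<rfloor> * x\<rfloor> = k})" for D t
    unfolding dyadic_def floor_powi_eq_iff by auto
  show ?thesis
  proof (intro set_eqI iffI)
    fix S assume "S \<in> box_partition chi n"
    then obtain D where D: "S = {x. \<forall>j. x $ j \<in> D j}" "\<forall>j. D j \<in> dyadic (chi j * of_int n)"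
      by (auto simp: box_partition_def)
    from D(2) obtain z where "\<And>j. D j = {x. \<lfloor>2 powi \<lfloor>chi j * of_int n\<rfloor> * x\<rfloor> = z j}"
      unfolding dy by metis
    then have "S = cell (scale_levels chi n) -` {z}"
      unfolding D(1) by (auto simp: cell_def scale_levels_def fun_eq_iff)
    then show "S \<in> {cell (scale_levels chi n) -` {z} | z. True}" by blast
  next
    fix S assume "S \<in> {cell (scale_levels chi n) -` {z} | z. True}"
    then obtain z where z: "S = cell (scale_levels chi n) -` {z}" by blast
    let ?D = "\<lambda>j. {x. \<lfloor>2 powi \<lfloor>chi j * of_int n\<rfloor> * x\<rfloor> = z j}"
    have "S = {x. \<forall>j. x $ j \<in> ?D j}" unfolding z by (auto simp: cell_def scale_levels_def fun_eq_iff)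
    moreover have "\<forall>j. ?D j \<in> dyadic (chi j * of_int n)" unfolding dy by blast
    ultimately show "S \<in> box_partition chi n"
      unfolding box_partition_def by (intro CollectI exI[of _ ?D] conjI)
  qed
qed

text \<open>Refinement by scale \<open>q\<close> matters for coordinate \<open>j\<close> only, as
  the others are already cut at \<open>q + m\<close>. The projection puts 0 into coordinate
  \<open>j\<close>, which has label 0 at every level and so reveals nothing.\<close>

lemma conditioning_partition_eq:
  fixes chi :: "'n::finite \<Rightarrow> real" and q m :: int and j :: 'n
  assumes chi: "\<And>i. 0 < chi i" and "0 \<le> m"
  defines "l' \<equiv> (scale_levels chi (q + m))(j := scale_levels chi q j)"
  shows "common_refinement (box_partition chi q)
      (pullback_partition (coord_proj (UNIV - {j})) (box_partition chi (q + m))) - {{}} =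
    {cell l' -` {z} | z. True} - {{}}"
proof -
  let ?l = "scale_levels chi q" and ?L = "scale_levels chi (q + m)"
  let ?\<pi> = "coord_proj (UNIV - {j})"
  have le: "?l \<le> l'"
  proof -
    have "\<lfloor>chi i * of_int q\<rfloor> \<le> \<lfloor>chi i * of_int (q + m)\<rfloor>" for i
      using chi[of i] assms(2) by (intro floor_mono mult_left_mono) auto
    then show ?thesis by (simp add: l'_def le_fun_def scale_levels_def)
  qed
  have proj: "cell ?L (?\<pi> x) = (cell ?L x)(j := 0)" for x :: "real ^ 'n"
    by (auto simp: cell_def coord_proj_def fun_eq_iff)
  have key: "cell ?l x = cell ?l x0 \<and> cell ?L (?\<pi> x) = cell ?L (?\<pi> x0) \<longleftrightarrow> cell l' x = cell l' x0" for x x0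
  proof
    assume "cell l' x = cell l' x0"
    moreover from this have "cell ?l x = cell ?l x0" by (rule cell_cong[OF le])
    moreover have "cell l' y = (cell ?L y)(j := cell ?l y j)" for y by (simp add: l'_def cell_def fun_eq_iff)
    ultimately show "cell ?l x = cell ?l x0 \<and> cell ?L (?\<pi> x) = cell ?L (?\<pi> x0)"
      unfolding proj by (metis fun_upd_upd)
  next
    assume a: "cell ?l x = cell ?l x0 \<and> cell ?L (?\<pi> x) = cell ?L (?\<pi> x0)"
    show "cell l' x = cell l' x0"
    proof
      fix i
      have "cell ?l x i = cell ?l x0 i" "((cell ?L x)(j := 0)) i = ((cell ?L x0)(j := 0)) i"
        using a unfolding proj by simp_all
      then show "cell l' x i = cell l' x0 i" by (cases "i = j") (simp_all add: l'_def cell_def)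
    qed
  qed
  show ?thesis
  proof (intro set_eqI iffI)
    fix S assume "S \<in> common_refinement (box_partition chi q) (pullback_partition ?\<pi> (box_partition chi (q + m))) - {{}}"
    then obtain z w where S: "S = cell ?l -` {z} \<inter> ?\<pi> -` (cell ?L -` {w})" "S \<noteq> {}"
      unfolding common_refinement_def pullback_partition_def box_partition_eq by blast
    then obtain x0 where x0: "x0 \<in> S" by blast
    then have zw: "z = cell ?l x0" "w = cell ?L (?\<pi> x0)" using S by auto
    have "S = cell l' -` {cell l' x0}" unfolding S(1) zw using key[of _ x0] by auto
    with S(2) show "S \<in> {cell l' -` {z} | z. True} - {{}}" by auto
  next
    fix S assume "S \<in> {cell l' -` {z} | z. True} - {{}}"
    then obtain z x0 where z: "S = cell l' -` {z}" and x0: "x0 \<in> S" by blast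
    then have "S = cell ?l -` {cell ?l x0} \<inter> ?\<pi> -` (cell ?L -` {cell ?L (?\<pi> x0)})"
      using key[of _ x0] by auto
    moreover have "cell ?l -` {cell ?l x0} \<in> box_partition chi q"
      unfolding box_partition_eq by blast
    moreover have "?\<pi> -` (cell ?L -` {cell ?L (?\<pi> x0)}) \<in> pullback_partition ?\<pi> (box_partition chi (q + m))"
      unfolding pullback_partition_def box_partition_eq by blast
    ultimately show "S \<in> common_refinement (box_partition chi q) (pullback_partition ?\<pi> (box_partition chi (q + m))) - {{}}"
      using x0 unfolding common_refinement_def by blast
  qed
qed

section \<open>Discretization of convolution powers\<close>

lemma sets_convolution_power: "sets (convolution_power M k) = sets borel"
  by (cases k) simp_all

lemma space_convolution_power: "space (convolution_power M k) = UNIV"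
  by (cases k) simp_all

lemma measurable_add_pair:
  fixes M N :: "'a::ordered_euclidean_space measure"
  assumes [measurable_cong]: "sets M = sets borel" "sets N = sets borel"
  shows "(\<lambda>(x, y). x + y) \<in> borel_measurable (M \<Otimes>\<^sub>M N)"
  by measurable

lemma prob_space_convolution:
  fixes M N :: "'a::ordered_euclidean_space measure"
  assumes "prob_space M" "prob_space N" "sets M = sets borel" "sets N = sets borel"
  shows "prob_space (convolution M N)"
  unfolding convolution_def
  by (intro prob_space.prob_space_distr prob_space_pair measurable_add_pair assms)

lemma prob_space_convolution_power:
  fixes M :: "'a::ordered_euclidean_space measure"
  assumes "prob_space M" "sets M = sets borel"
  shows "prob_space (convolution_power M k)"
proof (induction k)
  case 0
  then show ?case by (simp add: prob_space_return)
next
  case (Suc k)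
  then show ?case using assms by (simp add: prob_space_convolution sets_convolution_power)
qed

lemma distr_convolution:
  fixes M N :: "'a::ordered_euclidean_space measure" and \<phi> :: "'a \<Rightarrow> 'b::ordered_euclidean_space"
  assumes M: "prob_space M" "sets M = sets borel" and N: "prob_space N" "sets N = sets borel"
    and \<phi>: "\<phi> \<in> borel_measurable borel" and add: "\<And>x y. \<phi> (x + y) = \<phi> x + \<phi> y"
  shows "distr (convolution M N) borel \<phi> = convolution (distr M borel \<phi>) (distr N borel \<phi>)"
proof -
  have \<phi>M: "\<phi> \<in> borel_measurable M" "\<phi> \<in> borel_measurable N"
    using \<phi> M N by (simp_all cong: measurable_cong_sets)
  interpret N': prob_space "distr N borel \<phi>" by (intro prob_space.prob_space_distr N \<phi>M)
  have pair: "distr M borel \<phi> \<Otimes>\<^sub>M distr N borel \<phi> = distr (M \<Otimes>\<^sub>M N) (borel \<Otimes>\<^sub>M borel) (\<lambda>(x, y). (\<phi> x, \<phi> y))"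
    by (rule pair_measure_distr[OF \<phi>M]) (rule N'.sigma_finite_measure_axioms)
  have meas: "(\<lambda>(x, y). (\<phi> x, \<phi> y)) \<in> M \<Otimes>\<^sub>M N \<rightarrow>\<^sub>M borel \<Otimes>\<^sub>M borel"
    using \<phi>M by measurable
  have "convolution (distr M borel \<phi>) (distr N borel \<phi>) =
      distr (M \<Otimes>\<^sub>M N) borel ((\<lambda>(x, y). x + y) \<circ> (\<lambda>(x, y). (\<phi> x, \<phi> y)))"
    unfolding convolution_def pair by (rule distr_distr[OF measurable_add_pair meas]) simp_all
  also have "(\<lambda>(x, y). x + y) \<circ> (\<lambda>(x, y). (\<phi> x, \<phi> y)) = \<phi> \<circ> (\<lambda>(x, y). x + y)"
    by (auto simp: add)
  also have "distr (M \<Otimes>\<^sub>M N) borel (\<phi> \<circ> (\<lambda>(x, y). x + y)) = distr (convolution M N) borel \<phi>"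
    unfolding convolution_def by (rule distr_distr[symmetric, OF \<phi> measurable_add_pair[OF M(2) N(2)]])
  finally show ?thesis ..
qed

text \<open>Applied to the two projections of a product space, this gives the marginals of a
  coupling of two sums.\<close>

lemma distr_convolution_power:
  fixes M :: "'a::ordered_euclidean_space measure" and \<phi> :: "'a \<Rightarrow> 'b::ordered_euclidean_space"
  assumes M: "prob_space M" "sets M = sets borel"
    and \<phi>: "\<phi> \<in> borel_measurable borel" and add: "\<And>x y. \<phi> (x + y) = \<phi> x + \<phi> y" and zero: "\<phi> 0 = 0"
  shows "distr (convolution_power M k) borel \<phi> = convolution_power (distr M borel \<phi>) k"
proof (induction k)
  case 0
  then show ?case using \<phi> by (simp add: distr_return zero)
next
  case (Suc k)
  then show ?case
    using distr_convolution[OF M prob_space_convolution_power[OF M] sets_convolution_power \<phi> add] by simp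
qed

text \<open>\<open>distr\<close> moves a pmf from the discrete sigma-algebra to the Borel sets,
  where the two notions of convolution can be compared.\<close>

lemma convolution_pmf:
  fixes p q :: "'a::ordered_euclidean_space pmf"
  shows "convolution (distr (measure_pmf p) borel (\<lambda>x. x)) (distr (measure_pmf q) borel (\<lambda>x. x)) =
    distr (measure_pmf (map_pmf (\<lambda>(x, y). x + y) (pair_pmf p q))) borel (\<lambda>x. x)"
    (is "convolution ?p ?q = ?r")
proof (rule measure_eqI)
  fix A assume "A \<in> sets (convolution ?p ?q)"
  then have A: "A \<in> sets borel" by simp
  have ps: "prob_space ?p" "prob_space ?q" by (intro prob_space.prob_space_distr prob_space_measure_pmf, simp)+
  have fin: "finite_measure ?p" "finite_measure ?q"
    using ps by (auto simp: prob_space_def)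
  have m: "(\<lambda>y. indicator A (x + y) :: ennreal) \<in> borel_measurable borel" for x :: 'a
    using A by measurable
  have m2: "(\<lambda>x. \<integral>\<^sup>+y. indicator A (x + y) \<partial>measure_pmf q) \<in> borel_measurable borel"
  proof -
    have "(\<lambda>x. \<integral>\<^sup>+y. indicator A (x + y) \<partial>?q) \<in> borel_measurable borel"
    proof -
      interpret sigma_finite_measure ?q using ps(2) by (simp add: prob_space_imp_sigma_finite)
      show ?thesis using A by measurable
    qed
    then show ?thesis using m by (simp add: nn_integral_distr)
  qed
  have "emeasure (convolution ?p ?q) A = (\<integral>\<^sup>+x. \<integral>\<^sup>+y. indicator A (x + y) \<partial>?q \<partial>?p)"
    by (rule convolution_emeasure'[OF A fin]) simp_all
  also have "\<dots> = (\<integral>\<^sup>+x. \<integral>\<^sup>+y. indicator A (x + y) \<partial>measure_pmf q \<partial>measure_pmf p)"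
    using m m2 by (simp add: nn_integral_distr)
  also have "\<dots> = (\<integral>\<^sup>+z. indicator A (fst z + snd z) \<partial>measure_pmf (pair_pmf p q))"
    by (simp add: nn_integral_pair_pmf')
  also have "\<dots> = (\<integral>\<^sup>+z. indicator {z. fst z + snd z \<in> A} z \<partial>measure_pmf (pair_pmf p q))"
    by (intro nn_integral_cong) (simp add: indicator_def)
  also have "\<dots> = emeasure ?r A"
    using A by (simp add: emeasure_distr split_def vimage_def)
  finally show "emeasure (convolution ?p ?q) A = emeasure ?r A" .
qed simp

lemma convolution_power_pmf:
  fixes p :: "'a::ordered_euclidean_space pmf"
  shows "convolution_power (distr (measure_pmf p) borel (\<lambda>x. x)) k =
    distr (measure_pmf (conv_power p k)) borel (\<lambda>x. x)"
proof (induction k)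
  case 0
  show ?case
  proof (rule measure_eqI)
    fix A assume "A \<in> sets (convolution_power (distr (measure_pmf p) borel (\<lambda>x. x)) 0)"
    then show "emeasure (convolution_power (distr (measure_pmf p) borel (\<lambda>x. x)) 0) A =
      emeasure (distr (measure_pmf (conv_power p 0)) borel (\<lambda>x. x)) A"
      by (simp add: emeasure_distr)
  qed simp
next
  case (Suc k)
  then show ?case by (simp add: convolution_pmf)
qed

text \<open>The invariant \<open>Q\<close> may depend on the number of summands, which allows an
  error that accumulates from summand to summand to be tracked.\<close>

lemma AE_convolution_power:
  fixes M :: "'a::ordered_euclidean_space measure"
  assumes M: "prob_space M" "sets M = sets borel"
    and meas: "\<And>k. {x. Q k x} \<in> sets borel" and zero: "Q 0 0"
    and AE: "AE x in M. R x" and step: "\<And>k x y. R x \<Longrightarrow> Q k y \<Longrightarrow> Q (Suc k) (x + y)"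
  shows "AE x in convolution_power M k. Q k x"
proof (induction k)
  case 0
  have "Measurable.pred borel (Q 0)" using meas[of 0] by (simp add: pred_def)
  then show ?case unfolding convolution_power.simps
    using zero AE_return[of 0 borel "Q 0"] by simp
next
  case (Suc k)
  let ?N = "convolution_power M k"
  have N: "prob_space ?N" "sets ?N = sets borel"
    by (rule prob_space_convolution_power[OF M]) (rule sets_convolution_power)
  interpret M: prob_space M by (rule M)
  interpret N: prob_space ?N by (rule N)
  interpret pair_sigma_finite M ?N ..
  have add: "(\<lambda>(x, y). x + y) \<in> borel_measurable (M \<Otimes>\<^sub>M ?N)" by (rule measurable_add_pair[OF M(2) N(2)])
  have set: "{z \<in> space (M \<Otimes>\<^sub>M ?N). Q (Suc k) (case z of (x, y) \<Rightarrow> x + y)} \<in> sets (M \<Otimes>\<^sub>M ?N)"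
    using measurable_sets[OF add meas[of "Suc k"]] by (simp add: vimage_def Int_def conj_commute)
  have "AE z in M \<Otimes>\<^sub>M ?N. Q (Suc k) (case z of (x, y) \<Rightarrow> x + y)"
  proof (rule AE_pair_measure[OF set])
    show "AE x in M. AE y in ?N. Q (Suc k) (case (x, y) of (x, y) \<Rightarrow> x + y)"
      using AE
    proof eventually_elim
      case (elim x)
      show ?case using Suc.IH by eventually_elim (simp add: step[OF elim])
    qed
  qed
  moreover have "{x \<in> space borel. Q (Suc k) x} \<in> sets borel" using meas[of "Suc k"] by simp
  ultimately show ?case
    unfolding convolution_power.simps convolution_def by (simp only: AE_distr_iff[OF add])
qed

lemma measurable_cell: "cell l \<in> measurable borel (count_space UNIV)"
  for l :: "'n::finite \<Rightarrow> int"
  unfolding measurable_count_space_eq2_countable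
proof (intro conjI ballI)
  fix z :: "'n \<Rightarrow> int"
  have "cell l -` {z} \<inter> space borel = (\<Inter>i. {x. 2 powi (l i) * x $ i \<in> {real_of_int (z i)..<real_of_int (z i) + 1}})"
    by (auto simp: cell_def fun_eq_iff floor_eq_iff)
  also have "\<dots> \<in> sets borel"
  proof (rule sets.countable_INT'')
    fix i
    have "(\<lambda>x :: real ^ 'n. 2 powi (l i) * x $ i) \<in> borel_measurable borel" by measurable
    from measurable_sets[OF this, of "{real_of_int (z i)..<real_of_int (z i) + 1}"]
    show "{x. 2 powi (l i) * x $ i \<in> {real_of_int (z i)..<real_of_int (z i) + 1}} \<in> sets borel"
      by (simp add: vimage_def)
  qed auto
  finally show "cell l -` {z} \<inter> space borel \<in> sets borel" .
qed simp

lemma cell_vimage_sets: "cell l -` A \<in> sets borel" for l :: "'n::finite \<Rightarrow> int"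
  using measurable_sets[OF measurable_cell[of l], of A] by simp

definition corner :: "('n::finite \<Rightarrow> int) \<Rightarrow> ('n \<Rightarrow> int) \<Rightarrow> real ^ 'n" where
  "corner l z = (\<chi> i. of_int (z i) * 2 powi (- l i))"

lemma cell_corner: "cell l (corner l z) = z"
proof
  fix i
  have "2 powi (l i) * (real_of_int (z i) * 2 powi (- l i)) = real_of_int (z i)"
    by (simp add: power_int_minus field_simps)
  then show "cell l (corner l z) i = z i" by (simp only: cell_def corner_def vec_lambda_beta floor_of_int)
qed

lemma measurable_corner_cell: "(\<lambda>x. corner l (cell l x)) \<in> borel_measurable borel"
  by (rule measurable_compose[OF measurable_cell]) simp

text \<open>Adjacent labels determine each other up to two values per coordinate, that is one bit
  each, in both directions.\<close>

lemma ent_diff_le: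
  fixes J :: "(('n::finite \<Rightarrow> int) \<times> ('n \<Rightarrow> int)) pmf"
  assumes fin: "finite (set_pmf J)"
    and close: "\<And>a b i. (a, b) \<in> set_pmf J \<Longrightarrow> a i \<in> {b i, b i + 1}"
  shows "\<bar>ent J fst - ent J snd\<bar> \<le> real CARD('n)"
proof -
  have le: "cond_ent J f g \<le> real CARD('n)"
    if fg: "\<And>w i. w \<in> set_pmf J \<Longrightarrow> f w i \<in> {g w i + s..<g w i + s + 2}" for f g :: "_ \<Rightarrow> 'n \<Rightarrow> int" and s
  proof -
    have "cond_ent J f g \<le> log 2 (real (2 ^ CARD('n)))"
    proof (rule cond_ent_le_log_card[OF fin])
      fix y
      have "f ` {w \<in> set_pmf J. g w = y} \<subseteq> {z. \<forall>i. z i \<in> {y i + s..<y i + s + int 2}}" using fg by auto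
      from card_mono[OF card_int_box(1) this]
      show "card (f ` {w \<in> set_pmf J. g w = y}) \<le> 2 ^ CARD('n)" by (simp only: card_int_box(2))
    qed simp
    then show ?thesis by (simp add: log_nat_power)
  qed
  have "cond_ent J fst snd \<le> real CARD('n)"
  proof (rule le[where s = 0])
    fix w i assume "w \<in> set_pmf J"
    then show "fst w i \<in> {snd w i + 0..<snd w i + 0 + 2}" using close[of "fst w" "snd w" i] by auto
  qed
  moreover have "cond_ent J snd fst \<le> real CARD('n)"
  proof (rule le[where s = "-1"])
    fix w i assume "w \<in> set_pmf J"
    then show "snd w i \<in> {fst w i + -1..<fst w i + -1 + 2}" using close[of "fst w" "snd w" i] by auto
  qed
  moreover have "ent J fst \<le> ent J (\<lambda>w. (fst w, snd w))" "ent J snd \<le> ent J (\<lambda>w. (snd w, fst w))"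
    by (rule ent_mono[OF fin]; simp)+
  ultimately show ?thesis unfolding cond_ent_def by linarith
qed

text \<open>Sums of \<open>k\<close> independent vectors and of their lower cell corners at the fine level \<open>fl\<close> are
  coupled so closely that their cells at the coarser level \<open>l\<close> are equal or adjacent.\<close>

lemma cell_law_convolution_power:
  fixes \<theta> :: "(real ^ 'n) measure" and fl l :: "'n \<Rightarrow> int"
  assumes \<theta>: "prob_space \<theta>" "sets \<theta> = sets borel"
    and P0: "\<And>A. measure_pmf.prob P0 A = measure \<theta> (cell fl -` A)" and fin0: "finite (set_pmf P0)"
    and coarse: "\<And>i. real k * 2 powi (- fl i) \<le> 2 powi (- l i)"
  obtains P where "\<And>A. measure_pmf.prob P A = measure (convolution_power \<theta> k) (cell l -` A)"
    "finite (set_pmf P)"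
    "\<bar>ent P (\<lambda>w. w) - cell_ent (conv_power (map_pmf (corner fl) P0) k) l\<bar> \<le> real CARD('n)"
proof -
  let ?g = "\<lambda>x. corner fl (cell fl x)"
  let ?p = "map_pmf (corner fl) P0"
  let ?q = "conv_power ?p k"
  have m\<theta>: "f \<in> measurable \<theta> N \<longleftrightarrow> f \<in> measurable borel N" for f :: "_ \<Rightarrow> 'z" and N
    by (simp only: measurable_cong_sets[OF \<theta>(2) refl])
  have g: "?g \<in> borel_measurable borel" by (rule measurable_corner_cell)
  have sp: "space \<theta> = UNIV" using sets_eq_imp_space_eq[OF \<theta>(2)] by simp
  have pair: "(\<lambda>x. (x, ?g x)) \<in> borel_measurable \<theta>"
    unfolding m\<theta> using g by measurable
  \<comment> \<open>The law of a point together with its corner. Its convolution power couples the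
    sum of the points with the sum of their corners.\<close>
  define \<theta>2 where "\<theta>2 = distr \<theta> borel (\<lambda>x. (x, ?g x))"
  have \<theta>2: "prob_space \<theta>2" "sets \<theta>2 = sets borel"
    unfolding \<theta>2_def using pair \<theta> by (auto intro: prob_space.prob_space_distr)
  define \<mu> where "\<mu> = convolution_power \<theta>2 k"
  have \<mu>: "prob_space \<mu>" "sets \<mu> = sets borel" "space \<mu> = UNIV"
    unfolding \<mu>_def by (rule prob_space_convolution_power[OF \<theta>2], rule sets_convolution_power, rule space_convolution_power)
  interpret \<mu>: prob_space \<mu> by (rule \<mu>)
  have fst_m: "fst \<in> borel_measurable (borel :: ((real ^ 'n) \<times> (real ^ 'n)) measure)"
    "snd \<in> borel_measurable (borel :: ((real ^ 'n) \<times> (real ^ 'n)) measure)"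
    by (simp_all add: borel_prod[symmetric])
  have m\<mu>: "f \<in> measurable \<mu> N \<longleftrightarrow> f \<in> measurable borel N" for f :: "_ \<Rightarrow> 'z" and N
    by (simp only: measurable_cong_sets[OF \<mu>(2) refl])
  have fst_law: "distr \<mu> borel fst = convolution_power \<theta> k"
  proof -
    have "distr \<mu> borel fst = convolution_power (distr \<theta>2 borel fst) k"
      unfolding \<mu>_def by (rule distr_convolution_power[OF \<theta>2 fst_m(1)]) auto
    also have "distr \<theta>2 borel fst = distr \<theta> borel (fst \<circ> (\<lambda>x. (x, ?g x)))"
      unfolding \<theta>2_def by (rule distr_distr[OF fst_m(1) pair])
    also have "\<dots> = distr \<theta> \<theta> (\<lambda>x. x)"
      by (rule distr_cong) (auto simp: \<theta>)
    also have "\<dots> = \<theta>" by simp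
    finally show ?thesis .
  qed
  have snd_law: "distr \<mu> borel snd = distr (measure_pmf ?q) borel (\<lambda>x. x)"
  proof -
    have "distr \<mu> borel snd = convolution_power (distr \<theta>2 borel snd) k"
      unfolding \<mu>_def by (rule distr_convolution_power[OF \<theta>2 fst_m(2)]) auto
    also have "distr \<theta>2 borel snd = distr \<theta> borel (snd \<circ> (\<lambda>x. (x, ?g x)))"
      unfolding \<theta>2_def by (rule distr_distr[OF fst_m(2) pair])
    also have "\<dots> = distr \<theta> borel ?g" by (simp add: comp_def)
    also have "\<dots> = distr (measure_pmf ?p) borel (\<lambda>x. x)"
    proof (rule measure_eqI)
      fix A assume "A \<in> sets (distr \<theta> borel ?g)"
      then have A: "A \<in> sets borel" by simp
      interpret \<theta>: prob_space \<theta> by (rule \<theta>)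
      have "emeasure (distr \<theta> borel ?g) A = measure \<theta> (cell fl -` corner fl -` A)"
        using A g by (simp add: emeasure_distr m\<theta> sp \<theta>.emeasure_eq_measure vimage_def)
      also have "\<dots> = emeasure (distr (measure_pmf ?p) borel (\<lambda>x. x)) A"
        using A by (simp add: emeasure_distr P0[symmetric] measure_pmf.emeasure_eq_measure)
      finally show "emeasure (distr \<theta> borel ?g) A = emeasure (distr (measure_pmf ?p) borel (\<lambda>x. x)) A" .
    qed simp
    finally show ?thesis by (simp only: convolution_power_pmf)
  qed
  have measure_fst: "measure \<mu> (fst -` A) = measure (convolution_power \<theta> k) A" if "A \<in> sets borel" for A
    using that fst_m \<mu> by (simp add: fst_law[symmetric] measure_distr m\<mu>)
  have measure_snd: "measure \<mu> (snd -` A) = measure_pmf.prob ?q A" if A: "A \<in> sets borel" for A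
  proof -
    have "measure \<mu> (snd -` A) = measure (distr \<mu> borel snd) A" using A fst_m \<mu> by (simp add: measure_distr m\<mu>)
    also have "\<dots> = measure_pmf.prob ?q A" unfolding snd_law using A by (simp add: measure_distr)
    finally show ?thesis .
  qed
  \<comment> \<open>Corners lie below their points by at most one fine cell, so the error of the sum
    is one-sided and at most \<open>k\<close> fine cells; by \<open>coarse\<close> this is at most
    one cell of level \<open>l\<close>.\<close>
  define C where "C k s = (\<forall>i. snd s $ i \<le> fst s $ i \<and> fst s $ i \<le> snd s $ i + real k * 2 powi (- fl i))"
    for k and s :: "(real ^ 'n) \<times> (real ^ 'n)"
  have C_meas: "{s. C k s} \<in> sets borel" for k
  proof -
    have "closed {s. C k s}" unfolding C_def
      by (intro closed_Collect_all closed_Collect_conj closed_Collect_le continuous_intros)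
    then show ?thesis by (rule borel_closed)
  qed
  have AE_C: "AE s in \<mu>. C k s"
    unfolding \<mu>_def
  proof (rule AE_convolution_power[OF \<theta>2 C_meas])
    show "C 0 0" by (simp add: C_def)
    show "AE s in \<theta>2. C 1 s"
      unfolding \<theta>2_def
    proof (subst AE_distr_iff[OF pair])
      show "{s \<in> space borel. C 1 s} \<in> sets borel" using C_meas by simp
      show "AE x in \<theta>. C 1 (x, ?g x)"
        using cell_interval by (intro AE_I2) (auto simp: C_def corner_def)
    qed
    fix k s t assume st: "C 1 s" "C k t"
    show "C (Suc k) (s + t)"
      unfolding C_def
    proof
      fix i
      have "snd s $ i \<le> fst s $ i" "fst s $ i \<le> snd s $ i + 1 * 2 powi (- fl i)"
        "snd t $ i \<le> fst t $ i" "fst t $ i \<le> snd t $ i + real k * 2 powi (- fl i)"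
        using st by (simp_all add: C_def)
      moreover have "real (Suc k) * 2 powi (- fl i) = 1 * 2 powi (- fl i) + real k * 2 powi (- fl i)"
        by (simp add: distrib_right)
      ultimately show "snd (s + t) $ i \<le> fst (s + t) $ i \<and> fst (s + t) $ i \<le> snd (s + t) $ i + real (Suc k) * 2 powi (- fl i)"
        unfolding fst_add snd_add vector_add_component by linarith
    qed
  qed
  let ?H = "\<lambda>s. (cell l (fst s), cell l (snd s))"
  have H_vim: "?H -` {(a, b)} = fst -` (cell l -` {a}) \<inter> snd -` (cell l -` {b})" for a b by auto
  have fst_sets: "fst -` A \<in> sets \<mu>" "snd -` A \<in> sets \<mu>" if "A \<in> sets borel" for A :: "(real ^ 'n) set"
    using measurable_sets[OF fst_m(1) that] measurable_sets[OF fst_m(2) that] by (simp_all add: \<mu>)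
  have H: "?H \<in> measurable \<mu> (count_space UNIV)"
    unfolding measurable_count_space_eq2_countable
    using fst_sets[OF cell_vimage_sets] by (auto simp: \<mu> H_vim)
  obtain J where J: "\<And>A. measure_pmf.prob J A = measure \<mu> (?H -` A)"
    using pmf_of_countable_law[OF \<mu>(1) H] by (auto simp: \<mu>)
  have pmfJ: "pmf J x = measure \<mu> (?H -` {x})" for x by (simp add: J[symmetric] pmf.rep_eq)
  \<comment> \<open>A pair of cells that no point satisfying \<open>C k\<close> visits is null, so
    every atom of \<open>J\<close> is realized by such a point.\<close>
  have close: "a i \<in> {b i, b i + 1}" if ab: "(a, b) \<in> set_pmf J" for a b i
  proof -
    have "measure \<mu> (?H -` {(a, b)}) \<noteq> 0" using ab by (simp add: pmfJ[symmetric] set_pmf_iff)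
    moreover have "measure \<mu> (?H -` {(a, b)}) = 0" if "\<And>s. C k s \<Longrightarrow> s \<notin> ?H -` {(a, b)}"
    proof -
      have "AE s in \<mu>. s \<notin> ?H -` {(a, b)}" using AE_C by eventually_elim (rule that)
      moreover have "?H -` {(a, b)} \<in> sets \<mu>" using fst_sets[OF cell_vimage_sets] by (auto simp: H_vim)
      ultimately show ?thesis using \<mu>.prob_eq_0 by blast
    qed
    ultimately obtain s where s: "C k s" "?H s = (a, b)" by blast
    have *: "2 powi (l i) * snd s $ i \<le> 2 powi (l i) * fst s $ i" using s(1) by (auto simp: C_def)
    have "fst s $ i \<le> snd s $ i + 2 powi (- l i)" using s(1) coarse[of i] unfolding C_def by (meson add_left_mono order_trans)
    then have "2 powi (l i) * fst s $ i \<le> 2 powi (l i) * (snd s $ i + 2 powi (- l i))" by (intro mult_left_mono) auto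
    also have "\<dots> = 2 powi (l i) * snd s $ i + 1" by (simp add: distrib_left power_int_minus)
    finally have **: "2 powi (l i) * fst s $ i \<le> 2 powi (l i) * snd s $ i + 1" .
    have "\<lfloor>y\<rfloor> \<in> {\<lfloor>x\<rfloor>, \<lfloor>x\<rfloor> + 1}" if "x \<le> y" "y \<le> x + 1" for x y :: real
      using floor_mono[OF that(1)] floor_mono[OF that(2)] by auto
    from this[OF * **] show ?thesis using s(2) by (auto simp: cell_def)
  qed
  have snd_eq: "map_pmf snd J = map_pmf (cell l) ?q"
  proof (rule pmf_eqI)
    fix b
    have "pmf (map_pmf snd J) b = measure \<mu> (snd -` (cell l -` {b}))"
      by (simp add: pmf_map J vimage_def)
    also have "\<dots> = pmf (map_pmf (cell l) ?q) b"
      using measure_snd[OF cell_vimage_sets[of l "{b}"]] by (simp add: pmf_map)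
    finally show "pmf (map_pmf snd J) b = pmf (map_pmf (cell l) ?q) b" .
  qed
  have finq: "finite (set_pmf ?q)" by (rule finite_conv_power) (simp add: fin0)
  \<comment> \<open>The second marginal has finite support, and adjacency leaves finitely many first
    labels for each second one.\<close>
  have finJ: "finite (set_pmf J)"
  proof -
    have fin_snd: "finite (snd ` set_pmf J)"
      using arg_cong[OF snd_eq, of set_pmf] finq by simp
    have "set_pmf J \<subseteq> (\<Union>b\<in>snd ` set_pmf J. {z. \<forall>i. z i \<in> {b i..<b i + int 2}} \<times> {b})"
    proof
      fix x assume x: "x \<in> set_pmf J"
      have "fst x i \<in> {snd x i..<snd x i + int 2}" for i
        using close[of "fst x" "snd x" i] x by auto
      then have "fst x \<in> {z. \<forall>i. z i \<in> {snd x i..<snd x i + int 2}}" by blast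
      then show "x \<in> (\<Union>b\<in>snd ` set_pmf J. {z. \<forall>i. z i \<in> {b i..<b i + int 2}} \<times> {b})"
        using x by (intro UN_I[of "snd x"]) (auto simp: mem_Times_iff)
    qed
    then show ?thesis
      by (rule finite_subset) (intro finite_UN_I fin_snd finite_cartesian_product card_int_box(1), auto)
  qed
  show thesis
  proof (rule that[of "map_pmf fst J"])
    show "measure_pmf.prob (map_pmf fst J) A = measure (convolution_power \<theta> k) (cell l -` A)" for A
      using measure_fst[OF cell_vimage_sets[of l A]] by (simp add: J vimage_def)
    show "finite (set_pmf (map_pmf fst J))" using finJ by simp
    have "ent J snd = cell_ent ?q l"
      using arg_cong[OF snd_eq, of "\<lambda>P. ent P (\<lambda>w. w)"] by (simp add: ent_map_pmf cell_ent_def)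
    moreover have "\<bar>ent J fst - ent J snd\<bar> \<le> real CARD('n)"
      by (rule ent_diff_le[OF finJ]) (rule close)
    ultimately show "\<bar>ent (map_pmf fst J) (\<lambda>w. w) - cell_ent ?q l\<bar> \<le> real CARD('n)"
      by (simp add: ent_map_pmf)
  qed
qed

text \<open>By the Lindelof property, countably many open null sets cover the complement of the
  support.\<close>

lemma AE_measure_support:
  fixes \<theta> :: "'a::second_countable_topology measure"
  assumes "sets \<theta> = sets borel"
  shows "AE x in \<theta>. x \<in> measure_support \<theta>"
proof -
  let ?F = "{U. open U \<and> emeasure \<theta> U = 0}"
  obtain F' where F': "F' \<subseteq> ?F" "countable F'" "\<Union>F' = \<Union>?F"
    using Lindelof[of ?F] by auto
  have "(\<Union>U\<in>F'. U) \<in> null_sets \<theta>"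
    by (rule null_sets_UN'[OF F'(2)]) (use F'(1) assms in \<open>auto simp: null_sets_def\<close>)
  moreover have "{x \<in> space \<theta>. x \<notin> measure_support \<theta>} \<subseteq> (\<Union>U\<in>F'. U)"
    using F'(3) by (auto simp: measure_support_def not_gr_zero)
  ultimately show ?thesis by (rule AE_I')
qed

lemma (in multiscale) G_le_sum:
  assumes "0 \<le> L"
  shows "G K J q L \<le> (\<Sum>i\<in>J. G K {i} q L)"
proof (induction J rule: finite_induct[OF finite])
  case (2 i J)
  then show ?case using G_submod[of "{}" J i L K q] assms by (simp add: G_empty)
qed (simp add: G_empty)

lemma finite_cell_image:
  fixes S :: "(real ^ 'n) set"
  assumes "bounded S"
  shows "finite (cell l ` S)"
proof -
  obtain B where B: "\<And>x. x \<in> S \<Longrightarrow> norm x \<le> B" using assms by (auto simp: bounded_iff)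
  let ?I = "\<lambda>i. {\<lfloor>- (2 powi (l i) * B)\<rfloor>..\<lfloor>2 powi (l i) * B\<rfloor>}"
  have "cell l ` S \<subseteq> (\<Pi>\<^sub>E i\<in>UNIV. ?I i)"
  proof clarify
    fix x assume "x \<in> S"
    have "cell l x i \<in> ?I i" for i
    proof -
      have "\<bar>x $ i\<bar> \<le> B" using component_le_norm_cart[of x i] B[OF \<open>x \<in> S\<close>] by simp
      then have "x $ i \<le> B" "- B \<le> x $ i" by auto
      then have "2 powi (l i) * x $ i \<le> 2 powi (l i) * B" "2 powi (l i) * - B \<le> 2 powi (l i) * x $ i"
        by (intro mult_left_mono; simp)+
      then show ?thesis unfolding cell_def by (auto intro!: floor_mono)
    qed
    then show "cell l x \<in> (\<Pi>\<^sub>E i\<in>UNIV. ?I i)" by (auto simp: PiE_def)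
  qed
  then show ?thesis by (rule finite_subset) (intro finite_PiE, auto)
qed

text \<open>For the entropy at scale 0: the bound involves the diameter only, since the position of
  the support is arbitrary.\<close>

lemma card_cell_image_le:
  fixes S :: "(real ^ 'n) set"
  assumes "bounded S" "diameter S \<le> real N"
  shows "card (cell (\<lambda>_. 0) ` S) \<le> (2 * N + 3) ^ CARD('n)"
proof (cases "S = {}")
  case False
  then obtain x0 where x0: "x0 \<in> S" by blast
  have "cell (\<lambda>_. 0) ` S \<subseteq> {z. \<forall>i. z i \<in> {\<lfloor>x0 $ i\<rfloor> - int N - 1..<(\<lfloor>x0 $ i\<rfloor> - int N - 1) + int (2 * N + 3)}}"
  proof clarify
    fix x i assume x: "x \<in> S"
    have "\<bar>x $ i - x0 $ i\<bar> \<le> dist x x0"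
      using component_le_norm_cart[of "x - x0" i] by (simp add: dist_norm)
    also have "\<dots> \<le> real N" using diameter_bounded_bound[OF assms(1) x x0] assms(2) by simp
    finally have "\<lfloor>x0 $ i\<rfloor> - int N - 1 \<le> \<lfloor>x $ i\<rfloor>" "\<lfloor>x $ i\<rfloor> < (\<lfloor>x0 $ i\<rfloor> - int N - 1) + int (2 * N + 3)"
      by linarith+
    then show "cell (\<lambda>_. 0) x i \<in> {\<lfloor>x0 $ i\<rfloor> - int N - 1..<(\<lfloor>x0 $ i\<rfloor> - int N - 1) + int (2 * N + 3)}"
      by (simp add: cell_def)
  qed
  from card_mono[OF card_int_box(1) this] show ?thesis by (simp only: card_int_box(2))
qed simp

text \<open>The conditional entropy is a difference of entropies at the levels \<open>l\<close> and
  \<open>l'\<close>, and replacing the sum by that of the corners costs \<open>CARD('n)\<close> bits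
  at each of them.\<close>

lemma cond_entropy_convolution_ge:
  fixes chi :: "'n::finite \<Rightarrow> real" and j :: 'n and q m :: int and \<theta> :: "(real ^ 'n) measure"
  assumes \<theta>: "prob_space \<theta>" "sets \<theta> = sets borel" and chi: "\<And>i. 0 < chi i" and "0 \<le> m"
    and P0: "\<And>A. measure_pmf.prob P0 A = measure \<theta> (cell fl -` A)" and fin0: "finite (set_pmf P0)"
    and coarse: "\<And>i. real k * 2 powi (- fl i) \<le> 2 powi (- scale_levels chi (q + m) i)"
  defines "l \<equiv> scale_levels chi (q + m)"
  defines "l' \<equiv> l(j := scale_levels chi q j)"
  defines "p \<equiv> conv_power (map_pmf (corner fl) P0) k"
  shows "cell_ent p l - cell_ent p l' - 2 * real CARD('n) \<le>
    cond_partition_entropy (convolution_power \<theta> k) (box_partition chi (q + m))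
      (common_refinement (box_partition chi q)
        (pullback_partition (coord_proj (UNIV - {j})) (box_partition chi (q + m))))"
proof -
  let ?M = "convolution_power \<theta> k"
  have "scale_levels chi q j \<le> l j"
    unfolding l_def scale_levels_def using chi[of j] \<open>0 \<le> m\<close> by (intro floor_mono mult_left_mono) auto
  then have le: "l' \<le> l" by (simp add: l'_def le_fun_def)
  have coarse': "real k * 2 powi (- fl i) \<le> 2 powi (- l' i)" for i
  proof -
    have "(2::real) powi (- l i) \<le> 2 powi (- l' i)" using le by (intro power_int_increasing) (auto simp: le_fun_def)
    then show ?thesis using coarse[of i] by (simp add: l_def)
  qed
  obtain P where P: "\<And>A. measure_pmf.prob P A = measure ?M (cell l -` A)" "finite (set_pmf P)"
    "\<bar>ent P (\<lambda>w. w) - cell_ent p l\<bar> \<le> real CARD('n)"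
    unfolding p_def using cell_law_convolution_power[OF \<theta> P0 fin0 coarse[folded l_def]] by blast
  obtain P' where P': "\<And>A. measure_pmf.prob P' A = measure ?M (cell l' -` A)" "finite (set_pmf P')"
    "\<bar>ent P' (\<lambda>w. w) - cell_ent p l'\<bar> \<le> real CARD('n)"
    unfolding p_def using cell_law_convolution_power[OF \<theta> P0 fin0 coarse'] by blast
  \<comment> \<open>A cell of level \<open>l\<close> lies in a single cell of level
    \<open>l'\<close>, which can be read off from any of its points, here the corner.\<close>
  let ?r = "\<lambda>z. cell l' (corner l z)"
  have r: "?r (cell l x) = cell l' x" for x by (rule cell_cong[OF le]) (rule cell_corner)
  then have vim: "cell l -` ?r -` A = cell l' -` A" for A by auto
  have "map_pmf ?r P = P'"
    by (rule pmf_eqI) (simp add: pmf_map P(1) vim P'(1)[symmetric] pmf.rep_eq)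
  then have P'_ent: "ent P ?r = ent P' (\<lambda>w. w)" using ent_map_pmf[of ?r P "\<lambda>w. w"] by simp
  have "cond_partition_entropy ?M (box_partition chi (q + m)) (common_refinement (box_partition chi q)
        (pullback_partition (coord_proj (UNIV - {j})) (box_partition chi (q + m)))) = ent P (\<lambda>w. w) - ent P ?r"
  proof (rule cond_partition_entropy_eq_ent[where h = "cell l"])
    show "prob_space ?M" by (rule prob_space_convolution_power[OF \<theta>])
    show "space ?M = UNIV" by (rule space_convolution_power)
    show "cell l -` A \<in> sets ?M" for A using cell_vimage_sets[of l A] by (simp add: sets_convolution_power)
    show "box_partition chi (q + m) - {{}} = {cell l -` {w} | w. True} - {{}}"
      by (simp add: box_partition_eq l_def)
    show "common_refinement (box_partition chi q)
        (pullback_partition (coord_proj (UNIV - {j})) (box_partition chi (q + m))) - {{}} = {cell l -` ?r -` {z} | z. True} - {{}}"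
      unfolding vim unfolding l'_def l_def by (rule conditioning_partition_eq[OF chi \<open>0 \<le> m\<close>])
  qed (use P in auto)
  then show ?thesis using P(3) P'(3) unfolding P'_ent by linarith
qed

text \<open>By monotonicity in \<open>\<epsilon>\<close> it suffices to treat \<open>\<epsilon> = 1 / N\<close>; this leaves only countably many
  thresholds to be dominated by a single function \<open>f\<close>.\<close>

definition growth_bound ::
  "('n::{finite,linorder} \<Rightarrow> real) \<Rightarrow> nat \<Rightarrow> real \<Rightarrow> nat \<Rightarrow> (nat \<Rightarrow> nat) \<Rightarrow> (nat \<Rightarrow> nat \<Rightarrow> nat) \<Rightarrow> bool"
where
  "growth_bound chi N \<delta> M K N0 \<longleftrightarrow> (\<forall>m k n \<theta>.
    (\<forall>j. M \<le> m j) \<longrightarrow> (\<forall>j. K (m j) \<le> k j) \<longrightarrow> (\<forall>j. N0 (m j) (k j) \<le> n) \<longrightarrow>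
    prob_space \<theta> \<longrightarrow> sets \<theta> = sets borel \<longrightarrow> compact (measure_support \<theta>) \<longrightarrow>
    diameter (measure_support \<theta>) \<le> real N \<longrightarrow>
    1 / real N < 1 / real n * partition_entropy \<theta> (box_partition chi (int n)) \<longrightarrow>
    (\<exists>j. \<delta> < 1 / real n * real (card (high_entropy_scales chi \<theta> (1 / real N) m k n j))))"

text \<open>The entropy rises from a bounded amount at scale 0 to at least \<open>n / N\<close> at
  scale \<open>n\<close>; for large \<open>n\<close> half of this remains as a sum of increments,
  and by subadditivity some coordinate receives the share \<open>\<rho>\<close>. As vectors are
  rounded at scale \<open>n\<close>, only scales well below \<open>n\<close> can be compared with
  the true convolution; the others are few.\<close>

lemma high_entropy_scales_reciprocal:
  fixes chi :: "'n::{finite,linorder} \<Rightarrow> real" and N :: nat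
  assumes chi: "\<And>i. 0 < chi i" and inj: "inj chi" and N: "0 < N"
  shows "\<exists>\<delta> M K N0. 0 < \<delta> \<and> growth_bound chi N \<delta> M K N0"
proof -
  let ?d = "real CARD('n)"
  let ?lv = "scale_levels chi"
  define c where "c = 14 + 3 * ?d"
  define \<rho> where "\<rho> = 1 / (2 * real N * ?d)"
  have d1: "1 \<le> ?d" by (simp add: Suc_le_eq)
  have \<rho>: "0 < \<rho>" "\<rho> * ?d = 1 / (2 * real N)" using N d1 by (auto simp: \<rho>_def)
  have c: "0 \<le> c" by (simp add: c_def)
  define Full where "Full \<delta> m K N \<longleftrightarrow> (\<forall>k\<ge>K. \<forall>n\<ge>N. \<forall>E j. multiscale chi E c \<longrightarrow>
    \<rho> * real n \<le> coord_increments chi E n j \<longrightarrow>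
    \<delta> * real n \<le> real (card (saturated_scales chi c E m k n j)))"
    for \<delta> :: real and m K N :: nat
  have "\<exists>\<delta>>0. \<exists>M0. \<forall>m\<ge>M0. \<exists>K0 N0. Full \<delta> m K0 N0"
    unfolding Full_def by (rule multiscale_main[OF chi inj c \<rho>(1)])
  then obtain \<delta> M0 where \<delta>: "0 < \<delta>" and "\<forall>m\<ge>M0. \<exists>K0 N0. Full \<delta> m K0 N0" by blast
  then obtain K0 N0 where "\<And>m. M0 \<le> m \<Longrightarrow> Full \<delta> m (K0 m) (N0 m)" by metis
  then have main: "\<delta> * real n \<le> real (card (saturated_scales chi c E m k n j))"
    if "M0 \<le> m" "K0 m \<le> k" "N0 m \<le> n" "multiscale chi E c" "\<rho> * real n \<le> coord_increments chi E n j"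
    for m k n E j
    using that unfolding Full_def by simp
  define \<nu> where "\<nu> = Min (range chi)"
  have \<nu>0: "0 < \<nu>" unfolding \<nu>_def using chi by (subst Min_gr_iff) auto
  have \<nu>_le: "\<nu> \<le> chi i" for i unfolding \<nu>_def by (rule Min_le) auto
  \<comment> \<open>This many scales contain at least \<open>k\<close> binary digits in each
    coordinate, enough for the rounding errors of \<open>k\<close> summands because
    \<open>k \<le> 2 ^ k\<close>.\<close>
  define C where "C k = nat \<lceil>(real k + 1) / \<nu>\<rceil>" for k
  have C: "real k + 1 \<le> chi i * real (C k)" for k i
  proof -
    have "real k + 1 = \<nu> * ((real k + 1) / \<nu>)" using \<nu>0 by simp
    also have "\<dots> \<le> chi i * real (C k)"
      using \<nu>0 \<nu>_le[of i] unfolding C_def by (intro mult_mono real_nat_ceiling_ge) auto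
    finally show ?thesis .
  qed
  \<comment> \<open>The total loss \<open>1 + c + 2 * ?d\<close> has to stay below
    \<open>m j / N\<close>.\<close>
  define M where "M = M0 + nat \<lceil>(1 + c + 2 * ?d) * real N\<rceil> + 1"
  \<comment> \<open>Besides \<open>N0\<close>: the entropy at scale 0 must be at most
    \<open>n / (2 * N)\<close>, and the discarded top scales must number less than
    \<open>\<delta> / 2 * n\<close>.\<close>
  define N1 where "N1 m k = N0 m + nat \<lceil>2 * real N * (?d * log 2 (real (2 * N + 3)))\<rceil> + nat \<lceil>real (m + C k) / (\<delta> / 2)\<rceil> + 1" for m k
  have "growth_bound chi N (\<delta> / 4) M K0 N1"
    unfolding growth_bound_def
  proof (intro allI impI)
    fix m k :: "'n \<Rightarrow> nat" and n :: nat and \<theta> :: "(real ^ ('n::{finite,linorder})) measure"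
    assume m: "\<forall>j. M \<le> m j" and k: "\<forall>j. K0 (m j) \<le> k j" and n: "\<forall>j. N1 (m j) (k j) \<le> n"
      and \<theta>: "prob_space \<theta>" "sets \<theta> = sets borel" and comp: "compact (measure_support \<theta>)"
      and diam: "diameter (measure_support \<theta>) \<le> real N"
      and ent_gt: "1 / real N < 1 / real n * partition_entropy \<theta> (box_partition chi (int n))"
    let ?S = "measure_support \<theta>"
    let ?fl = "?lv (int n)"
    interpret \<theta>: prob_space \<theta> by (rule \<theta>)
    have sp: "space \<theta> = UNIV" using sets_eq_imp_space_eq[OF \<theta>(2)] by simp
    have bS: "bounded ?S" using comp by (rule compact_imp_bounded)
    have cell_m: "cell ?fl \<in> measurable \<theta> (count_space UNIV)"
      using measurable_cell[of ?fl] by (simp only: measurable_cong_sets[OF \<theta>(2) refl])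
    obtain P0 where P0: "\<And>A. measure_pmf.prob P0 A = measure \<theta> (cell ?fl -` A)"
      using pmf_of_countable_law[OF \<theta>(1) cell_m] by (auto simp: sp)
    have P0_sub: "set_pmf P0 \<subseteq> cell ?fl ` ?S"
    proof
      fix z assume z: "z \<in> set_pmf P0"
      have "measure \<theta> (cell ?fl -` {z}) \<noteq> 0" using z by (simp add: P0[symmetric] pmf.rep_eq set_pmf_iff)
      moreover have "measure \<theta> (cell ?fl -` {z}) = 0" if "z \<notin> cell ?fl ` ?S"
      proof -
        have "AE x in \<theta>. x \<notin> cell ?fl -` {z}"
          using AE_measure_support[OF \<theta>(2)] by eventually_elim (use that in auto)
        moreover have "cell ?fl -` {z} \<in> sets \<theta>" using cell_vimage_sets[of ?fl "{z}"] by (simp add: \<theta>)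
        ultimately show ?thesis using \<theta>.prob_eq_0 by blast
      qed
      ultimately show "z \<in> cell ?fl ` ?S" by blast
    qed
    have fin0: "finite (set_pmf P0)" using finite_subset[OF P0_sub finite_cell_image[OF bS]] .
    define p where "p = map_pmf (corner ?fl) P0"
    have finp: "finite (set_pmf p)" using fin0 by (simp add: p_def)
    define E where "E K = cell_ent (conv_power p K)" for K
    have ms: "multiscale chi E c" unfolding E_def c_def by (rule multiscale_cell_ent[OF finp chi])
    interpret multiscale chi E c by (rule ms)
    have E1: "E 1 l = ent P0 (\<lambda>z. cell l (corner ?fl z))" for l
      unfolding E_def conv_power_1 by (simp add: p_def cell_ent_def ent_map_pmf)
    have n_pos: "0 < n" using n[rule_format, of undefined] by (simp add: N1_def)
    have top: "real n / real N \<le> E 1 ?fl"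
    proof -
      have "partition_entropy \<theta> (box_partition chi (int n)) = ent P0 (\<lambda>z. z)"
        by (rule partition_entropy_eq_ent[OF P0 fin0]) (simp add: box_partition_eq)
      moreover have "real n / real N = real n * (1 / real N)" by simp
      moreover have "real n * (1 / real N) \<le> real n * (1 / real n * partition_entropy \<theta> (box_partition chi (int n)))"
        using ent_gt by (intro mult_left_mono) auto
      ultimately show ?thesis unfolding E1 cell_corner using n_pos by simp
    qed
    have bottom: "E 1 (?lv 0) \<le> ?d * log 2 (real (2 * N + 3))"
    proof -
      have lv0: "?lv 0 = (\<lambda>_. 0)" by (simp add: scale_levels_def)
      have le: "(\<lambda>_. 0) \<le> ?fl" using chi by (simp add: le_fun_def scale_levels_def less_imp_le)
      have "(\<lambda>z. cell (\<lambda>_. 0) (corner ?fl z)) ` set_pmf P0 \<subseteq> cell (\<lambda>_. 0) ` ?S"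
      proof clarify
        fix z assume "z \<in> set_pmf P0"
        then obtain x where x: "x \<in> ?S" "z = cell ?fl x" using P0_sub by blast
        have "cell (\<lambda>_. 0) (corner ?fl z) = cell (\<lambda>_. 0) x"
          by (rule cell_cong[OF le]) (simp add: cell_corner x(2))
        then show "cell (\<lambda>_. 0) (corner ?fl z) \<in> cell (\<lambda>_. 0) ` ?S" using x(1) by simp
      qed
      then have "card ((\<lambda>z. cell (\<lambda>_. 0) (corner ?fl z)) ` set_pmf P0) \<le> (2 * N + 3) ^ CARD('n)"
        using card_mono[OF finite_cell_image[OF bS]] card_cell_image_le[OF bS diam] order_trans by blast
      then have "E 1 (?lv 0) \<le> log 2 (real ((2 * N + 3) ^ CARD('n)))"
        unfolding E1 lv0 by (rule ent_le_log_card[OF fin0])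
      also have "\<dots> = ?d * log 2 (real (2 * N + 3))" by (simp only: of_nat_power) (rule log_nat_power, simp)
      finally show ?thesis .
    qed
    have n_ge: "2 * real N * (?d * log 2 (real (2 * N + 3))) \<le> real n" "real (m j + C (k j)) / (\<delta> / 2) < real n" "N0 (m j) \<le> n" for j
    proof -
      have "0 \<le> log 2 (real (2 * N + 3))" by simp
      then have "0 \<le> 2 * real N * (?d * log 2 (real (2 * N + 3)))" by simp
      moreover have "0 \<le> real (m j + C (k j)) / (\<delta> / 2)" using \<delta> by simp
      ultimately show "2 * real N * (?d * log 2 (real (2 * N + 3))) \<le> real n" "real (m j + C (k j)) / (\<delta> / 2) < real n" "N0 (m j) \<le> n"
        using n[rule_format, of j] unfolding N1_def by linarith+
    qed
    have "\<rho> * real n * ?d \<le> (\<Sum>q\<in>{0..<int n}. G 1 UNIV q 1)"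
    proof -
      have "(\<Sum>q\<in>{0..<int n}. G 1 UNIV q 1) = (\<Sum>q\<in>int ` {..<n}. E 1 (?lv (q + 1)) - E 1 (?lv q))"
      proof (rule sum.cong)
        show "{0..<int n} = int ` {..<n}" by (simp add: image_int_atLeastLessThan lessThan_atLeast0)
      qed (simp add: G_def lev_def)
      also have "\<dots> = (\<Sum>i<n. E 1 (?lv (int (Suc i))) - E 1 (?lv (int i)))"
        by (subst sum.reindex) (auto simp: add.commute)
      also have "\<dots> = E 1 ?fl - E 1 (?lv 0)"
        using sum_lessThan_telescope[of "\<lambda>i. E 1 (?lv (int i))" n] by simp
      also have "\<dots> \<ge> real n / real N - real n / (2 * real N)"
      proof -
        have "?d * log 2 (real (2 * N + 3)) \<le> real n / (2 * real N)"
          using n_ge(1) N by (simp add: le_divide_eq mult_ac)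
        then show ?thesis using top bottom by linarith
      qed
      finally have "real n / real N - real n / (2 * real N) \<le> (\<Sum>q\<in>{0..<int n}. G 1 UNIV q 1)" .
      moreover have "real n / real N - real n / (2 * real N) = real n * (1 / (2 * real N))" using N by (simp add: field_simps)
      moreover have "\<rho> * real n * ?d = real n * (\<rho> * ?d)" by simp
      ultimately show ?thesis by (simp only: \<rho>(2))
    qed
    also have "\<dots> \<le> (\<Sum>q\<in>{0..<int n}. \<Sum>j\<in>UNIV. G 1 {j} q 1)" by (intro sum_mono G_le_sum) simp
    also have "\<dots> = (\<Sum>j\<in>UNIV. \<Sum>q\<in>{0..<int n}. G 1 {j} q 1)" by (rule sum.swap)
    finally have total: "\<rho> * real n * ?d \<le> (\<Sum>j\<in>UNIV. \<Sum>q\<in>{0..<int n}. G 1 {j} q 1)" .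
    have "\<exists>j. \<rho> * real n \<le> (\<Sum>q\<in>{0..<int n}. G 1 {j} q 1)"
    proof (rule ccontr)
      assume "\<not> ?thesis"
      then have "(\<Sum>j\<in>(UNIV::'n set). \<Sum>q\<in>{0..<int n}. G 1 {j} q 1) < (\<Sum>j\<in>(UNIV::'n set). \<rho> * real n)"
        by (intro sum_strict_mono) (auto simp: not_le)
      then show False using total by (simp add: mult.commute)
    qed
    then obtain j where "\<rho> * real n \<le> (\<Sum>q\<in>{0..<int n}. G 1 {j} q 1)" by blast
    also have "\<dots> = coord_increments chi E n j"
      unfolding G_def coord_increments_def
      by (intro sum.cong refl arg_cong2[of _ _ _ _ "(-)"] arg_cong[of _ _ "E 1"]) (auto simp: lev_def)
    finally have hyp: "\<rho> * real n \<le> coord_increments chi E n j" .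
    let ?Q = "saturated_scales chi c E (m j) (k j) n j"
    let ?H = "high_entropy_scales chi \<theta> (1 / real N) m k n j"
    have "M0 \<le> m j" using m[rule_format, of j] by (simp add: M_def)
    then have card_Q: "\<delta> * real n \<le> real (card ?Q)"
      by (rule main[OF _ k[rule_format] n_ge(3) ms hyp])
    have finH: "finite ?H" by (rule finite_subset[of _ "{1..int n}"]) (auto simp: high_entropy_scales_def)
    let ?top = "{int n - int (m j + C (k j))<..int n}"
    have "?Q \<subseteq> ?H \<union> ?top"
    proof
      fix q assume q: "q \<in> ?Q"
      show "q \<in> ?H \<union> ?top"
      proof (cases "q \<in> ?top")
        case False
        then have q_le: "q + int (m j) + int (C (k j)) \<le> int n" using q by (auto simp: saturated_scales_def)
        have coarse: "real (k j) * 2 powi (- ?fl i) \<le> 2 powi (- ?lv (q + int (m j)) i)" for i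
        proof -
          have "chi i * real (C (k j)) \<le> chi i * real_of_int (int n - (q + int (m j)))"
            using chi[of i] q_le by (intro mult_left_mono) linarith+
          then have "real (k j) \<le> real_of_int (?fl i - ?lv (q + int (m j)) i)"
            using C[of "k j" i] lv_diff(2)[of i "int n" "q + int (m j)"] by linarith
          then have k_le: "int (k j) \<le> ?fl i - ?lv (q + int (m j)) i" by linarith
          have "real (k j) \<le> 2 ^ k j" by (rule less_imp_le[OF of_nat_less_two_power])
          also have "\<dots> = (2::real) powi int (k j)" by simp
          also have "\<dots> \<le> 2 powi (?fl i - ?lv (q + int (m j)) i)" using k_le by (rule power_int_increasing) simp
          finally have "real (k j) * 2 powi (- ?fl i) \<le> 2 powi (?fl i - ?lv (q + int (m j)) i) * 2 powi (- ?fl i)"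
            by (intro mult_right_mono) auto
          also have "\<dots> = 2 powi (- ?lv (q + int (m j)) i)" by (simp add: power_int_add[symmetric])
          finally show ?thesis .
        qed
        let ?ce = "cond_partition_entropy (convolution_power \<theta> (k j)) (box_partition chi (q + int (m j)))
          (common_refinement (box_partition chi q)
            (pullback_partition (coord_proj (UNIV - {j})) (box_partition chi (q + int (m j)))))"
        have "E (k j) (?lv (q + int (m j))) - E (k j) ((?lv (q + int (m j)))(j := ?lv q j)) - 2 * ?d \<le> ?ce"
          unfolding E_def p_def by (rule cond_entropy_convolution_ge[OF \<theta> chi _ P0 fin0 coarse]) simp
        then have ce: "chi j * real (m j) - 1 - c - 2 * ?d \<le> ?ce" using q by (auto simp: saturated_scales_def)
        have "nat \<lceil>(1 + c + 2 * ?d) * real N\<rceil> + 1 \<le> m j" using m[rule_format, of j] by (simp add: M_def)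
        then have "(1 + c + 2 * ?d) * real N < real (m j)" by linarith
        then have mj: "1 + c + 2 * ?d < 1 / real N * real (m j)" using N by (simp add: less_divide_eq)
        have m_pos: "0 < real (m j)" using m[rule_format, of j] by (simp add: M_def)
        have "(chi j - 1 / real N) * real (m j) < ?ce" using ce mj unfolding left_diff_distrib by linarith
        then have "chi j - 1 / real N < ?ce / real (m j)" using m_pos by (simp only: less_divide_eq if_True)
        then have "q \<in> ?H" using q by (simp add: high_entropy_scales_def saturated_scales_def)
        then show ?thesis by simp
      qed simp
    qed
    then have "card ?Q \<le> card (?H \<union> ?top)" using finH by (intro card_mono) auto
    also have "\<dots> \<le> card ?H + card ?top" by (rule card_Un_le)
    also have "card ?top = m j + C (k j)" by simp
    finally have "real (card ?Q) \<le> real (card ?H) + real (m j + C (k j))" by linarith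
    moreover have "real (m j + C (k j)) < \<delta> / 2 * real n"
      using n_ge(2)[of j] \<delta> by (simp add: divide_less_eq mult_ac)
    ultimately have "\<delta> / 2 * real n < real (card ?H)" using card_Q by simp
    moreover have "\<delta> / 4 * real n \<le> \<delta> / 2 * real n" using \<delta> by (intro mult_right_mono) auto
    ultimately have "\<delta> / 4 * real n < real (card ?H)" by linarith
    then have "\<delta> / 4 < 1 / real n * real (card ?H)" using n_pos by (simp add: less_divide_eq)
    then show "\<exists>j. \<delta> / 4 < 1 / real n * real (card (high_entropy_scales chi \<theta> (1 / real N) m k n j))" by blast
  qed
  with \<delta> show ?thesis by (metis divide_pos_pos zero_less_numeral)
qed

theorem proposition1p15:
  fixes chi :: "'n::{finite,linorder} \<Rightarrow> real"
  assumes "\<And>j. 0 < chi j"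
    and "strict_mono chi"
  shows "\<exists>f :: real \<Rightarrow> real. (\<forall>x\<ge>1. f x \<ge> 1) \<and>
    (\<forall>\<epsilon>::real. 0 < \<epsilon> \<and> \<epsilon> < 1 \<longrightarrow>
      (\<exists>\<delta>::real. \<delta> > 0 \<and>
        (\<forall>(m :: 'n \<Rightarrow> nat) (k :: 'n \<Rightarrow> nat) (n :: nat) (\<theta> :: (real ^ ('n::{finite,linorder})) measure).
          (\<forall>j. 0 < m j) \<and> (\<forall>j. 0 < k j) \<and> 0 < n \<and>
          real (m (Max UNIV)) \<ge> f (inverse \<epsilon>) \<and>
          real n \<ge> f (real (k (Min UNIV))) \<and>
          (\<forall>j. real (k j) \<ge> f (real (m j))) \<and>
          (\<forall>i j. i < j \<and> {i<..<j} = {} \<longrightarrow> real (m i) \<ge> f (real (k j))) \<and>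
          prob_space \<theta> \<and> sets \<theta> = sets borel \<and>
          compact (measure_support \<theta>) \<and>
          diameter (measure_support \<theta>) \<le> inverse \<epsilon> \<and>
          1 / real n * partition_entropy \<theta> (box_partition chi (int n)) > \<epsilon>
          \<longrightarrow> (\<exists>j. 1 / real n * real (card (high_entropy_scales chi \<theta> \<epsilon> m k n j)) > \<delta>))))"
proof -
  have inj: "inj chi" using assms(2) by (rule strict_mono_imp_inj_on)
  have "\<forall>N. 0 < N \<longrightarrow> (\<exists>\<delta> M K N0. 0 < \<delta> \<and> growth_bound chi N \<delta> M K N0)"
    using high_entropy_scales_reciprocal[OF assms(1) inj] by blast
  then obtain \<delta> M K N0 where core: "\<And>N. 0 < N \<Longrightarrow> 0 < \<delta> N \<and> growth_bound chi N (\<delta> N) (M N) (K N) (N0 N)"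
    by metis
  \<comment> \<open>Summing over all smaller arguments makes \<open>F a\<close> dominate every
    threshold with arguments up to \<open>a\<close>. As \<open>f\<close> must not depend on
    \<open>\<epsilon>\<close>, the index \<open>N\<close> is one of these arguments.\<close>
  define F where "F a = a + (\<Sum>N\<le>a. M N) + (\<Sum>N\<le>a. \<Sum>m\<le>a. K N m) + (\<Sum>N\<le>a. \<Sum>m\<le>a. \<Sum>k\<le>a. N0 N m k)" for a
  have F_ge: "a \<le> F a" for a by (simp add: F_def)
  have F_M: "M N \<le> F a" if "N \<le> a" for N a
    using member_le_sum[of N "{..a}" M] that by (simp add: F_def)
  have F_K: "K N m \<le> F a" if "N \<le> a" "m \<le> a" for N m a
  proof -
    have "K N m \<le> (\<Sum>m\<le>a. K N m)" using that by (intro member_le_sum) auto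
    also have "\<dots> \<le> (\<Sum>N\<le>a. \<Sum>m\<le>a. K N m)"
      using that by (intro member_le_sum[of N "{..a}" "\<lambda>N. \<Sum>m\<le>a. K N m"]) auto
    finally show ?thesis by (simp add: F_def)
  qed
  have F_N0: "N0 N m k \<le> F a" if "N \<le> a" "m \<le> a" "k \<le> a" for N m k a
  proof -
    have "N0 N m k \<le> (\<Sum>k\<le>a. N0 N m k)" using that by (intro member_le_sum) auto
    also have "\<dots> \<le> (\<Sum>m\<le>a. \<Sum>k\<le>a. N0 N m k)"
      using that by (intro member_le_sum[of m "{..a}" "\<lambda>m. \<Sum>k\<le>a. N0 N m k"]) auto
    also have "\<dots> \<le> (\<Sum>N\<le>a. \<Sum>m\<le>a. \<Sum>k\<le>a. N0 N m k)"
      using that by (intro member_le_sum[of N "{..a}" "\<lambda>N. \<Sum>m\<le>a. \<Sum>k\<le>a. N0 N m k"]) auto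
    finally show ?thesis by (simp add: F_def)
  qed
  define f where "f x = 1 + real (F (nat \<lceil>x\<rceil>))" for x :: real
  have f_nat: "F a \<le> b" if "f (real a) \<le> real b" for a b
    using that by (simp add: f_def)
  show ?thesis
  proof (rule exI[of _ f], intro conjI allI impI)
    show "1 \<le> f x" for x by (simp add: f_def)
    fix \<epsilon> :: real assume \<epsilon>: "0 < \<epsilon> \<and> \<epsilon> < 1"
    define N where "N = nat \<lceil>inverse \<epsilon>\<rceil>"
    have N_ge: "inverse \<epsilon> \<le> real N" unfolding N_def by (rule real_nat_ceiling_ge)
    moreover have "0 < inverse \<epsilon>" using \<epsilon> by simp
    ultimately have N: "0 < N" using of_nat_0_less_iff[where ?'a = real] less_le_trans by blast
    have N_eps: "1 / real N \<le> \<epsilon>"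
      using N_ge \<epsilon> N by (simp add: field_simps)
    show "\<exists>\<delta>>0. \<forall>(m :: 'n \<Rightarrow> nat) (k :: 'n \<Rightarrow> nat) (n :: nat) (\<theta> :: (real ^ ('n::{finite,linorder})) measure).
          (\<forall>j. 0 < m j) \<and> (\<forall>j. 0 < k j) \<and> 0 < n \<and>
          real (m (Max UNIV)) \<ge> f (inverse \<epsilon>) \<and>
          real n \<ge> f (real (k (Min UNIV))) \<and>
          (\<forall>j. real (k j) \<ge> f (real (m j))) \<and>
          (\<forall>i j. i < j \<and> {i<..<j} = {} \<longrightarrow> real (m i) \<ge> f (real (k j))) \<and>
          prob_space \<theta> \<and> sets \<theta> = sets borel \<and>
          compact (measure_support \<theta>) \<and>
          diameter (measure_support \<theta>) \<le> inverse \<epsilon> \<and>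
          1 / real n * partition_entropy \<theta> (box_partition chi (int n)) > \<epsilon>
          \<longrightarrow> (\<exists>j. 1 / real n * real (card (high_entropy_scales chi \<theta> \<epsilon> m k n j)) > \<delta>)"
    proof (rule exI[of _ "\<delta> N"], intro conjI allI impI)
      show "0 < \<delta> N" using core[OF N] by simp
      fix m k :: "'n \<Rightarrow> nat" and n :: nat and \<theta> :: "(real ^ ('n::{finite,linorder})) measure"
      assume H: "(\<forall>j. 0 < m j) \<and> (\<forall>j. 0 < k j) \<and> 0 < n \<and>
          real (m (Max UNIV)) \<ge> f (inverse \<epsilon>) \<and>
          real n \<ge> f (real (k (Min UNIV))) \<and>
          (\<forall>j. real (k j) \<ge> f (real (m j))) \<and>
          (\<forall>i j. i < j \<and> {i<..<j} = {} \<longrightarrow> real (m i) \<ge> f (real (k j))) \<and>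
          prob_space \<theta> \<and> sets \<theta> = sets borel \<and>
          compact (measure_support \<theta>) \<and>
          diameter (measure_support \<theta>) \<le> inverse \<epsilon> \<and>
          1 / real n * partition_entropy \<theta> (box_partition chi (int n)) > \<epsilon>"
      have mMax: "F N \<le> m (Max UNIV)" using H by (simp add: f_def N_def)
      have nMin: "F (k (Min UNIV)) \<le> n" using H f_nat by blast
      have km: "F (m j) \<le> k j" for j using H f_nat by blast
      have mk: "F (k j) \<le> m i" if "i < j" "{i<..<j} = {}" for i j using H f_nat that by blast
      \<comment> \<open>Only neighbouring indices are linked by the hypotheses; through the
        successor \<open>s\<close> of \<open>i\<close> the chain is
        \<open>k j \<le> m s \<le> k s \<le> m i\<close>. So \<open>m (Max UNIV)\<close> is the
        smallest of the \<open>m j\<close> and \<open>k (Min UNIV)\<close> the largest of the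
        \<open>k j\<close>.\<close>
      have le: "k j \<le> m i" if "i < j" for i j
        using that
      proof (induction "card {i<..j}" arbitrary: i rule: less_induct)
        case less
        define s where "s = Min {i<..}"
        have s: "i < s" "s \<le> j" "{i<..<s} = {}"
        proof -
          have "s \<in> {i<..}" unfolding s_def using less.prems by (intro Min_in) auto
          then show "i < s" by simp
          show "s \<le> j" unfolding s_def using less.prems by (intro Min_le) auto
          have "s \<le> x" if "i < x" for x unfolding s_def using that by (intro Min_le) auto
          then show "{i<..<s} = {}" by (force dest: leD)
        qed
        show ?case
        proof (cases "s = j")
          case True
          then show ?thesis using mk[OF s(1,3)] F_ge[of "k s"] by simp
        next
          case False
          then have "s < j" using s(2) by simp
          moreover have "card {s<..j} < card {i<..j}"
            using s \<open>s < j\<close> by (intro psubset_card_mono) auto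
          ultimately have "k j \<le> m s" using less.hyps by blast
          also have "m s \<le> k s" using km[of s] F_ge[of "m s"] by simp
          also have "k s \<le> m i" using mk[OF s(1,3)] F_ge[of "k s"] by simp
          finally show ?thesis .
        qed
      qed
      have m_ge: "F N \<le> m j" for j
      proof (cases "j = Max UNIV")
        case True
        then show ?thesis using mMax by simp
      next
        case False
        have "j \<le> Max UNIV" by (rule Max_ge) auto
        then have "k (Max UNIV) \<le> m j" using False by (intro le le_neq_trans)
        then show ?thesis using mMax km[of "Max UNIV"] F_ge[of "m (Max UNIV)"] by simp
      qed
      have k_le: "k j \<le> k (Min UNIV)" for j
      proof (cases "j = Min UNIV")
        case False
        have "Min UNIV \<le> j" by (rule Min_le) auto
        then have "k j \<le> m (Min UNIV)" using False[symmetric] by (intro le le_neq_trans)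
        then show ?thesis using km[of "Min UNIV"] F_ge[of "m (Min UNIV)"] by simp
      qed simp
      have N_m: "N \<le> m j" for j using m_ge[of j] F_ge[of N] by simp
      have m_k: "m j \<le> k j" for j using km[of j] F_ge[of "m j"] by simp
      have 1: "M N \<le> m j" for j using F_M[of N N] m_ge[of j] by simp
      have 2: "K N (m j) \<le> k j" for j using F_K[of N "m j" "m j"] km[of j] N_m[of j] by simp
      \<comment> \<open>All three arguments are at most \<open>k (Min UNIV)\<close>, whose image
        under \<open>F\<close> bounds \<open>n\<close> from below.\<close>
      have 3: "N0 N (m j) (k j) \<le> n" for j
      proof -
        have "N0 N (m j) (k j) \<le> F (k (Min UNIV))"
          using N_m[of j] m_k[of j] k_le[of j] by (intro F_N0) auto
        then show ?thesis using nMin by simp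
      qed
      have "diameter (measure_support \<theta>) \<le> real N" using H N_ge by linarith
      moreover have "1 / real N < 1 / real n * partition_entropy \<theta> (box_partition chi (int n))"
        using H N_eps by linarith
      ultimately obtain j where j: "\<delta> N < 1 / real n * real (card (high_entropy_scales chi \<theta> (1 / real N) m k n j))"
        using core[OF N] H 1 2 3 unfolding growth_bound_def by blast
      have "card (high_entropy_scales chi \<theta> (1 / real N) m k n j) \<le> card (high_entropy_scales chi \<theta> \<epsilon> m k n j)"
      proof (rule card_mono)
        show "finite (high_entropy_scales chi \<theta> \<epsilon> m k n j)"
          by (rule finite_subset[of _ "{1..int n}"]) (auto simp: high_entropy_scales_def)
        show "high_entropy_scales chi \<theta> (1 / real N) m k n j \<subseteq> high_entropy_scales chi \<theta> \<epsilon> m k n j"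
          using N_eps by (auto simp: high_entropy_scales_def)
      qed
      then have "1 / real n * real (card (high_entropy_scales chi \<theta> (1 / real N) m k n j)) \<le>
        1 / real n * real (card (high_entropy_scales chi \<theta> \<epsilon> m k n j))"
        by (intro mult_left_mono) auto
      then show "\<exists>j. 1 / real n * real (card (high_entropy_scales chi \<theta> \<epsilon> m k n j)) > \<delta> N"
        using j by (intro exI[of _ j]) linarith
    qed
  qed
qed

end
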